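(* Let $\mathcal{C}$ be a (strict) monoidal category. Evaluation at the cosimplicial monoid $S^*$ of $\overline{\Omega}_2$ is an equivalence between the category of monoidal functors $\overline{\Omega}_2\to\mathcal{C}$ (with monoidal natural transformations as morphisms) and the category of cosimplicial monoids in $\mathcal{C}$.
   Context: Monoidal functors are strong. $[n]=\{1,\dots,n\}$ with its usual order. A cosimplicial monoid in $\mathcal{C}$ is a functor from the category of the nonempty finite ordinals $[n]$, $n\ge1$, and order-preserving maps to the category $\mathrm{Mon}(\mathcal{C})$ of monoids and monoid homomorphisms in $\mathcal{C}$; morphisms of cosimplicial monoids are natural transformations. The category $\overline{\Omega}_2$ of pruned trees of height 2: objects are surjections (not necessarily order-preserving) $t:T_2\to T_1$ of finite (totally) ordered sets; a morphism from $s:S_2\to S_1$ to $t:T_2\to T_1$ is a pair of maps $f_2:S_2\to T_2$, $f_1:S_1\to T_1$ with $t f_2=f_1 s$, such that $f_1$ is order-preserving and $f_2$ is order-preserving on fibres, i.e. for every $x\in S_1$ the restriction $f_2:s^{-1}(x)\to t^{-1}(f_1(x))$ is order-preserving. The monoidal structure is the ordered sum (ordered disjoint union), with unit object $\emptyset\to\emptyset$. The cosimplicial monoid $S^*$ in $\overline{\Omega}_2$: for a nonempty finite ordered set $X$ let $S(X)=(X\to[1])$, with multiplication $S(X)\otimes S(X)=(X\cup X\to[2])\to(X\to[1])=S(X)$ given by the pair consisting of the codiagonal $X\cup X\to X$ (identity on each copy) and the unique map $[2]\to[1]$, and with unit the unique morphism $(\emptyset\to\emptyset)\to(X\to[1])$.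 An order-preserving map $X\to Y$ induces a homomorphism of monoids $S(X)\to S(Y)$. $S^n=S([n])$. Evaluation at $S^*$ sends a monoidal functor $F$ to the cosimplicial monoid $[n]\mapsto F(S([n]))$. *)

theory Defs
  imports "HOL-Library.FuncSet" "HOL-Library.Nat_Bijection"
begin

section \<open>Categories, functors, natural transformations\<close>

record ('o, 'a) cat =
  Obj :: "'o set"
  Arr :: "'a set"
  Dom :: "'a \<Rightarrow> 'o"
  Cod :: "'a \<Rightarrow> 'o"
  Ident :: "'o \<Rightarrow> 'a"
  Comp :: "'a \<Rightarrow> 'a \<Rightarrow> 'a"  (infixl "\<cdot>\<index>" 55)

definition hom :: "('o, 'a, 'm) cat_scheme \<Rightarrow> 'o \<Rightarrow> 'o \<Rightarrow> 'a set" where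
  "hom C x y = {f \<in> Arr C. Dom C f = x \<and> Cod C f = y}"

text \<open>Composition is written in the order of application of functions, \<open>g \<cdot> f\<close> being \<open>g\<close> after
  \<open>f\<close>; it is unspecified on pairs of arrows that are not composable.\<close>

locale category =
  fixes C :: "('o, 'a, 'm) cat_scheme" (structure)
  assumes dom_obj: "f \<in> Arr C \<Longrightarrow> Dom C f \<in> Obj C"
    and cod_obj: "f \<in> Arr C \<Longrightarrow> Cod C f \<in> Obj C"
    and ident_hom: "x \<in> Obj C \<Longrightarrow> Ident C x \<in> hom C x x"
    and comp_hom: "\<lbrakk>f \<in> hom C x y; g \<in> hom C y z\<rbrakk> \<Longrightarrow> g \<cdot> f \<in> hom C x z"
    and comp_ident: "f \<in> hom C x y \<Longrightarrow> f \<cdot> Ident C x = f"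
    and ident_comp: "f \<in> hom C x y \<Longrightarrow> Ident C y \<cdot> f = f"
    and comp_assoc: "\<lbrakk>f \<in> hom C w x; g \<in> hom C x y; h \<in> hom C y z\<rbrakk>
      \<Longrightarrow> h \<cdot> (g \<cdot> f) = (h \<cdot> g) \<cdot> f"

definition isos :: "('o, 'a, 'm) cat_scheme \<Rightarrow> 'o \<Rightarrow> 'o \<Rightarrow> 'a set" where
  "isos C x y = {f \<in> hom C x y. \<exists>g \<in> hom C y x.
     g \<cdot>\<^bsub>C\<^esub> f = Ident C x \<and> f \<cdot>\<^bsub>C\<^esub> g = Ident C y}"

text \<open>A category presented by a set \<open>X\<close> of objects and a family \<open>H x y\<close> of not necessarily disjoint
  hom-sets: an arrow is an element of a hom-set tagged with its source and target. The composite
  \<open>c x g f\<close> may depend on the source \<open>x\<close> of \<open>f\<close>, since composing extensional functions does.\<close>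

datatype ('x, 'm) arrow = Arrow (source: 'x) (target: 'x) (underlying: 'm)

definition hom_cat ::
  "'x set \<Rightarrow> ('x \<Rightarrow> 'x \<Rightarrow> 'm set) \<Rightarrow> ('x \<Rightarrow> 'm) \<Rightarrow> ('x \<Rightarrow> 'm \<Rightarrow> 'm \<Rightarrow> 'm) \<Rightarrow> ('x, ('x, 'm) arrow) cat"
  where "hom_cat X H i c =
    \<lparr>Obj = X,
     Arr = {Arrow x y m | x y m. x \<in> X \<and> y \<in> X \<and> m \<in> H x y},
     Dom = source,
     Cod = target,
     Ident = (\<lambda>x. Arrow x x (i x)),
     Comp = (\<lambda>g f. Arrow (source f) (target g) (c (source f) (underlying g) (underlying f)))\<rparr>"

text \<open>The components of functors and of natural transformations are extensional functions, so that
  equality of functors and of natural transformations is the intended one.\<close>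

record ('o, 'a, 'p, 'b) fctr =
  omap :: "'o \<Rightarrow> 'p"
  amap :: "'a \<Rightarrow> 'b"

locale category_functor = A: category A + B: category B
  for A :: "('o, 'a, 'm) cat_scheme" and B :: "('p, 'b, 'n) cat_scheme" +
  fixes F :: "('o, 'a, 'p, 'b, 'r) fctr_scheme"
  assumes omap_ext: "omap F \<in> extensional (Obj A)"
    and amap_ext: "amap F \<in> extensional (Arr A)"
    and omap_obj: "x \<in> Obj A \<Longrightarrow> omap F x \<in> Obj B"
    and amap_hom: "f \<in> hom A x y \<Longrightarrow> amap F f \<in> hom B (omap F x) (omap F y)"
    and amap_ident: "x \<in> Obj A \<Longrightarrow> amap F (Ident A x) = Ident B (omap F x)"
    and amap_comp: "\<lbrakk>f \<in> hom A x y; g \<in> hom A y z\<rbrakk>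
      \<Longrightarrow> amap F (g \<cdot>\<^bsub>A\<^esub> f) = amap F g \<cdot>\<^bsub>B\<^esub> amap F f"

definition id_functor :: "('o, 'a, 'm) cat_scheme \<Rightarrow> ('o, 'a, 'o, 'a) fctr" where
  "id_functor A = \<lparr>omap = (\<lambda>x \<in> Obj A. x), amap = (\<lambda>f \<in> Arr A. f)\<rparr>"

definition comp_functor ::
  "('o, 'a, 'm) cat_scheme \<Rightarrow> ('p, 'b, 'q, 'c, 'r) fctr_scheme \<Rightarrow> ('o, 'a, 'p, 'b, 's) fctr_scheme
    \<Rightarrow> ('o, 'a, 'q, 'c) fctr"
  where "comp_functor A G F =
    \<lparr>omap = compose (Obj A) (omap G) (omap F), amap = compose (Arr A) (amap G) (amap F)\<rparr>"

locale natural_transformation = F: category_functor A B F + G: category_functor A B G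
  for A :: "('o, 'a, 'm) cat_scheme" and B :: "('p, 'b, 'n) cat_scheme"
    and F :: "('o, 'a, 'p, 'b, 'r) fctr_scheme" and G :: "('o, 'a, 'p, 'b, 's) fctr_scheme" +
  fixes \<eta> :: "'o \<Rightarrow> 'b"
  assumes component_ext: "\<eta> \<in> extensional (Obj A)"
    and component_hom: "x \<in> Obj A \<Longrightarrow> \<eta> x \<in> hom B (omap F x) (omap G x)"
    and natural: "f \<in> hom A x y \<Longrightarrow> \<eta> y \<cdot>\<^bsub>B\<^esub> amap F f = amap G f \<cdot>\<^bsub>B\<^esub> \<eta> x"

definition naturally_isomorphic ::
  "('o, 'a, 'm) cat_scheme \<Rightarrow> ('p, 'b, 'n) cat_scheme \<Rightarrow> ('o, 'a, 'p, 'b) fctr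
    \<Rightarrow> ('o, 'a, 'p, 'b) fctr \<Rightarrow> bool"
  where "naturally_isomorphic A B F G \<longleftrightarrow>
    (\<exists>\<eta>. natural_transformation A B F G \<eta> \<and>
      (\<forall>x \<in> Obj A. \<eta> x \<in> isos B (omap F x) (omap G x)))"

definition equivalence_of_categories ::
  "('o, 'a, 'm) cat_scheme \<Rightarrow> ('p, 'b, 'n) cat_scheme \<Rightarrow> ('o, 'a, 'p, 'b) fctr \<Rightarrow> bool"
  where "equivalence_of_categories A B E \<longleftrightarrow>
    category_functor A B E \<and>
    (\<exists>G :: ('p, 'b, 'o, 'a) fctr. category_functor B A G \<and>
      naturally_isomorphic A A (id_functor A) (comp_functor A G E) \<and>
      naturally_isomorphic B B (comp_functor B E G) (id_functor B))"

definition functor_category ::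
  "('o, 'a, 'm) cat_scheme \<Rightarrow> ('p, 'b, 'n) cat_scheme
    \<Rightarrow> (('o, 'a, 'p, 'b) fctr, (('o, 'a, 'p, 'b) fctr, 'o \<Rightarrow> 'b) arrow) cat"
  where "functor_category A B = hom_cat
    {F. category_functor A B F}
    (\<lambda>F G. {\<eta>. natural_transformation A B F G \<eta>})
    (\<lambda>F. \<lambda>x \<in> Obj A. Ident B (omap F x))
    (\<lambda>F \<theta> \<eta>. \<lambda>x \<in> Obj A. \<theta> x \<cdot>\<^bsub>B\<^esub> \<eta> x)"


section \<open>Monoidal categories, functors, natural transformations\<close>

record ('o, 'a) moncat = "('o, 'a) cat" +
  TensorO :: "'o \<Rightarrow> 'o \<Rightarrow> 'o"  (infixr "\<otimes>\<index>" 70)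
  TensorA :: "'a \<Rightarrow> 'a \<Rightarrow> 'a"  (infixr "\<boxtimes>\<index>" 70)
  Unit :: "'o"
  Assoc :: "'o \<Rightarrow> 'o \<Rightarrow> 'o \<Rightarrow> 'a"
  LUnit :: "'o \<Rightarrow> 'a"
  RUnit :: "'o \<Rightarrow> 'a"

locale monoidal_category = category C
  for C :: "('o, 'a) moncat" (structure) +
  assumes unit_obj: "Unit C \<in> Obj C"
    and tensor_obj: "\<lbrakk>x \<in> Obj C; y \<in> Obj C\<rbrakk> \<Longrightarrow> x \<otimes> y \<in> Obj C"
    and tensor_hom: "\<lbrakk>f \<in> hom C x x'; g \<in> hom C y y'\<rbrakk> \<Longrightarrow> f \<boxtimes> g \<in> hom C (x \<otimes> y) (x' \<otimes> y')"
    and tensor_ident: "\<lbrakk>x \<in> Obj C; y \<in> Obj C\<rbrakk> \<Longrightarrow> Ident C x \<boxtimes> Ident C y = Ident C (x \<otimes> y)"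
    and tensor_comp:
      "\<lbrakk>f \<in> hom C x x'; f' \<in> hom C x' x''; g \<in> hom C y y'; g' \<in> hom C y' y''\<rbrakk>
        \<Longrightarrow> (f' \<cdot> f) \<boxtimes> (g' \<cdot> g) = (f' \<boxtimes> g') \<cdot> (f \<boxtimes> g)"
    and assoc_iso: "\<lbrakk>x \<in> Obj C; y \<in> Obj C; z \<in> Obj C\<rbrakk>
      \<Longrightarrow> Assoc C x y z \<in> isos C ((x \<otimes> y) \<otimes> z) (x \<otimes> (y \<otimes> z))"
    and assoc_natural: "\<lbrakk>f \<in> hom C x x'; g \<in> hom C y y'; h \<in> hom C z z'\<rbrakk>
      \<Longrightarrow> Assoc C x' y' z' \<cdot> ((f \<boxtimes> g) \<boxtimes> h) = (f \<boxtimes> (g \<boxtimes> h)) \<cdot> Assoc C x y z"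
    and lunit_iso: "x \<in> Obj C \<Longrightarrow> LUnit C x \<in> isos C (Unit C \<otimes> x) x"
    and lunit_natural: "f \<in> hom C x x'
      \<Longrightarrow> LUnit C x' \<cdot> (Ident C (Unit C) \<boxtimes> f) = f \<cdot> LUnit C x"
    and runit_iso: "x \<in> Obj C \<Longrightarrow> RUnit C x \<in> isos C (x \<otimes> Unit C) x"
    and runit_natural: "f \<in> hom C x x'
      \<Longrightarrow> RUnit C x' \<cdot> (f \<boxtimes> Ident C (Unit C)) = f \<cdot> RUnit C x"
    and pentagon: "\<lbrakk>w \<in> Obj C; x \<in> Obj C; y \<in> Obj C; z \<in> Obj C\<rbrakk>
      \<Longrightarrow> Assoc C w x (y \<otimes> z) \<cdot> Assoc C (w \<otimes> x) y z =
          (Ident C w \<boxtimes> Assoc C x y z) \<cdot> Assoc C w (x \<otimes> y) z \<cdot> (Assoc C w x y \<boxtimes> Ident C z)"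
    and triangle: "\<lbrakk>x \<in> Obj C; y \<in> Obj C\<rbrakk>
      \<Longrightarrow> (Ident C x \<boxtimes> LUnit C y) \<cdot> Assoc C x (Unit C) y = RUnit C x \<boxtimes> Ident C y"

record ('o, 'a, 'p, 'b) monfctr = "('o, 'a, 'p, 'b) fctr" +
  Fmult :: "'o \<times> 'o \<Rightarrow> 'b"
  Funit :: "'b"

text \<open>Monoidal functors are strong: the structure maps \<open>F x \<otimes> F y \<rightarrow> F (x \<otimes> y)\<close> and
  \<open>I \<rightarrow> F I\<close> are isomorphisms.\<close>

locale monoidal_functor =
  C: monoidal_category C + D: monoidal_category D + category_functor C D F
  for C :: "('o, 'a) moncat" and D :: "('p, 'b) moncat" (structure)
    and F :: "('o, 'a, 'p, 'b) monfctr" +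
  assumes Fmult_ext: "Fmult F \<in> extensional (Obj C \<times> Obj C)"
    and Fmult_iso: "\<lbrakk>x \<in> Obj C; y \<in> Obj C\<rbrakk>
      \<Longrightarrow> Fmult F (x, y) \<in> isos D (omap F x \<otimes> omap F y) (omap F (x \<otimes>\<^bsub>C\<^esub> y))"
    and Funit_iso: "Funit F \<in> isos D (Unit D) (omap F (Unit C))"
    and Fmult_natural: "\<lbrakk>f \<in> hom C x x'; g \<in> hom C y y'\<rbrakk>
      \<Longrightarrow> Fmult F (x', y') \<cdot> (amap F f \<boxtimes> amap F g) = amap F (f \<boxtimes>\<^bsub>C\<^esub> g) \<cdot> Fmult F (x, y)"
    and Fmult_assoc: "\<lbrakk>x \<in> Obj C; y \<in> Obj C; z \<in> Obj C\<rbrakk>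
      \<Longrightarrow> amap F (Assoc C x y z) \<cdot> Fmult F (x \<otimes>\<^bsub>C\<^esub> y, z) \<cdot> (Fmult F (x, y) \<boxtimes> Ident D (omap F z)) =
          Fmult F (x, y \<otimes>\<^bsub>C\<^esub> z) \<cdot> (Ident D (omap F x) \<boxtimes> Fmult F (y, z)) \<cdot>
            Assoc D (omap F x) (omap F y) (omap F z)"
    and Fmult_lunit: "x \<in> Obj C
      \<Longrightarrow> amap F (LUnit C x) \<cdot> Fmult F (Unit C, x) \<cdot> (Funit F \<boxtimes> Ident D (omap F x)) =
          LUnit D (omap F x)"
    and Fmult_runit: "x \<in> Obj C
      \<Longrightarrow> amap F (RUnit C x) \<cdot> Fmult F (x, Unit C) \<cdot> (Ident D (omap F x) \<boxtimes> Funit F) =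
          RUnit D (omap F x)"

locale monoidal_transformation =
  F: monoidal_functor C D F + G: monoidal_functor C D G + natural_transformation C D F G \<eta>
  for C :: "('o, 'a) moncat" and D :: "('p, 'b) moncat" (structure)
    and F :: "('o, 'a, 'p, 'b) monfctr" and G :: "('o, 'a, 'p, 'b) monfctr"
    and \<eta> :: "'o \<Rightarrow> 'b" +
  assumes component_mult: "\<lbrakk>x \<in> Obj C; y \<in> Obj C\<rbrakk>
      \<Longrightarrow> \<eta> (x \<otimes>\<^bsub>C\<^esub> y) \<cdot> Fmult F (x, y) = Fmult G (x, y) \<cdot> (\<eta> x \<boxtimes> \<eta> y)"
    and component_unit: "\<eta> (Unit C) \<cdot> Funit F = Funit G"

definition monoidal_functor_category ::
  "('o, 'a) moncat \<Rightarrow> ('p, 'b) moncat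
    \<Rightarrow> (('o, 'a, 'p, 'b) monfctr, (('o, 'a, 'p, 'b) monfctr, 'o \<Rightarrow> 'b) arrow) cat"
  where "monoidal_functor_category C D = hom_cat
    {F. monoidal_functor C D F}
    (\<lambda>F G. {\<eta>. monoidal_transformation C D F G \<eta>})
    (\<lambda>F. \<lambda>x \<in> Obj C. Ident D (omap F x))
    (\<lambda>F \<theta> \<eta>. \<lambda>x \<in> Obj C. \<theta> x \<cdot>\<^bsub>D\<^esub> \<eta> x)"


section \<open>Monoids and cosimplicial monoids\<close>

record ('o, 'a) mon =
  carr :: "'o"
  mult :: "'a"
  unit :: "'a"

locale monoid_in = monoidal_category C
  for C :: "('o, 'a) moncat" (structure) and M :: "('o, 'a) mon" +
  assumes carr_obj: "carr M \<in> Obj C"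
    and mult_hom: "mult M \<in> hom C (carr M \<otimes> carr M) (carr M)"
    and unit_hom: "unit M \<in> hom C (Unit C) (carr M)"
    and mult_assoc: "mult M \<cdot> (mult M \<boxtimes> Ident C (carr M)) =
      mult M \<cdot> (Ident C (carr M) \<boxtimes> mult M) \<cdot> Assoc C (carr M) (carr M) (carr M)"
    and mult_lunit: "mult M \<cdot> (unit M \<boxtimes> Ident C (carr M)) = LUnit C (carr M)"
    and mult_runit: "mult M \<cdot> (Ident C (carr M) \<boxtimes> unit M) = RUnit C (carr M)"

definition monoid_homs :: "('o, 'a) moncat \<Rightarrow> ('o, 'a) mon \<Rightarrow> ('o, 'a) mon \<Rightarrow> 'a set" where
  "monoid_homs C M N = {f \<in> hom C (carr M) (carr N).
     f \<cdot>\<^bsub>C\<^esub> mult M = mult N \<cdot>\<^bsub>C\<^esub> (f \<boxtimes>\<^bsub>C\<^esub> f) \<and> f \<cdot>\<^bsub>C\<^esub> unit M = unit N}"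

definition Mon :: "('o, 'a) moncat \<Rightarrow> (('o, 'a) mon, (('o, 'a) mon, 'a) arrow) cat" where
  "Mon C = hom_cat {M. monoid_in C M} (monoid_homs C) (\<lambda>M. Ident C (carr M)) (\<lambda>M. Comp C)"

definition Mon_functor ::
  "('o, 'a) moncat \<Rightarrow> ('p, 'b) moncat \<Rightarrow> ('o, 'a, 'p, 'b) monfctr
    \<Rightarrow> (('o, 'a) mon, (('o, 'a) mon, 'a) arrow, ('p, 'b) mon, (('p, 'b) mon, 'b) arrow) fctr"
  where "Mon_functor C D F =
    (let F' = (\<lambda>M. \<lparr>carr = omap F (carr M),
                    mult = amap F (mult M) \<cdot>\<^bsub>D\<^esub> Fmult F (carr M, carr M),
                    unit = amap F (unit M) \<cdot>\<^bsub>D\<^esub> Funit F\<rparr>)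
     in \<lparr>omap = (\<lambda>M \<in> Obj (Mon C). F' M),
         amap = (\<lambda>f \<in> Arr (Mon C).
           Arrow (F' (source f)) (F' (target f)) (amap F (underlying f)))\<rparr>)"

text \<open>The object \<open>n \<ge> 1\<close> stands for \<open>[n] = {1..n}\<close>.\<close>

definition Delta :: "(nat, (nat, nat \<Rightarrow> nat) arrow) cat" where
  "Delta = hom_cat
    {n. n \<ge> 1}
    (\<lambda>m n. {f \<in> {1..m} \<rightarrow>\<^sub>E {1..n}. mono_on {1..m} f})
    (\<lambda>n. \<lambda>i \<in> {1..n}. i)
    (\<lambda>m g f. compose {1..m} g f)"

definition cosimplicial_monoids ::
  "('o, 'a) moncat \<Rightarrow>
    ((nat, (nat, nat \<Rightarrow> nat) arrow, ('o, 'a) mon, (('o, 'a) mon, 'a) arrow) fctr,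
     ((nat, (nat, nat \<Rightarrow> nat) arrow, ('o, 'a) mon, (('o, 'a) mon, 'a) arrow) fctr,
      nat \<Rightarrow> (('o, 'a) mon, 'a) arrow) arrow) cat"
  where "cosimplicial_monoids C = functor_category Delta (Mon C)"


section \<open>Finite ordered sets\<close>

text \<open>A finite totally ordered set is represented by its reflexive order relation \<open>r\<close>, the
  underlying set being \<^term>\<open>Field r\<close>, a finite set of natural numbers. Any infinite universe
  equipped with an encoding of disjoint sums would serve equally well.\<close>

definition fin_ordered :: "nat rel \<Rightarrow> bool" where
  "fin_ordered r \<longleftrightarrow> finite (Field r) \<and> Linear_order r"

definition ordinal :: "nat \<Rightarrow> nat rel" where
  "ordinal n = {(i, j). 1 \<le> i \<and> i \<le> j \<and> j \<le> n}"

abbreviation inl :: "nat \<Rightarrow> nat" where "inl x \<equiv> sum_encode (Inl x)"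
abbreviation inr :: "nat \<Rightarrow> nat" where "inr x \<equiv> sum_encode (Inr x)"

definition copair :: "(nat \<Rightarrow> nat) \<Rightarrow> (nat \<Rightarrow> nat) \<Rightarrow> nat \<Rightarrow> nat" where
  "copair f g = case_sum f g \<circ> sum_decode"

definition sum_map :: "(nat \<Rightarrow> nat) \<Rightarrow> (nat \<Rightarrow> nat) \<Rightarrow> nat \<Rightarrow> nat" where
  "sum_map f g = copair (inl \<circ> f) (inr \<circ> g)"

text \<open>The ordered sum: every element of the left summand precedes every element of the right one.\<close>

definition ordered_sum :: "nat rel \<Rightarrow> nat rel \<Rightarrow> nat rel"  (infixr "+\<^sub>o\<^sub>r\<^sub>d" 65) where
  "r +\<^sub>o\<^sub>r\<^sub>d s = {(inl x, inl y) | x y. (x, y) \<in> r} \<union> {(inr x, inr y) | x y. (x, y) \<in> s} \<union>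
     {(inl x, inr y) | x y. x \<in> Field r \<and> y \<in> Field s}"


section \<open>Pruned trees of height 2\<close>

datatype tree = Tree (lev2: "nat rel") (lev1: "nat rel") (proj: "nat \<Rightarrow> nat")

abbreviation nodes2 :: "tree \<Rightarrow> nat set" where "nodes2 t \<equiv> Field (lev2 t)"
abbreviation nodes1 :: "tree \<Rightarrow> nat set" where "nodes1 t \<equiv> Field (lev1 t)"

definition pruned_trees :: "tree set" where
  "pruned_trees = {t. fin_ordered (lev2 t) \<and> fin_ordered (lev1 t) \<and>
     proj t \<in> nodes2 t \<rightarrow>\<^sub>E nodes1 t \<and> proj t ` nodes2 t = nodes1 t}"

text \<open>A pair of maps is \<open>(f2, f1)\<close>, with \<open>f2\<close> on the leaves.\<close>

type_synonym tree_map = "(nat \<Rightarrow> nat) \<times> (nat \<Rightarrow> nat)"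
type_synonym tree_arrow = "(tree, tree_map) arrow"

definition tree_maps :: "tree \<Rightarrow> tree \<Rightarrow> tree_map set" where
  "tree_maps s t = {(f2, f1).
     f2 \<in> nodes2 s \<rightarrow>\<^sub>E nodes2 t \<and> f1 \<in> nodes1 s \<rightarrow>\<^sub>E nodes1 t \<and>
     (\<forall>x \<in> nodes2 s. proj t (f2 x) = f1 (proj s x)) \<and>
     (\<forall>(x, y) \<in> lev1 s. (f1 x, f1 y) \<in> lev1 t) \<and>
     (\<forall>(x, y) \<in> lev2 s. proj s x = proj s y \<longrightarrow> (f2 x, f2 y) \<in> lev2 t)}"

definition restrict_levels :: "tree \<Rightarrow> tree_map \<Rightarrow> tree_map" where
  "restrict_levels s f = (restrict (fst f) (nodes2 s), restrict (snd f) (nodes1 s))"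

definition tree_comp :: "tree \<Rightarrow> tree_map \<Rightarrow> tree_map \<Rightarrow> tree_map" where
  "tree_comp s g f = restrict_levels s (fst g \<circ> fst f, snd g \<circ> snd f)"

definition tree_sum :: "tree \<Rightarrow> tree \<Rightarrow> tree" where
  "tree_sum s t = Tree (lev2 s +\<^sub>o\<^sub>r\<^sub>d lev2 t) (lev1 s +\<^sub>o\<^sub>r\<^sub>d lev1 t)
     (restrict (sum_map (proj s) (proj t)) (Field (lev2 s +\<^sub>o\<^sub>r\<^sub>d lev2 t)))"

definition empty_tree :: tree where
  "empty_tree = Tree {} {} (\<lambda>x \<in> {}. x)"

definition same_map :: "tree \<Rightarrow> tree \<Rightarrow> (nat \<Rightarrow> nat) \<Rightarrow> tree_arrow" where
  "same_map s t f = Arrow s t (restrict_levels s (f, f))"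

definition Omega2 :: "(tree, tree_arrow) moncat" where
  "Omega2 = cat.extend
    (hom_cat pruned_trees tree_maps (\<lambda>t. restrict_levels t (id, id)) tree_comp)
    (moncat.fields
      tree_sum
      (\<lambda>f g. let s = tree_sum (source f) (source g); t = tree_sum (target f) (target g) in
         Arrow s t (restrict_levels s
           (sum_map (fst (underlying f)) (fst (underlying g)),
            sum_map (snd (underlying f)) (snd (underlying g)))))
      empty_tree
      (\<lambda>s t u. same_map (tree_sum (tree_sum s t) u) (tree_sum s (tree_sum t u))
         (copair (copair inl (inr \<circ> inl)) (inr \<circ> inr)))
      (\<lambda>t. same_map (tree_sum empty_tree t) t (copair id id))
      (\<lambda>t. same_map (tree_sum t empty_tree) t (copair id id)))"


section \<open>The cosimplicial monoid of pruned trees and evaluation at it\<close>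

definition S_tree :: "nat rel \<Rightarrow> tree" where
  "S_tree X = Tree X (ordinal 1) (\<lambda>x \<in> Field X. 1)"

definition S_monoid :: "nat rel \<Rightarrow> (tree, tree_arrow) mon" where
  "S_monoid X = (let S = S_tree X; SS = tree_sum S S in
    \<lparr>carr = S,
     mult = Arrow SS S (restrict_levels SS (copair id id, \<lambda>_. 1)),
     unit = Arrow empty_tree S (restrict_levels empty_tree (id, id))\<rparr>)"

definition S_star ::
  "(nat, (nat, nat \<Rightarrow> nat) arrow, (tree, tree_arrow) mon, ((tree, tree_arrow) mon, tree_arrow) arrow) fctr"
  where "S_star =
    \<lparr>omap = (\<lambda>n \<in> Obj Delta. S_monoid (ordinal n)),
     amap = (\<lambda>f \<in> Arr Delta.
       let X = ordinal (source f); Y = ordinal (target f) in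
       Arrow (S_monoid X) (S_monoid Y)
         (Arrow (S_tree X) (S_tree Y) (restrict_levels (S_tree X) (underlying f, id))))\<rparr>"

definition eval_obj ::
  "('o, 'a) moncat \<Rightarrow> (tree, tree_arrow, 'o, 'a) monfctr
    \<Rightarrow> (nat, (nat, nat \<Rightarrow> nat) arrow, ('o, 'a) mon, (('o, 'a) mon, 'a) arrow) fctr"
  where "eval_obj C F = comp_functor Delta (Mon_functor Omega2 C F) S_star"

definition evaluation ::
  "('o, 'a) moncat \<Rightarrow>
    ((tree, tree_arrow, 'o, 'a) monfctr,
     ((tree, tree_arrow, 'o, 'a) monfctr, tree \<Rightarrow> 'a) arrow,
     (nat, (nat, nat \<Rightarrow> nat) arrow, ('o, 'a) mon, (('o, 'a) mon, 'a) arrow) fctr,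
     ((nat, (nat, nat \<Rightarrow> nat) arrow, ('o, 'a) mon, (('o, 'a) mon, 'a) arrow) fctr,
      nat \<Rightarrow> (('o, 'a) mon, 'a) arrow) arrow) fctr"
  where "evaluation C =
    \<lparr>omap = (\<lambda>F \<in> Obj (monoidal_functor_category Omega2 C). eval_obj C F),
     amap = (\<lambda>\<theta> \<in> Arr (monoidal_functor_category Omega2 C).
       Arrow (eval_obj C (source \<theta>)) (eval_obj C (target \<theta>))
         (\<lambda>n \<in> Obj Delta.
           Arrow (omap (eval_obj C (source \<theta>)) n) (omap (eval_obj C (target \<theta>)) n)
             (underlying \<theta> (S_tree (ordinal n)))))\<rparr>"

end

theory Submission
  imports Defs
begin

text \<open>A pruned tree is, up to isomorphism, an ordered sum of corollas \<open>S(X)\<close>, one for each fibre, and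
  every arrow is generated by order isomorphisms, the structure maps of \<open>S\<^sup>*\<close>, composition and sums.
  A cosimplicial monoid \<open>M\<close> therefore determines the functor sending a tree with fibres of sizes
  \<open>n\<^sub>1, \<dots>, n\<^sub>k\<close> to \<open>M n\<^sub>1 \<otimes> (\<dots> \<otimes> (M n\<^sub>k \<otimes> I))\<close>. An arrow is evaluated by recursion on its target: the
  first target fibre either receives no fibre of the source, and a unit is inserted, or it receives the
  first one, and then the arrow of the remaining fibres is composed with the action of the monoid on
  the free module generated by the other target fibres. Associativity and unitality of this action
  give functoriality. Evaluating the functor gives back \<open>M \<otimes> I\<close>. Conversely, the comparison from
  the functor built from the evaluation of \<open>F\<close> to \<open>F\<close> is assembled from the structure maps of \<open>F\<close>;
  it is monoidal, so its naturality is only to be checked on generating arrows.\<close>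

section \<open>Categories and monoidal categories\<close>

text \<open>An arrow can be evaluated at all because its map of level 1 nodes is order-preserving:
  the fibres sent into one target fibre are consecutive, so their values can be multiplied from left
  to right in a monoid that may be non-commutative. Leaves of different fibres are never compared by
  arrows, hence a tree enters only through the list of its fibres, and isomorphisms that merely
  rename leaves are sent to identities. Functoriality is proved for this explicit evaluation,
  without a presentation by generators and relations; generation serves the comparison with F, where
  naturality squares can be composed and tensored. The obstacle is the associators and unitors of C.
  Right-nested products ending in I give every list of fibres one fixed bracketing, so that
  coherence enters through a few equations about single recursion steps. The price is the final
  factor I. Right unitors remove it: they are the natural isomorphism on the side of cosimplicial
  monoids and, on corollas, the comparison with F.\<close>

context category
begin

lemma arr_hom: "f \<in> Arr C \<Longrightarrow> f \<in> hom C (Dom C f) (Cod C f)"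
  by (simp add: hom_def)

lemma homI: "\<lbrakk>f \<in> Arr C; Dom C f = x; Cod C f = y\<rbrakk> \<Longrightarrow> f \<in> hom C x y"
  by (simp add: hom_def)

lemma hom_arr [simp]:
  assumes "f \<in> hom C x y"
  shows "f \<in> Arr C" "Dom C f = x" "Cod C f = y"
  using assms by (auto simp: hom_def)

lemma hom_obj:
  assumes "f \<in> hom C x y"
  shows "x \<in> Obj C" "y \<in> Obj C"
  using assms dom_obj[of f] cod_obj[of f] unfolding hom_def by blast+

lemma dom_cod_obj [simp]:
  "f \<in> Arr C \<Longrightarrow> Dom C f \<in> Obj C" "f \<in> Arr C \<Longrightarrow> Cod C f \<in> Obj C"
  by (rule dom_obj cod_obj; assumption)+

lemma ident_arr [simp]:
  assumes "x \<in> Obj C"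
  shows "Ident C x \<in> Arr C" "Dom C (Ident C x) = x" "Cod C (Ident C x) = x"
  using ident_hom[OF assms] by auto

lemma comp_arr [simp]:
  assumes "f \<in> Arr C" "g \<in> Arr C" "Dom C g = Cod C f"
  shows "g \<cdot> f \<in> Arr C" "Dom C (g \<cdot> f) = Dom C f" "Cod C (g \<cdot> f) = Cod C g"
proof -
  have "g \<cdot> f \<in> hom C (Dom C f) (Cod C g)"
    by (rule comp_hom[where y = "Cod C f"]) (use assms in \<open>auto intro: homI\<close>)
  then show "g \<cdot> f \<in> Arr C" "Dom C (g \<cdot> f) = Dom C f" "Cod C (g \<cdot> f) = Cod C g"
    by auto
qed

lemma comp_ident_arr [simp]: "\<lbrakk>f \<in> Arr C; Dom C f = x\<rbrakk> \<Longrightarrow> f \<cdot> Ident C x = f"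
  using comp_ident arr_hom by blast

lemma ident_comp_arr [simp]: "\<lbrakk>f \<in> Arr C; Cod C f = x\<rbrakk> \<Longrightarrow> Ident C x \<cdot> f = f"
  using ident_comp arr_hom by blast

text \<open>Composites are normalised to the right. The pair of arrows to be rewritten then usually
  has a tail, which is why cancellation and interchange rules also come in a version with one more
  factor on the right.\<close>

lemma comp_assoc_arr [simp]:
  "\<lbrakk>f \<in> Arr C; g \<in> Arr C; h \<in> Arr C; Dom C g = Cod C f; Dom C h = Cod C g\<rbrakk>
    \<Longrightarrow> (h \<cdot> g) \<cdot> f = h \<cdot> (g \<cdot> f)"
  by (metis comp_assoc arr_hom)

end

section \<open>Inverses of isomorphisms\<close>

definition inverse_arr :: "('o, 'a, 'm) cat_scheme \<Rightarrow> 'a \<Rightarrow> 'a" where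
  "inverse_arr C f = (SOME g. g \<in> hom C (Cod C f) (Dom C f) \<and>
     g \<cdot>\<^bsub>C\<^esub> f = Ident C (Dom C f) \<and> f \<cdot>\<^bsub>C\<^esub> g = Ident C (Cod C f))"

context category
begin

abbreviation inv_arr where "inv_arr \<equiv> inverse_arr C"

lemma isos_hom: "f \<in> isos C x y \<Longrightarrow> f \<in> hom C x y"
  by (simp add: isos_def)

lemma isosI:
  "\<lbrakk>f \<in> hom C x y; g \<in> hom C y x; g \<cdot> f = Ident C x; f \<cdot> g = Ident C y\<rbrakk> \<Longrightarrow> f \<in> isos C x y"
  by (auto simp: isos_def)

lemma inverse_arr_props:
  assumes "f \<in> isos C x y"
  shows "inv_arr f \<in> hom C y x \<and> inv_arr f \<cdot> f = Ident C x \<and> f \<cdot> inv_arr f = Ident C y"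
proof -
  have xy: "Dom C f = x" "Cod C f = y" using isos_hom[OF assms] by auto
  have "\<exists>g. g \<in> hom C y x \<and> g \<cdot> f = Ident C x \<and> f \<cdot> g = Ident C y"
    using assms by (auto simp: isos_def)
  then show ?thesis
    unfolding inverse_arr_def xy by (rule someI_ex)
qed

lemma inverse_arr_hom: "f \<in> isos C x y \<Longrightarrow> inv_arr f \<in> hom C y x"
  using inverse_arr_props by blast

lemma iso_arr [simp]:
  assumes "f \<in> isos C x y"
  shows "f \<in> Arr C" "Dom C f = x" "Cod C f = y"
    "inv_arr f \<in> Arr C" "Dom C (inv_arr f) = y" "Cod C (inv_arr f) = x"
    "inv_arr f \<cdot> f = Ident C x" "f \<cdot> inv_arr f = Ident C y"
  using isos_hom[OF assms] inverse_arr_props[OF assms] by auto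

lemma iso_cancel [simp]:
  assumes "f \<in> isos C x y"
  shows "\<lbrakk>g \<in> Arr C; Cod C g = x\<rbrakk> \<Longrightarrow> inv_arr f \<cdot> (f \<cdot> g) = g"
    "\<lbrakk>g \<in> Arr C; Cod C g = y\<rbrakk> \<Longrightarrow> f \<cdot> (inv_arr f \<cdot> g) = g"
  using assms
   by (simp_all flip: comp_assoc_arr)

lemma iso_obj: "f \<in> isos C x y \<Longrightarrow> x \<in> Obj C" "f \<in> isos C x y \<Longrightarrow> y \<in> Obj C"
  using isos_hom hom_obj by blast+

lemma inverse_arr_iso: "f \<in> isos C x y \<Longrightarrow> inv_arr f \<in> isos C y x"
  by (rule isosI[where g = f]) (auto intro: homI)

lemma ident_iso: "x \<in> Obj C \<Longrightarrow> Ident C x \<in> isos C x x"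
  by (rule isosI[where g = "Ident C x"]) (auto intro: ident_hom)

lemma comp_iso: "\<lbrakk>f \<in> isos C x y; g \<in> isos C y z\<rbrakk> \<Longrightarrow> g \<cdot> f \<in> isos C x z"
  by (rule isosI[where g = "inv_arr f \<cdot> inv_arr g"]) (auto intro: homI)

lemma iso_cancel_left:
  assumes "f \<in> isos C x y" "g \<in> Arr C" "h \<in> Arr C" "Cod C g = x" "Cod C h = x" "f \<cdot> g = f \<cdot> h"
  shows "g = h"
  using iso_cancel(1)[OF assms(1,2,4)] iso_cancel(1)[OF assms(1,3,5)] unfolding assms(6) by simp

lemma iso_cancel_right:
  assumes f: "f \<in> isos C x y" and "g \<in> Arr C" "h \<in> Arr C" "Dom C g = y" "Dom C h = y"
    and eq: "g \<cdot> f = h \<cdot> f"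
  shows "g = h"
proof -
  have "(g \<cdot> f) \<cdot> inv_arr f = (h \<cdot> f) \<cdot> inv_arr f" by (simp only: eq)
  then show ?thesis using assms(1-5) by simp
qed

text \<open>This makes the choice in \<open>inverse_arr\<close> harmless: a left inverse found by
  any means is the chosen one.\<close>

lemma inverse_arr_unique:
  assumes "f \<in> isos C x y" "g \<in> Arr C" "Dom C g = y" "Cod C g = x" "g \<cdot> f = Ident C x"
  shows "inv_arr f = g"
  by (rule iso_cancel_right[OF assms(1)]) (use assms in auto)

text \<open>Inverting two opposite sides of a commuting square leaves a commuting square. Naturality
  of inverse constraints and of inverse transformations is obtained in this way.\<close>

lemma comp_inverse_eq:
  assumes "f \<in> isos C x y" "g \<in> isos C z w" "h \<in> hom C y w" "k \<in> hom C x z" "h \<cdot> f = g \<cdot> k"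
  shows "inv_arr g \<cdot> h = k \<cdot> inv_arr f"
proof -
  have "inv_arr g \<cdot> h = inv_arr g \<cdot> ((h \<cdot> f) \<cdot> inv_arr f)"
    using assms(1-4) by simp
  also have "\<dots> = inv_arr g \<cdot> ((g \<cdot> k) \<cdot> inv_arr f)"
    by (simp only: assms(5))
  also have "\<dots> = k \<cdot> inv_arr f" using assms(1-4) by simp
  finally show ?thesis .
qed

end

section \<open>Tensor calculus and the unit coherences\<close>

context monoidal_category
begin

abbreviation "AInv x y z \<equiv> inv_arr (Assoc C x y z)"
abbreviation "LInv x \<equiv> inv_arr (LUnit C x)"
abbreviation "RInv x \<equiv> inv_arr (RUnit C x)"

declare unit_obj [simp] tensor_obj [simp] tensor_ident [simp]

lemma tensor_arr [simp]:
  assumes "f \<in> Arr C" "g \<in> Arr C"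
  shows "f \<boxtimes> g \<in> Arr C" "Dom C (f \<boxtimes> g) = Dom C f \<otimes> Dom C g" "Cod C (f \<boxtimes> g) = Cod C f \<otimes> Cod C g"
  using tensor_hom[OF arr_hom[OF assms(1)] arr_hom[OF assms(2)]] by auto

lemma tensor_comp_arr [simp]:
  assumes "f \<in> Arr C" "f' \<in> Arr C" "g \<in> Arr C" "g' \<in> Arr C" "Dom C f' = Cod C f" "Dom C g' = Cod C g"
  shows "(f' \<boxtimes> g') \<cdot> (f \<boxtimes> g) = (f' \<cdot> f) \<boxtimes> (g' \<cdot> g)"
  by (rule tensor_comp[symmetric]) (use assms in \<open>auto intro!: homI\<close>)

lemma tensor_comp_arr2 [simp]:
  assumes "f \<in> Arr C" "f' \<in> Arr C" "g \<in> Arr C" "g' \<in> Arr C" "Dom C f' = Cod C f" "Dom C g' = Cod C g"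
    "h \<in> Arr C" "Cod C h = Dom C f \<otimes> Dom C g"
  shows "(f' \<boxtimes> g') \<cdot> ((f \<boxtimes> g) \<cdot> h) = ((f' \<cdot> f) \<boxtimes> (g' \<cdot> g)) \<cdot> h"
  using assms by (simp flip: comp_assoc_arr)

lemma tensor_iso:
  "\<lbrakk>f \<in> isos C x x'; g \<in> isos C y y'\<rbrakk> \<Longrightarrow> f \<boxtimes> g \<in> isos C (x \<otimes> y) (x' \<otimes> y')"
  by (rule isosI[where g = "inv_arr f \<boxtimes> inv_arr g"]) (auto intro: homI simp: iso_obj)

lemma tensor_ident_iso:
  "\<lbrakk>f \<in> isos C x x'; y \<in> Obj C\<rbrakk> \<Longrightarrow> f \<boxtimes> Ident C y \<in> isos C (x \<otimes> y) (x' \<otimes> y)"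
  "\<lbrakk>f \<in> isos C x x'; y \<in> Obj C\<rbrakk> \<Longrightarrow> Ident C y \<boxtimes> f \<in> isos C (y \<otimes> x) (y \<otimes> x')"
  by (auto intro: tensor_iso ident_iso)

lemma assoc_arr [simp]:
  assumes "x \<in> Obj C" "y \<in> Obj C" "z \<in> Obj C"
  shows "Assoc C x y z \<in> Arr C" "Dom C (Assoc C x y z) = (x \<otimes> y) \<otimes> z"
    "Cod C (Assoc C x y z) = x \<otimes> (y \<otimes> z)"
    "AInv x y z \<in> Arr C" "Cod C (AInv x y z) = (x \<otimes> y) \<otimes> z"
    "Dom C (AInv x y z) = x \<otimes> (y \<otimes> z)"
    "AInv x y z \<cdot> Assoc C x y z = Ident C ((x \<otimes> y) \<otimes> z)"
    "Assoc C x y z \<cdot> AInv x y z = Ident C (x \<otimes> (y \<otimes> z))"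
  using assoc_iso[OF assms] by simp_all

lemma unit_arr [simp]:
  assumes "x \<in> Obj C"
  shows "LUnit C x \<in> Arr C" "Dom C (LUnit C x) = Unit C \<otimes> x" "Cod C (LUnit C x) = x"
    "LInv x \<in> Arr C" "Cod C (LInv x) = Unit C \<otimes> x" "Dom C (LInv x) = x"
    "LInv x \<cdot> LUnit C x = Ident C (Unit C \<otimes> x)" "LUnit C x \<cdot> LInv x = Ident C x"
    "RUnit C x \<in> Arr C" "Dom C (RUnit C x) = x \<otimes> Unit C" "Cod C (RUnit C x) = x"
    "RInv x \<in> Arr C" "Cod C (RInv x) = x \<otimes> Unit C" "Dom C (RInv x) = x"
    "RInv x \<cdot> RUnit C x = Ident C (x \<otimes> Unit C)" "RUnit C x \<cdot> RInv x = Ident C x"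
  using lunit_iso[OF assms] runit_iso[OF assms] by simp_all

lemma unit_cancel [simp]:
  assumes "x \<in> Obj C" "f \<in> Arr C"
  shows "Cod C f = Unit C \<otimes> x \<Longrightarrow> LInv x \<cdot> (LUnit C x \<cdot> f) = f"
    "Cod C f = x \<Longrightarrow> LUnit C x \<cdot> (LInv x \<cdot> f) = f"
    "Cod C f = x \<otimes> Unit C \<Longrightarrow> RInv x \<cdot> (RUnit C x \<cdot> f) = f"
    "Cod C f = x \<Longrightarrow> RUnit C x \<cdot> (RInv x \<cdot> f) = f"
  using lunit_iso[OF assms(1)] runit_iso[OF assms(1)] assms(2) by simp_all

lemma assoc_cancel [simp]:
  assumes "x \<in> Obj C" "y \<in> Obj C" "z \<in> Obj C" "f \<in> Arr C"
  shows "Cod C f = (x \<otimes> y) \<otimes> z \<Longrightarrow> AInv x y z \<cdot> (Assoc C x y z \<cdot> f) = f"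
    "Cod C f = x \<otimes> (y \<otimes> z) \<Longrightarrow> Assoc C x y z \<cdot> (AInv x y z \<cdot> f) = f"
  using assoc_iso[OF assms(1-3)] assms(4) by simp_all

text \<open>Not a default rewrite rule, since associators have to move in either direction; the
  calculations invoke it at the intended place. The codomains get names of their own so that the
  left-hand side matches whatever form the objects have.\<close>

lemma assoc_natural_arr:
  assumes "f \<in> Arr C" "g \<in> Arr C" "h \<in> Arr C" "Cod C f = x" "Cod C g = y" "Cod C h = z"
  shows "Assoc C x y z \<cdot> ((f \<boxtimes> g) \<boxtimes> h) = (f \<boxtimes> (g \<boxtimes> h)) \<cdot> Assoc C (Dom C f) (Dom C g) (Dom C h)"
  by (rule assoc_natural) (use assms in \<open>auto intro!: homI\<close>)

lemma assoc_natural_arr2: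
  assumes "f \<in> Arr C" "g \<in> Arr C" "h \<in> Arr C" "Cod C f = x" "Cod C g = y" "Cod C h = z"
    "k \<in> Arr C" "Cod C k = (Dom C f \<otimes> Dom C g) \<otimes> Dom C h"
  shows "Assoc C x y z \<cdot> (((f \<boxtimes> g) \<boxtimes> h) \<cdot> k) =
    (f \<boxtimes> (g \<boxtimes> h)) \<cdot> (Assoc C (Dom C f) (Dom C g) (Dom C h) \<cdot> k)"
  using assms assoc_natural_arr[OF assms(1-6)] by (auto simp flip: comp_assoc_arr)

lemma inverse_assoc_natural:
  assumes "f \<in> Arr C" "g \<in> Arr C" "h \<in> Arr C" "Cod C f = x" "Cod C g = y" "Cod C h = z"
  shows "AInv x y z \<cdot> (f \<boxtimes> (g \<boxtimes> h)) = ((f \<boxtimes> g) \<boxtimes> h) \<cdot> AInv (Dom C f) (Dom C g) (Dom C h)"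
  by (rule comp_inverse_eq[OF assoc_iso assoc_iso])
    (use assms in \<open>auto intro!: homI simp: assoc_natural_arr\<close>)

lemma inverse_assoc_natural2:
  assumes "f \<in> Arr C" "g \<in> Arr C" "h \<in> Arr C" "Cod C f = x" "Cod C g = y" "Cod C h = z"
    "k \<in> Arr C" "Cod C k = Dom C f \<otimes> (Dom C g \<otimes> Dom C h)"
  shows "AInv x y z \<cdot> ((f \<boxtimes> (g \<boxtimes> h)) \<cdot> k) =
    ((f \<boxtimes> g) \<boxtimes> h) \<cdot> (AInv (Dom C f) (Dom C g) (Dom C h) \<cdot> k)"
  using assms inverse_assoc_natural[OF assms(1-6)] by (auto simp flip: comp_assoc_arr)

lemma lunit_natural_arr:
  "\<lbrakk>f \<in> Arr C; Cod C f = x\<rbrakk> \<Longrightarrow> LUnit C x \<cdot> (Ident C (Unit C) \<boxtimes> f) = f \<cdot> LUnit C (Dom C f)"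
  by (rule lunit_natural) (auto intro!: homI)

lemma runit_natural_arr:
  "\<lbrakk>f \<in> Arr C; Cod C f = x\<rbrakk> \<Longrightarrow> RUnit C x \<cdot> (f \<boxtimes> Ident C (Unit C)) = f \<cdot> RUnit C (Dom C f)"
  by (rule runit_natural) (auto intro!: homI)

lemma inverse_lunit_natural:
  "\<lbrakk>f \<in> Arr C; Cod C f = x\<rbrakk> \<Longrightarrow> LInv x \<cdot> f = (Ident C (Unit C) \<boxtimes> f) \<cdot> LInv (Dom C f)"
  by (rule comp_inverse_eq[OF lunit_iso lunit_iso]) (auto intro!: homI simp: lunit_natural_arr)

text \<open>The left unitor makes tensoring with I naturally isomorphic to the identity, hence
  faithful. Kelly's argument rests on this: the pentagon and the triangle yield the unit equations
  only after padding with a further I.\<close>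

lemma unit_tensor_faithful:
  assumes "f \<in> Arr C" "g \<in> Arr C" "Dom C f = Dom C g" "Cod C f = Cod C g"
    "Ident C (Unit C) \<boxtimes> f = Ident C (Unit C) \<boxtimes> g"
  shows "f = g"
  by (rule iso_cancel_right[OF lunit_iso[of "Dom C f"]])
    (use assms lunit_natural_arr[of f "Cod C f"] lunit_natural_arr[of g "Cod C g"] in auto)

lemma tensor_unit_faithful:
  assumes "f \<in> Arr C" "g \<in> Arr C" "Dom C f = Dom C g" "Cod C f = Cod C g"
    "f \<boxtimes> Ident C (Unit C) = g \<boxtimes> Ident C (Unit C)"
  shows "f = g"
  by (rule iso_cancel_right[OF runit_iso[of "Dom C f"]])
    (use assms runit_natural_arr[of f "Cod C f"] runit_natural_arr[of g "Cod C g"] in auto)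

text \<open>The unit coherences that Kelly deduced from the pentagon and the triangle.\<close>

lemma lunit_tensor:
  assumes [simp]: "x \<in> Obj C" "y \<in> Obj C"
  shows "LUnit C (x \<otimes> y) \<cdot> Assoc C (Unit C) x y = LUnit C x \<boxtimes> Ident C y"
proof (rule unit_tensor_faithful)
  let ?I = "Unit C" and ?one = "Ident C (Unit C)"
  \<comment> \<open>\<open>?X\<close> is the part of the pentagon for I, I, x, y that is applied
    before the associator in question. Both sides are compared after it, and being invertible it is
    cancelled at the end.\<close>
  let ?X = "Assoc C ?I (?I \<otimes> x) y \<cdot> (Assoc C ?I ?I x \<boxtimes> Ident C y)"
  have X: "?X \<in> isos C (((?I \<otimes> ?I) \<otimes> x) \<otimes> y) (?I \<otimes> ((?I \<otimes> x) \<otimes> y))"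
    by (rule comp_iso tensor_ident_iso assoc_iso | simp)+
  have "(?one \<boxtimes> (LUnit C (x \<otimes> y) \<cdot> Assoc C ?I x y)) \<cdot> ?X =
      (?one \<boxtimes> LUnit C (x \<otimes> y)) \<cdot>
        ((?one \<boxtimes> Assoc C ?I x y) \<cdot> Assoc C ?I (?I \<otimes> x) y \<cdot> (Assoc C ?I ?I x \<boxtimes> Ident C y))"
    by simp
  also have "\<dots> = (?one \<boxtimes> LUnit C (x \<otimes> y)) \<cdot> (Assoc C ?I ?I (x \<otimes> y) \<cdot> Assoc C (?I \<otimes> ?I) x y)"
    by (subst pentagon) auto
  also have "\<dots> = ((?one \<boxtimes> LUnit C (x \<otimes> y)) \<cdot> Assoc C ?I ?I (x \<otimes> y)) \<cdot> Assoc C (?I \<otimes> ?I) x y"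
    by simp
  also have "\<dots> = (RUnit C ?I \<boxtimes> Ident C (x \<otimes> y)) \<cdot> Assoc C (?I \<otimes> ?I) x y"
    by (subst triangle) auto
  also have "\<dots> = Assoc C ?I x y \<cdot> ((RUnit C ?I \<boxtimes> Ident C x) \<boxtimes> Ident C y)"
    by (simp add: assoc_natural_arr)
  also have "\<dots> = Assoc C ?I x y \<cdot> (((?one \<boxtimes> LUnit C x) \<cdot> Assoc C ?I ?I x) \<boxtimes> Ident C y)"
    by (subst triangle) auto
  also have "\<dots> = Assoc C ?I x y \<cdot> ((?one \<boxtimes> LUnit C x) \<boxtimes> Ident C y) \<cdot> (Assoc C ?I ?I x \<boxtimes> Ident C y)"
    by simp
  also have "\<dots> = (?one \<boxtimes> (LUnit C x \<boxtimes> Ident C y)) \<cdot> ?X"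
    by (subst assoc_natural_arr) auto
  finally have eq: "(?one \<boxtimes> (LUnit C (x \<otimes> y) \<cdot> Assoc C ?I x y)) \<cdot> ?X =
    (?one \<boxtimes> (LUnit C x \<boxtimes> Ident C y)) \<cdot> ?X" .
  show "?one \<boxtimes> (LUnit C (x \<otimes> y) \<cdot> Assoc C ?I x y) = ?one \<boxtimes> (LUnit C x \<boxtimes> Ident C y)"
    by (rule iso_cancel_right[OF X _ _ _ _ eq]) auto
qed auto

text \<open>Mirror image of \<open>lunit_tensor\<close>, padded with I on the right: the triangle
  for y and I, the pentagon for x, y, I, I and the triangle for x \<otimes> y and I combine, and the
  associator of x, y, I is cancelled on the left.\<close>

lemma runit_tensor:
  assumes [simp]: "x \<in> Obj C" "y \<in> Obj C"
  shows "(Ident C x \<boxtimes> RUnit C y) \<cdot> Assoc C x y (Unit C) = RUnit C (x \<otimes> y)"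
proof (rule tensor_unit_faithful)
  let ?I = "Unit C" and ?one = "Ident C (Unit C)"
  have "Assoc C x y ?I \<cdot> (((Ident C x \<boxtimes> RUnit C y) \<cdot> Assoc C x y ?I) \<boxtimes> ?one) =
      Assoc C x y ?I \<cdot> ((Ident C x \<boxtimes> RUnit C y) \<boxtimes> ?one) \<cdot> (Assoc C x y ?I \<boxtimes> ?one)"
    by simp
  also have "\<dots> = (Ident C x \<boxtimes> (RUnit C y \<boxtimes> ?one)) \<cdot> Assoc C x (y \<otimes> ?I) ?I \<cdot> (Assoc C x y ?I \<boxtimes> ?one)"
    by (subst assoc_natural_arr) auto
  also have "\<dots> = (Ident C x \<boxtimes> ((Ident C y \<boxtimes> LUnit C ?I) \<cdot> Assoc C y ?I ?I)) \<cdot>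
      Assoc C x (y \<otimes> ?I) ?I \<cdot> (Assoc C x y ?I \<boxtimes> ?one)"
    by (subst triangle) auto
  also have "\<dots> = (Ident C x \<boxtimes> (Ident C y \<boxtimes> LUnit C ?I)) \<cdot>
      ((Ident C x \<boxtimes> Assoc C y ?I ?I) \<cdot> Assoc C x (y \<otimes> ?I) ?I \<cdot> (Assoc C x y ?I \<boxtimes> ?one))"
    by simp
  also have "\<dots> = (Ident C x \<boxtimes> (Ident C y \<boxtimes> LUnit C ?I)) \<cdot>
      (Assoc C x y (?I \<otimes> ?I) \<cdot> Assoc C (x \<otimes> y) ?I ?I)"
    by (subst pentagon) auto
  also have "\<dots> = Assoc C x y ?I \<cdot> ((Ident C (x \<otimes> y) \<boxtimes> LUnit C ?I) \<cdot> Assoc C (x \<otimes> y) ?I ?I)"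
    by (simp add: assoc_natural_arr2 flip: tensor_ident)
  also have "\<dots> = Assoc C x y ?I \<cdot> (RUnit C (x \<otimes> y) \<boxtimes> ?one)"
    by (subst triangle) auto
  finally have eq: "Assoc C x y ?I \<cdot> (((Ident C x \<boxtimes> RUnit C y) \<cdot> Assoc C x y ?I) \<boxtimes> ?one) =
    Assoc C x y ?I \<cdot> (RUnit C (x \<otimes> y) \<boxtimes> ?one)" .
  show "((Ident C x \<boxtimes> RUnit C y) \<cdot> Assoc C x y ?I) \<boxtimes> ?one = RUnit C (x \<otimes> y) \<boxtimes> ?one"
    by (rule iso_cancel_left[OF assoc_iso[of x y ?I] _ _ _ _ eq]) auto
qed auto

text \<open>Naturality of the left unitor of I at itself identifies two left unitors on I \<otimes>
  I; then \<open>lunit_tensor\<close> and the triangle express both unitors of I, tensored with I,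
  by one arrow. The tensor functor mixes left and right unitors at I, in its unit law and in its
  value at the units of the corollas.\<close>

lemma lunit_unit_eq_runit_unit: "LUnit C (Unit C) = RUnit C (Unit C)"
proof (rule tensor_unit_faithful)
  let ?I = "Unit C" and ?one = "Ident C (Unit C)"
  have "LUnit C ?I \<cdot> (?one \<boxtimes> LUnit C ?I) = LUnit C ?I \<cdot> LUnit C (?I \<otimes> ?I)"
    by (simp add: lunit_natural_arr)
  from iso_cancel_left[OF lunit_iso[of ?I] _ _ _ _ this]
  have "?one \<boxtimes> LUnit C ?I = LUnit C (?I \<otimes> ?I)" by simp
  then show "LUnit C ?I \<boxtimes> ?one = RUnit C ?I \<boxtimes> ?one"
    using lunit_tensor[of ?I ?I] triangle[of ?I ?I] by simp
qed auto

lemma inverse_lunit_tensor: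
  assumes [simp]: "x \<in> Obj C" "y \<in> Obj C"
  shows "Assoc C (Unit C) x y \<cdot> (LInv x \<boxtimes> Ident C y) = LInv (x \<otimes> y)"
proof (rule iso_cancel_left[OF lunit_iso[of "x \<otimes> y"]])
  show "LUnit C (x \<otimes> y) \<cdot> (Assoc C (Unit C) x y \<cdot> (LInv x \<boxtimes> Ident C y)) =
      LUnit C (x \<otimes> y) \<cdot> LInv (x \<otimes> y)"
    using lunit_tensor[of x y] by (simp flip: comp_assoc_arr)
qed auto

end

section \<open>Categories presented by hom-sets\<close>

lemma hom_cat_simps [simp]:
  "Obj (hom_cat X H i c) = X"
  "Dom (hom_cat X H i c) = source"
  "Cod (hom_cat X H i c) = target"
  "Ident (hom_cat X H i c) x = Arrow x x (i x)"
  "Comp (hom_cat X H i c) g f = Arrow (source f) (target g) (c (source f) (underlying g) (underlying f))"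
  "f \<in> Arr (hom_cat X H i c) \<longleftrightarrow> source f \<in> X \<and> target f \<in> X \<and> underlying f \<in> H (source f) (target f)"
  by (cases f; force simp: hom_cat_def)+

lemma hom_hom_cat:
  "f \<in> hom (hom_cat X H i c) x y \<longleftrightarrow> x \<in> X \<and> y \<in> X \<and> (\<exists>m \<in> H x y. f = Arrow x y m)"
  by (cases f) (auto simp: hom_def)

lemma hom_cat_category:
  assumes "\<And>x. x \<in> X \<Longrightarrow> i x \<in> H x x"
    and "\<And>x y z f g. \<lbrakk>x \<in> X; y \<in> X; z \<in> X; f \<in> H x y; g \<in> H y z\<rbrakk> \<Longrightarrow> c x g f \<in> H x z"
    and "\<And>x y f. \<lbrakk>x \<in> X; y \<in> X; f \<in> H x y\<rbrakk> \<Longrightarrow> c x f (i x) = f"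
    and "\<And>x y f. \<lbrakk>x \<in> X; y \<in> X; f \<in> H x y\<rbrakk> \<Longrightarrow> c x (i y) f = f"
    and "\<And>w x y z f g h. \<lbrakk>w \<in> X; x \<in> X; y \<in> X; z \<in> X; f \<in> H w x; g \<in> H x y; h \<in> H y z\<rbrakk>
      \<Longrightarrow> c w h (c w g f) = c w (c x h g) f"
  shows "category (hom_cat X H i c)"
  by unfold_locales (auto simp: hom_hom_cat assms)

section \<open>Pruned trees in terms of their leaves\<close>

text \<open>As projections are surjective, a morphism of trees is determined by its effect on leaves, and it
  is a map of leaves preserving the two relations \<open>before\<close> (a preorder, with the fibres as
  equivalence classes) and \<open>within\<close>.\<close>

definition before :: "tree \<Rightarrow> nat rel" where
  "before t = {(x, y). x \<in> nodes2 t \<and> y \<in> nodes2 t \<and> (proj t x, proj t y) \<in> lev1 t}"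

definition within :: "tree \<Rightarrow> nat rel" where
  "within t = {(x, y). (x, y) \<in> lev2 t \<and> proj t x = proj t y}"

definition leaf_map :: "tree \<Rightarrow> tree \<Rightarrow> (nat \<Rightarrow> nat) \<Rightarrow> bool" where
  "leaf_map s t f \<longleftrightarrow> (\<forall>x \<in> nodes2 s. f x \<in> nodes2 t) \<and>
     (\<forall>x y. (x, y) \<in> before s \<longrightarrow> (f x, f y) \<in> before t) \<and>
     (\<forall>x y. (x, y) \<in> within s \<longrightarrow> (f x, f y) \<in> within t)"

abbreviation leaf :: "tree_arrow \<Rightarrow> nat \<Rightarrow> nat" where
  "leaf F \<equiv> fst (underlying F)"

text \<open>The level 1 map is read off from an arbitrarily chosen leaf over each node; for a leaf
  map the choice is immaterial by \<open>leaf_map_proj\<close>.\<close>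

definition leaf_arrow :: "tree \<Rightarrow> tree \<Rightarrow> (nat \<Rightarrow> nat) \<Rightarrow> tree_arrow" where
  "leaf_arrow s t f = Arrow s t (restrict_levels s
     (f, \<lambda>x. proj t (f (SOME z. z \<in> nodes2 s \<and> proj s z = x))))"

lemma Omega2_hom_cat_simps [simp]:
  "Obj Omega2 = pruned_trees"
  "Dom Omega2 = source"
  "Cod Omega2 = target"
  "Ident Omega2 t = Arrow t t (restrict_levels t (id, id))"
  "Comp Omega2 G F = Arrow (source F) (target G) (tree_comp (source F) (underlying G) (underlying F))"
  "F \<in> Arr Omega2 \<longleftrightarrow> source F \<in> pruned_trees \<and> target F \<in> pruned_trees \<and>
    underlying F \<in> tree_maps (source F) (target F)"
  by (simp_all add: Omega2_def cat.defs)

lemma hom_Omega2: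
  "F \<in> hom Omega2 s t \<longleftrightarrow>
    s \<in> pruned_trees \<and> t \<in> pruned_trees \<and> (\<exists>m \<in> tree_maps s t. F = Arrow s t m)"
  by (cases F) (auto simp: hom_def)

lemma hom_pruned: "F \<in> hom Omega2 s t \<Longrightarrow> s \<in> pruned_trees" "F \<in> hom Omega2 s t \<Longrightarrow> t \<in> pruned_trees"
  by (auto simp: hom_Omega2)

lemma Omega2_tensor_simps [simp]:
  "TensorO Omega2 = tree_sum"
  "Unit Omega2 = empty_tree"
  "Assoc Omega2 s t u = same_map (tree_sum (tree_sum s t) u) (tree_sum s (tree_sum t u))
    (copair (copair inl (inr \<circ> inl)) (inr \<circ> inr))"
  "LUnit Omega2 t = same_map (tree_sum empty_tree t) t (copair id id)"
  "RUnit Omega2 t = same_map (tree_sum t empty_tree) t (copair id id)"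
  "TensorA Omega2 F G = Arrow (tree_sum (source F) (source G)) (tree_sum (target F) (target G))
    (restrict_levels (tree_sum (source F) (source G))
      (sum_map (leaf F) (leaf G), sum_map (snd (underlying F)) (snd (underlying G))))"
  by (simp_all add: Omega2_def cat.defs moncat.defs Let_def)

lemma linear_orderD:
  assumes "Linear_order r"
  shows "x \<in> Field r \<Longrightarrow> (x, x) \<in> r"
    "\<lbrakk>(x, y) \<in> r; (y, z) \<in> r\<rbrakk> \<Longrightarrow> (x, z) \<in> r"
    "\<lbrakk>(x, y) \<in> r; (y, x) \<in> r\<rbrakk> \<Longrightarrow> x = y"
    "\<lbrakk>x \<in> Field r; y \<in> Field r\<rbrakk> \<Longrightarrow> (x, y) \<in> r \<or> (y, x) \<in> r"
proof -
  have r: "refl_on (Field r) r" "trans r" "antisym r" "total_on (Field r) r"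
    using assms unfolding linear_order_on_def partial_order_on_def preorder_on_def by blast+
  show refl: "x \<in> Field r \<Longrightarrow> (x, x) \<in> r" for x
    using r(1) by (rule refl_onD)
  show "\<lbrakk>(x, y) \<in> r; (y, z) \<in> r\<rbrakk> \<Longrightarrow> (x, z) \<in> r" using r(2) by (rule transD)
  show "\<lbrakk>(x, y) \<in> r; (y, x) \<in> r\<rbrakk> \<Longrightarrow> x = y" using r(3) by (rule antisymD)
  show "\<lbrakk>x \<in> Field r; y \<in> Field r\<rbrakk> \<Longrightarrow> (x, y) \<in> r \<or> (y, x) \<in> r"
    using r(4) refl by (cases "x = y") (auto simp: total_on_def)
qed

lemma linear_orderI:
  assumes "\<And>x. x \<in> Field r \<Longrightarrow> (x, x) \<in> r"
    and "\<And>x y z. \<lbrakk>(x, y) \<in> r; (y, z) \<in> r\<rbrakk> \<Longrightarrow> (x, z) \<in> r"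
    and "\<And>x y. \<lbrakk>(x, y) \<in> r; (y, x) \<in> r\<rbrakk> \<Longrightarrow> x = y"
    and "\<And>x y. \<lbrakk>x \<in> Field r; y \<in> Field r\<rbrakk> \<Longrightarrow> (x, y) \<in> r \<or> (y, x) \<in> r"
  shows "Linear_order r"
  unfolding linear_order_on_def partial_order_on_def preorder_on_def refl_on_def antisym_def
    total_on_def trans_def
  using assms by (auto simp: Field_def)

lemma pruned_treeD:
  assumes "t \<in> pruned_trees"
  shows "finite (nodes2 t)" "Linear_order (lev2 t)" "finite (nodes1 t)" "Linear_order (lev1 t)"
    "proj t ` nodes2 t = nodes1 t" "x \<in> nodes2 t \<Longrightarrow> proj t x \<in> nodes1 t"
  using assms by (auto simp: pruned_trees_def fin_ordered_def)

lemma before_antisym: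
  "\<lbrakk>t \<in> pruned_trees; (x, y) \<in> before t; (y, x) \<in> before t\<rbrakk> \<Longrightarrow> proj t x = proj t y"
  using linear_orderD(3)[OF pruned_treeD(4)] by (auto simp: before_def)

lemma leaf_map_nodes: "\<lbrakk>leaf_map s t f; x \<in> nodes2 s\<rbrakk> \<Longrightarrow> f x \<in> nodes2 t"
  by (simp add: leaf_map_def)

text \<open>Leaves of one fibre are before each other in both directions, and so are their images;
  antisymmetry of the level 1 order then puts the images into one fibre.\<close>

lemma leaf_map_proj:
  assumes "s \<in> pruned_trees" "t \<in> pruned_trees" "leaf_map s t f" "x \<in> nodes2 s" "y \<in> nodes2 s"
    "proj s x = proj s y"
  shows "proj t (f x) = proj t (f y)"
proof -
  have "(x, y) \<in> before s" "(y, x) \<in> before s"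
    using assms pruned_treeD[OF assms(1)] linear_orderD(1)[OF pruned_treeD(4)[OF assms(1)]]
    by (auto simp: before_def)
  then show ?thesis
    using assms(3) before_antisym[OF assms(2)] by (auto simp: leaf_map_def)
qed

lemma leaf_map_hom:
  assumes "F \<in> hom Omega2 s t"
  shows "leaf_map s t (leaf F)"
proof -
  obtain f2 f1 where F: "F = Arrow s t (f2, f1)" and m: "(f2, f1) \<in> tree_maps s t"
    and st: "s \<in> pruned_trees" "t \<in> pruned_trees"
    using assms by (auto simp: hom_Omega2)
  have "x \<in> nodes2 s \<Longrightarrow> f2 x \<in> nodes2 t" for x using m by (auto simp: tree_maps_def)
  moreover have "(f2 x, f2 y) \<in> before t" if "(x, y) \<in> before s" for x y
    using that m by (fastforce simp: tree_maps_def before_def)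
  moreover have "(f2 x, f2 y) \<in> within t" if "(x, y) \<in> within s" for x y
    using that m FieldI1[of x y "lev2 s"] FieldI2[of x y "lev2 s"]
    by (fastforce simp: tree_maps_def within_def)
  ultimately show ?thesis by (auto simp: F leaf_map_def)
qed

text \<open>Every node of level 1 lies under a leaf, so a relation between nodes lifts to leaves.
  Preservation of \<open>before\<close> by f2 and compatibility with the projections therefore make
  f1 order-preserving.\<close>

lemma tree_arrow_hom:
  assumes s: "s \<in> pruned_trees" and t: "t \<in> pruned_trees" and f: "leaf_map s t f2"
    and f1: "\<And>x. x \<in> nodes2 s \<Longrightarrow> f1 (proj s x) = proj t (f2 x)"
  shows "Arrow s t (restrict_levels s (f2, f1)) \<in> hom Omega2 s t"
proof -
  have mono: "(f1 x, f1 y) \<in> lev1 t" if "(x, y) \<in> lev1 s" for x y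
  proof -
    have "x \<in> nodes1 s" "y \<in> nodes1 s" using that by (auto simp: Field_def)
    then obtain x' y' where xy: "x' \<in> nodes2 s" "y' \<in> nodes2 s" "x = proj s x'" "y = proj s y'"
      unfolding pruned_treeD(5)[OF s, symmetric] by blast
    then have "(x', y') \<in> before s" using that by (simp add: before_def)
    then have "(f2 x', f2 y') \<in> before t" using f by (simp add: leaf_map_def)
    then show ?thesis using f1 xy by (simp add: before_def)
  qed
  have nodes1: "f1 x \<in> nodes1 t" if "x \<in> nodes1 s" for x
    using that f1 leaf_map_nodes[OF f] pruned_treeD(6)[OF t]
    unfolding pruned_treeD(5)[OF s, symmetric] by auto
  have fields: "x \<in> nodes1 s" "y \<in> nodes1 s" if "(x, y) \<in> lev1 s" for x y
    using that by (auto simp: Field_def)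
  have within: "(f2 x, f2 y) \<in> lev2 t" "x \<in> nodes2 s" "y \<in> nodes2 s"
    if "(x, y) \<in> lev2 s" "proj s x = proj s y" for x y
    using that f by (auto simp: leaf_map_def within_def Field_def)
  have "restrict_levels s (f2, f1) \<in> tree_maps s t"
    unfolding tree_maps_def restrict_levels_def
    using mono nodes1 fields within f1 leaf_map_nodes[OF f] pruned_treeD(6)[OF s]
    by auto
  then show ?thesis using s t by (simp add: hom_Omega2)
qed

lemma leaf_arrow_hom:
  assumes s: "s \<in> pruned_trees" and t: "t \<in> pruned_trees" and f: "leaf_map s t f"
  shows "leaf_arrow s t f \<in> hom Omega2 s t"
  unfolding leaf_arrow_def
proof (rule tree_arrow_hom[OF s t f])
  fix x assume x: "x \<in> nodes2 s"
  let ?z = "SOME z. z \<in> nodes2 s \<and> proj s z = proj s x"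
  have "?z \<in> nodes2 s \<and> proj s ?z = proj s x" by (rule someI[where x = x]) (use x in simp)
  then show "proj t (f ?z) = proj t (f x)" using leaf_map_proj[OF s t f] x by blast
qed

lemma leaf_restrict [simp]:
  "x \<in> nodes2 s \<Longrightarrow> fst (restrict_levels s (f2, f1)) x = f2 x"
  by (simp add: restrict_levels_def)

lemma leaf_leaf_arrow [simp]: "x \<in> nodes2 s \<Longrightarrow> leaf (leaf_arrow s t f) x = f x"
  by (simp add: leaf_arrow_def)

lemma leaf_same_map [simp]: "x \<in> nodes2 s \<Longrightarrow> leaf (same_map s t f) x = f x"
  by (simp add: same_map_def)

lemma tree_arrow_eqI:
  assumes F: "F \<in> hom Omega2 s t" and G: "G \<in> hom Omega2 s t"
    and eq: "\<And>x. x \<in> nodes2 s \<Longrightarrow> leaf F x = leaf G x"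
  shows "F = G"
proof -
  obtain f2 f1 where F': "F = Arrow s t (f2, f1)" and f: "(f2, f1) \<in> tree_maps s t"
    and s: "s \<in> pruned_trees" using F by (auto simp: hom_Omega2)
  obtain g2 g1 where G': "G = Arrow s t (g2, g1)" and g: "(g2, g1) \<in> tree_maps s t"
    using G by (auto simp: hom_Omega2)
  have 2: "f2 = g2"
    by (rule PiE_ext[of _ "nodes2 s" "\<lambda>_. nodes2 t"]) (use f g eq F' G' in \<open>auto simp: tree_maps_def\<close>)
  have "f1 = g1"
  proof (rule PiE_ext[of _ "nodes1 s" "\<lambda>_. nodes1 t"])
    fix y assume "y \<in> nodes1 s"
    then obtain x where "x \<in> nodes2 s" "y = proj s x"
      unfolding pruned_treeD(5)[OF s, symmetric] by blast
    then show "f1 y = g1 y" using f g 2 by (auto simp: tree_maps_def)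
  qed (use f g in \<open>auto simp: tree_maps_def\<close>)
  with 2 F' G' show ?thesis by simp
qed

lemma leaf_comp [simp]:
  "F \<in> hom Omega2 s t \<Longrightarrow> x \<in> nodes2 s \<Longrightarrow> leaf (G \<cdot>\<^bsub>Omega2\<^esub> F) x = leaf G (leaf F x)"
  by (auto simp: hom_Omega2 tree_comp_def restrict_levels_def)

lemma leaf_ident [simp]: "x \<in> nodes2 s \<Longrightarrow> leaf (Ident Omega2 s) x = x"
  by simp

lemma leaf_hom: "\<lbrakk>F \<in> hom Omega2 s t; x \<in> nodes2 s\<rbrakk> \<Longrightarrow> leaf F x \<in> nodes2 t"
  using leaf_map_hom leaf_map_nodes by blast

lemma tree_maps_comp:
  assumes F: "F \<in> hom Omega2 s t" and G: "G \<in> hom Omega2 t u"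
  shows "G \<cdot>\<^bsub>Omega2\<^esub> F \<in> hom Omega2 s u"
proof -
  obtain f2 f1 where F': "F = Arrow s t (f2, f1)" and f: "(f2, f1) \<in> tree_maps s t"
    and s: "s \<in> pruned_trees" using F by (auto simp: hom_Omega2)
  obtain g2 g1 where G': "G = Arrow t u (g2, g1)" and g: "(g2, g1) \<in> tree_maps t u"
    and u: "u \<in> pruned_trees" using G by (auto simp: hom_Omega2)
  have "Arrow s u (restrict_levels s (g2 \<circ> f2, g1 \<circ> f1)) \<in> hom Omega2 s u"
    by (rule tree_arrow_hom[OF s u])
      (use leaf_map_hom[OF F] leaf_map_hom[OF G] F' G' f g in
        \<open>auto simp: leaf_map_def tree_maps_def\<close>)
  then show ?thesis by (simp add: F' G' tree_comp_def)
qed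

lemma ident_tree_hom: "t \<in> pruned_trees \<Longrightarrow> Ident Omega2 t \<in> hom Omega2 t t"
  by (simp, rule tree_arrow_hom) (auto simp: leaf_map_def)

interpretation Omega2: category Omega2
proof
  fix F G H s t u v
  { assume "F \<in> Arr Omega2"
    then show "Dom Omega2 F \<in> Obj Omega2" "Cod Omega2 F \<in> Obj Omega2" by simp_all }
  { assume "t \<in> Obj Omega2"
    then show "Ident Omega2 t \<in> hom Omega2 t t" using ident_tree_hom by simp }
  { assume F: "F \<in> hom Omega2 s t"
    then have st: "Ident Omega2 s \<in> hom Omega2 s s" "Ident Omega2 t \<in> hom Omega2 t t"
      by (auto intro: ident_tree_hom dest: hom_pruned simp del: Omega2_hom_cat_simps)
    show "F \<cdot>\<^bsub>Omega2\<^esub> Ident Omega2 s = F" "Ident Omega2 t \<cdot>\<^bsub>Omega2\<^esub> F = F"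
      using tree_maps_comp[OF st(1) F] tree_maps_comp[OF F st(2)] F leaf_hom[OF F]
      by (auto intro!: tree_arrow_eqI[of _ s t] simp: leaf_comp[OF st(1)] leaf_comp[OF F]
        simp del: Omega2_hom_cat_simps)
    assume G: "G \<in> hom Omega2 t u"
    show GF: "G \<cdot>\<^bsub>Omega2\<^esub> F \<in> hom Omega2 s u" by (rule tree_maps_comp[OF F G])
    assume H: "H \<in> hom Omega2 u v"
    have HG: "H \<cdot>\<^bsub>Omega2\<^esub> G \<in> hom Omega2 t v" by (rule tree_maps_comp[OF G H])
    show "H \<cdot>\<^bsub>Omega2\<^esub> (G \<cdot>\<^bsub>Omega2\<^esub> F) = (H \<cdot>\<^bsub>Omega2\<^esub> G) \<cdot>\<^bsub>Omega2\<^esub> F"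
      by (rule tree_arrow_eqI[OF tree_maps_comp[OF GF H] tree_maps_comp[OF F HG]])
        (simp add: leaf_comp[OF F] leaf_comp[OF GF] leaf_comp[OF G] leaf_hom[OF F]
          del: Omega2_hom_cat_simps) }
qed

subsection \<open>Sums of trees\<close>

lemma copair_simps [simp]: "copair f g (inl x) = f x" "copair f g (inr x) = g x"
  by (simp_all add: copair_def)

lemma sum_map_simps [simp]: "sum_map f g (inl x) = inl (f x)" "sum_map f g (inr x) = inr (g x)"
  by (simp_all add: sum_map_def)

lemma inl_inr_simps [simp]:
  "inl x = inl y \<longleftrightarrow> x = y" "inr x = inr y \<longleftrightarrow> x = y" "inl x \<noteq> inr y" "inr x \<noteq> inl y"
  by (simp_all add: sum_encode_eq)

lemma ordered_sum_simps [simp]: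
  "(inl x, inl y) \<in> r +\<^sub>o\<^sub>r\<^sub>d s \<longleftrightarrow> (x, y) \<in> r"
  "(inr x, inr y) \<in> r +\<^sub>o\<^sub>r\<^sub>d s \<longleftrightarrow> (x, y) \<in> s"
  "(inl x, inr y) \<in> r +\<^sub>o\<^sub>r\<^sub>d s \<longleftrightarrow> x \<in> Field r \<and> y \<in> Field s"
  "(inr x, inl y) \<notin> r +\<^sub>o\<^sub>r\<^sub>d s"
  by (auto simp: ordered_sum_def sum_encode_eq)

lemma Field_ordered_sum [simp]: "Field (r +\<^sub>o\<^sub>r\<^sub>d s) = inl ` Field r \<union> inr ` Field s"
proof -
  have "Field {(inl x, inl y) | x y. (x, y) \<in> r} = inl ` Field r"
    "Field {(inr x, inr y) | x y. (x, y) \<in> s} = inr ` Field s"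
    "Field {(inl x, inr y) | x y. x \<in> Field r \<and> y \<in> Field s} \<subseteq> inl ` Field r \<union> inr ` Field s"
    unfolding Field_def Domain_unfold Range_iff[abs_def] by fast+
  then show ?thesis unfolding ordered_sum_def Field_Un by blast
qed

lemma inl_inr_cases: obtains x where "z = inl x" | y where "z = inr y"
  using that by (cases "sum_decode z") (metis sum_decode_inverse)+

lemma fin_ordered_sum:
  assumes r: "fin_ordered r" and s: "fin_ordered s"
  shows "fin_ordered (r +\<^sub>o\<^sub>r\<^sub>d s)"
proof -
  note R = linear_orderD[of r] linear_orderD[of s]
  have RS: "Linear_order r" "Linear_order s" using assms by (auto simp: fin_ordered_def)
  have "Linear_order (r +\<^sub>o\<^sub>r\<^sub>d s)"
  proof (rule linear_orderI)
    fix x y z assume "(x, y) \<in> r +\<^sub>o\<^sub>r\<^sub>d s" "(y, z) \<in> r +\<^sub>o\<^sub>r\<^sub>d s"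
    then show "(x, z) \<in> r +\<^sub>o\<^sub>r\<^sub>d s"
      by (cases x rule: inl_inr_cases; cases y rule: inl_inr_cases; cases z rule: inl_inr_cases)
        (auto dest: linear_orderD(2)[OF RS(1)] linear_orderD(2)[OF RS(2)] FieldI1 FieldI2)
  next
    fix x y assume "(x, y) \<in> r +\<^sub>o\<^sub>r\<^sub>d s" "(y, x) \<in> r +\<^sub>o\<^sub>r\<^sub>d s"
    then show "x = y"
      by (cases x rule: inl_inr_cases; cases y rule: inl_inr_cases)
        (auto dest: linear_orderD(3)[OF RS(1)] linear_orderD(3)[OF RS(2)])
  qed (auto intro: linear_orderD(1)[OF RS(1)] linear_orderD(1)[OF RS(2)]
      dest: linear_orderD(4)[OF RS(1)] linear_orderD(4)[OF RS(2)])
  then show ?thesis using assms by (auto simp: fin_ordered_def)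
qed

lemma tree_sum_simps [simp]:
  "lev2 (tree_sum s t) = lev2 s +\<^sub>o\<^sub>r\<^sub>d lev2 t"
  "lev1 (tree_sum s t) = lev1 s +\<^sub>o\<^sub>r\<^sub>d lev1 t"
  "x \<in> nodes2 s \<Longrightarrow> proj (tree_sum s t) (inl x) = inl (proj s x)"
  "y \<in> nodes2 t \<Longrightarrow> proj (tree_sum s t) (inr y) = inr (proj t y)"
  by (simp_all add: tree_sum_def)

lemma tree_sum_pruned [simp]:
  assumes "s \<in> pruned_trees" "t \<in> pruned_trees"
  shows "tree_sum s t \<in> pruned_trees"
proof -
  have "proj (tree_sum s t) ` nodes2 (tree_sum s t) = nodes1 (tree_sum s t)"
    by (simp add: image_Un image_image flip: pruned_treeD(5)[OF assms(1)] pruned_treeD(5)[OF assms(2)])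
  moreover have "proj (tree_sum s t) \<in> extensional (nodes2 (tree_sum s t))"
    by (simp add: tree_sum_def)
  ultimately show ?thesis
    using assms by (auto simp: pruned_trees_def fin_ordered_sum PiE_def simp del: Field_ordered_sum)
qed

lemma before_tree_sum [simp]:
  "(inl x, inl y) \<in> before (tree_sum s t) \<longleftrightarrow> (x, y) \<in> before s"
  "(inr x, inr y) \<in> before (tree_sum s t) \<longleftrightarrow> (x, y) \<in> before t"
  "\<lbrakk>s \<in> pruned_trees; t \<in> pruned_trees\<rbrakk> \<Longrightarrow>
    (inl x, inr y) \<in> before (tree_sum s t) \<longleftrightarrow> x \<in> nodes2 s \<and> y \<in> nodes2 t"
  "(inr x, inl y) \<notin> before (tree_sum s t)"
  by (auto simp: before_def pruned_treeD(6))

lemma within_tree_sum [simp]: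
  "(inl x, inl y) \<in> within (tree_sum s t) \<longleftrightarrow> (x, y) \<in> within s"
  "(inr x, inr y) \<in> within (tree_sum s t) \<longleftrightarrow> (x, y) \<in> within t"
  "(inl x, inr y) \<notin> within (tree_sum s t)"
  "(inr x, inl y) \<notin> within (tree_sum s t)"
  by (auto simp: within_def FieldI1 FieldI2)

text \<open>A mixed pair of leaves never shares a fibre, so \<open>within\<close> imposes nothing
  across the summands and only \<open>before\<close> remains. The images of the summands may thus
  meet in one fibre with their leaves interleaved, as they do under the codiagonal.\<close>

lemma leaf_map_tree_sum:
  assumes "s \<in> pruned_trees" "t \<in> pruned_trees"
  shows "leaf_map (tree_sum s t) u f \<longleftrightarrow> leaf_map s u (f \<circ> inl) \<and> leaf_map t u (f \<circ> inr) \<and>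
    (\<forall>x \<in> nodes2 s. \<forall>y \<in> nodes2 t. (f (inl x), f (inr y)) \<in> before u)"
    (is "?L \<longleftrightarrow> ?R")
proof
  show "?L \<Longrightarrow> ?R" using assms by (auto simp: leaf_map_def)
  assume R: ?R
  have "(f x, f y) \<in> before u" if "(x, y) \<in> before (tree_sum s t)" for x y
    using that R assms
    by (cases x rule: inl_inr_cases; cases y rule: inl_inr_cases) (auto simp: leaf_map_def)
  moreover have "(f x, f y) \<in> within u" if "(x, y) \<in> within (tree_sum s t)" for x y
    using that R assms
    by (cases x rule: inl_inr_cases; cases y rule: inl_inr_cases) (auto simp: leaf_map_def)
  ultimately show ?L using R by (auto simp: leaf_map_def)
qed

lemma empty_tree_simps [simp]: "lev2 empty_tree = {}" "lev1 empty_tree = {}"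
  by (simp_all add: empty_tree_def)

lemma empty_tree_pruned [simp]: "empty_tree \<in> pruned_trees"
  by (auto simp: pruned_trees_def fin_ordered_def linear_orderI) (auto simp: empty_tree_def)

lemma leaf_map_empty [simp]: "leaf_map empty_tree t f"
  by (simp add: leaf_map_def before_def within_def)

lemma leaf_map_sum_map:
  assumes "s \<in> pruned_trees" "t \<in> pruned_trees" "s' \<in> pruned_trees" "t' \<in> pruned_trees"
    "leaf_map s s' f" "leaf_map t t' g"
  shows "leaf_map (tree_sum s t) (tree_sum s' t') (sum_map f g)"
  using assms by (auto simp: leaf_map_tree_sum) (auto simp: leaf_map_def)

lemma tensor_tree_hom:
  assumes F: "F \<in> hom Omega2 s s'" and G: "G \<in> hom Omega2 t t'"
  shows "F \<boxtimes>\<^bsub>Omega2\<^esub> G \<in> hom Omega2 (tree_sum s t) (tree_sum s' t')"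
proof -
  obtain f2 f1 where F': "F = Arrow s s' (f2, f1)" and f: "(f2, f1) \<in> tree_maps s s'"
    using F by (auto simp: hom_Omega2)
  obtain g2 g1 where G': "G = Arrow t t' (g2, g1)" and g: "(g2, g1) \<in> tree_maps t t'"
    using G by (auto simp: hom_Omega2)
  have "Arrow (tree_sum s t) (tree_sum s' t') (restrict_levels (tree_sum s t)
      (sum_map f2 g2, sum_map f1 g1)) \<in> hom Omega2 (tree_sum s t) (tree_sum s' t')"
  proof (rule tree_arrow_hom)
    show "leaf_map (tree_sum s t) (tree_sum s' t') (sum_map f2 g2)"
      using hom_pruned[OF F] hom_pruned[OF G] leaf_map_hom[OF F] leaf_map_hom[OF G] F' G'
      by (auto simp: leaf_map_sum_map)
    have "f2 x \<in> nodes2 s' \<and> proj s' (f2 x) = f1 (proj s x)" if "x \<in> nodes2 s" for x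
      using f that by (auto simp: tree_maps_def)
    moreover have "g2 x \<in> nodes2 t' \<and> proj t' (g2 x) = g1 (proj t x)" if "x \<in> nodes2 t" for x
      using g that by (auto simp: tree_maps_def)
    ultimately show "sum_map f1 g1 (proj (tree_sum s t) x) = proj (tree_sum s' t') (sum_map f2 g2 x)"
      if "x \<in> nodes2 (tree_sum s t)" for x
      using that by auto
  qed (use hom_pruned[OF F] hom_pruned[OF G] in auto)
  then show ?thesis by (simp add: F' G')
qed

lemma leaf_tensor [simp]:
  assumes "F \<in> hom Omega2 s s'" "G \<in> hom Omega2 t t'"
  shows "x \<in> nodes2 s \<Longrightarrow> leaf (F \<boxtimes>\<^bsub>Omega2\<^esub> G) (inl x) = inl (leaf F x)"
    "y \<in> nodes2 t \<Longrightarrow> leaf (F \<boxtimes>\<^bsub>Omega2\<^esub> G) (inr y) = inr (leaf G y)"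
  using assms by (auto simp: hom_Omega2 restrict_levels_def)

lemma same_map_hom:
  assumes "s \<in> pruned_trees" "t \<in> pruned_trees" "leaf_map s t f"
    "\<And>x. x \<in> nodes2 s \<Longrightarrow> f (proj s x) = proj t (f x)"
  shows "same_map s t f \<in> hom Omega2 s t"
  unfolding same_map_def by (rule tree_arrow_hom) (use assms in auto)

lemma tree_assoc_hom:
  assumes "s \<in> pruned_trees" "t \<in> pruned_trees" "u \<in> pruned_trees"
  shows "Assoc Omega2 s t u \<in> hom Omega2 (tree_sum (tree_sum s t) u) (tree_sum s (tree_sum t u))"
  unfolding Omega2_tensor_simps
  by (rule same_map_hom)
    (use assms in \<open>auto simp: leaf_map_tree_sum\<close>, auto simp: leaf_map_def)

lemma tree_lunit_hom: "t \<in> pruned_trees \<Longrightarrow> LUnit Omega2 t \<in> hom Omega2 (tree_sum empty_tree t) t"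
  unfolding Omega2_tensor_simps
  by (rule same_map_hom) (auto simp: leaf_map_tree_sum, auto simp: leaf_map_def)

lemma tree_runit_hom: "t \<in> pruned_trees \<Longrightarrow> RUnit Omega2 t \<in> hom Omega2 (tree_sum t empty_tree) t"
  unfolding Omega2_tensor_simps
  by (rule same_map_hom) (auto simp: leaf_map_tree_sum, auto simp: leaf_map_def)

declare Omega2_hom_cat_simps(4,5) [simp del] Omega2_tensor_simps(3-6) [simp del]

subsection \<open>Fibres as lists\<close>

definition enum_list :: "nat rel \<Rightarrow> nat set \<Rightarrow> nat list" where
  "enum_list r A = (THE xs. distinct xs \<and> set xs = A \<and> sorted_wrt (\<lambda>x y. (x, y) \<in> r) xs)"

lemma sorted_wrt_unique:
  assumes "\<And>x y. \<lbrakk>(x, y) \<in> r; (y, x) \<in> r\<rbrakk> \<Longrightarrow> x = y"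
  shows "\<lbrakk>distinct xs; distinct ys; set xs = set ys; sorted_wrt (\<lambda>x y. (x, y) \<in> r) xs;
    sorted_wrt (\<lambda>x y. (x, y) \<in> r) ys\<rbrakk> \<Longrightarrow> xs = ys"
proof (induction xs arbitrary: ys)
  case (Cons x xs)
  then obtain y ys' where ys: "ys = y # ys'" by (cases ys) auto
  have "x = y"
  proof (rule ccontr)
    assume "x \<noteq> y"
    then have "x \<in> set ys'" "y \<in> set xs" using Cons.prems(3) ys by auto
    then show False using Cons.prems(4,5) ys assms[of x y] \<open>x \<noteq> y\<close> by auto
  qed
  moreover have "set xs = set ys'"
    using Cons.prems(1-3) \<open>x = y\<close> ys by (auto simp: insert_ident)
  ultimately show ?case using Cons.IH[of ys'] Cons.prems ys by auto
qed auto

lemma sorted_wrt_exists: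
  assumes "Linear_order r" "finite A" "A \<subseteq> Field r"
  shows "\<exists>xs. distinct xs \<and> set xs = A \<and> sorted_wrt (\<lambda>x y. (x, y) \<in> r) xs"
  using assms(2,3)
proof (induction A rule: finite_induct)
  case (insert a A)
  note r = linear_orderD[OF assms(1)]
  obtain xs where xs: "distinct xs" "set xs = A" "sorted_wrt (\<lambda>x y. (x, y) \<in> r) xs"
    using insert by auto
  \<comment> \<open>Insertion: the elements below a, then a, then the rest, which lie above a by
    totality.\<close>
  let ?ys = "filter (\<lambda>x. (x, a) \<in> r) xs @ a # filter (\<lambda>x. (x, a) \<notin> r) xs"
  have a: "(a, x) \<in> r" if "x \<in> A" "(x, a) \<notin> r" for x
    using r(4)[of a x] that insert.prems by auto
  have "sorted_wrt (\<lambda>x y. (x, y) \<in> r) ?ys"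
    using xs a by (auto simp: sorted_wrt_append sorted_wrt_filter intro: r(2))
  moreover have "distinct ?ys" "set ?ys = insert a A" using xs insert.hyps by auto
  ultimately show ?case by blast
qed auto

lemma enum_list_eqI:
  assumes "Linear_order r" "distinct xs" "set xs = A" "sorted_wrt (\<lambda>x y. (x, y) \<in> r) xs"
  shows "enum_list r A = xs"
  unfolding enum_list_def
  by (rule the_equality) (use assms sorted_wrt_unique[of r] linear_orderD(3)[OF assms(1)] in blast)+

lemma enum_list_props:
  assumes "Linear_order r" "finite A" "A \<subseteq> Field r"
  shows "distinct (enum_list r A)" "set (enum_list r A) = A"
    "sorted_wrt (\<lambda>x y. (x, y) \<in> r) (enum_list r A)"
  using sorted_wrt_exists[OF assms] enum_list_eqI[OF assms(1)] by auto

definition fibre :: "tree \<Rightarrow> nat \<Rightarrow> nat list" where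
  "fibre t x = enum_list (lev2 t) {z \<in> nodes2 t. proj t z = x}"

definition base_list :: "tree \<Rightarrow> nat list" where
  "base_list t = enum_list (lev1 t) (nodes1 t)"

text \<open>A normal form of the tree. The order between leaves of different fibres is lost, which
  is exactly the information that arrows ignore; accordingly trees of equal \<open>shape\<close>
  turn out to be isomorphic.\<close>

definition fibs :: "tree \<Rightarrow> nat list list" where
  "fibs t = map (fibre t) (base_list t)"

abbreviation shape :: "tree \<Rightarrow> nat list" where
  "shape t \<equiv> map length (fibs t)"

lemma fibre_props:
  assumes "t \<in> pruned_trees"
  shows "distinct (fibre t x)" "set (fibre t x) = {z \<in> nodes2 t. proj t z = x}"
    "sorted_wrt (\<lambda>x y. (x, y) \<in> lev2 t) (fibre t x)"
  unfolding fibre_def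
  using enum_list_props[OF pruned_treeD(2)[OF assms], of "{z \<in> nodes2 t. proj t z = x}"]
    pruned_treeD(1)[OF assms] by auto

lemma base_list_props:
  assumes "t \<in> pruned_trees"
  shows "distinct (base_list t)" "set (base_list t) = nodes1 t"
    "sorted_wrt (\<lambda>x y. (x, y) \<in> lev1 t) (base_list t)"
  unfolding base_list_def
  using enum_list_props[OF pruned_treeD(4)[OF assms], of "nodes1 t"]
    pruned_treeD(3)[OF assms] by auto

lemma fibre_nonempty: "\<lbrakk>t \<in> pruned_trees; x \<in> nodes1 t\<rbrakk> \<Longrightarrow> fibre t x \<noteq> []"
  using fibre_props(2)[of t x] pruned_treeD(5)[of t] by force

text \<open>Blocks abstract from fibres: disjoint because fibres are, nonempty because the
  projection is onto. Nonemptiness lets the later recursions test a whole block by its head.\<close>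

definition wf_blocks :: "nat list list \<Rightarrow> bool" where
  "wf_blocks xss \<longleftrightarrow> distinct (concat xss) \<and> [] \<notin> set xss"

lemma wf_blocks_Nil [simp]: "wf_blocks []"
  by (simp add: wf_blocks_def)

lemma wf_blocks_Cons:
  "wf_blocks (xs # xss) \<longleftrightarrow> distinct xs \<and> xs \<noteq> [] \<and> set xs \<inter> set (concat xss) = {} \<and> wf_blocks xss"
  by (auto simp: wf_blocks_def)

lemma wf_blocks_fibs:
  assumes t: "t \<in> pruned_trees"
  shows "wf_blocks (fibs t)" "set (concat (fibs t)) = nodes2 t"
proof -
  have "wf_blocks (map (fibre t) L)" if "distinct L" "set L \<subseteq> nodes1 t" for L
    using that by (induction L) (auto simp: wf_blocks_Cons fibre_props[OF t] fibre_nonempty[OF t])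
  then show "wf_blocks (fibs t)" using base_list_props[OF t] by (simp add: fibs_def)
  show "set (concat (fibs t)) = nodes2 t"
    using fibre_props(2)[OF t] base_list_props(2)[OF t] pruned_treeD(6)[OF t]
    by (auto simp: fibs_def)
qed

lemma fibs_empty [simp]: "fibs empty_tree = []"
  using base_list_props(2)[OF empty_tree_pruned] by (simp add: fibs_def)

lemma fibs_tree_sum:
  assumes s: "s \<in> pruned_trees" and t: "t \<in> pruned_trees"
  shows "fibs (tree_sum s t) = map (map inl) (fibs s) @ map (map inr) (fibs t)"
proof -
  note st = tree_sum_pruned[OF s t]
  have "base_list (tree_sum s t) = map inl (base_list s) @ map inr (base_list t)"
    unfolding base_list_def[of "tree_sum s t"]
    using base_list_props[OF s] base_list_props[OF t]
    by (intro enum_list_eqI[OF pruned_treeD(4)[OF st]])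
      (auto simp: distinct_map inj_on_def sorted_wrt_append sorted_wrt_map)
  moreover have "fibre (tree_sum s t) (inl x) = map inl (fibre s x)" for x
    unfolding fibre_def[of "tree_sum s t"]
    using fibre_props[OF s, of x]
    by (intro enum_list_eqI[OF pruned_treeD(2)[OF st]])
      (auto simp: distinct_map inj_on_def sorted_wrt_map)
  moreover have "fibre (tree_sum s t) (inr x) = map inr (fibre t x)" for x
    unfolding fibre_def[of "tree_sum s t"]
    using fibre_props[OF t, of x]
    by (intro enum_list_eqI[OF pruned_treeD(2)[OF st]])
      (auto simp: distinct_map inj_on_def sorted_wrt_map)
  ultimately show ?thesis by (simp add: fibs_def)
qed

lemma shape_tree_sum:
  "\<lbrakk>s \<in> pruned_trees; t \<in> pruned_trees\<rbrakk> \<Longrightarrow> shape (tree_sum s t) = shape s @ shape t"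
  by (simp add: fibs_tree_sum comp_def)

lemma sorted_wrt_nth_iff:
  assumes "Linear_order r" "distinct xs" "set xs \<subseteq> Field r" "sorted_wrt (\<lambda>x y. (x, y) \<in> r) xs"
    "i < length xs" "j < length xs"
  shows "(xs ! i, xs ! j) \<in> r \<longleftrightarrow> i \<le> j"
proof -
  note r = linear_orderD[OF assms(1)]
  have less: "(xs ! i, xs ! j) \<in> r" if "i < j" "j < length xs" for i j
    using sorted_wrt_nth_less[OF assms(4) that] .
  show ?thesis
  proof
    assume "(xs ! i, xs ! j) \<in> r"
    then show "i \<le> j"
      using less[of j i] r(3)[of "xs ! i" "xs ! j"] assms(2,5,6) nth_eq_iff_index_eq[of xs i j]
      by linarith
  next
    assume "i \<le> j"
    then show "(xs ! i, xs ! j) \<in> r"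
      using less[of i j] assms(3,5,6) r(1)[OF subsetD[OF assms(3) nth_mem[OF assms(5)]]] by (cases "i = j") auto
  qed
qed

lemma fibs_nth:
  assumes t: "t \<in> pruned_trees" and "i < length (fibs t)" "j < length (fibs t ! i)"
  shows "fibs t ! i ! j \<in> nodes2 t" "proj t (fibs t ! i ! j) = base_list t ! i"
proof -
  have "fibs t ! i ! j \<in> set (fibre t (base_list t ! i))"
    using assms(2,3) by (simp add: fibs_def)
  then show "fibs t ! i ! j \<in> nodes2 t" "proj t (fibs t ! i ! j) = base_list t ! i"
    using fibre_props(2)[OF t] by auto
qed

text \<open>Together with \<open>fibs_nth_within\<close> this expresses both relations of a tree by
  indices alone: block numbers for \<open>before\<close>, block number and position for
  \<open>within\<close>. Trees of equal shape can then be compared index by index.\<close>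

lemma fibs_nth_before:
  assumes t: "t \<in> pruned_trees" and i: "i < length (fibs t)" "j < length (fibs t ! i)"
    and i': "i' < length (fibs t)" "j' < length (fibs t ! i')"
  shows "(fibs t ! i ! j, fibs t ! i' ! j') \<in> before t \<longleftrightarrow> i \<le> i'"
  using sorted_wrt_nth_iff[OF pruned_treeD(4)[OF t] base_list_props(1)[OF t] _ base_list_props(3)[OF t]]
    base_list_props(2)[OF t] fibs_nth[OF t i] fibs_nth[OF t i'] i(1) i'(1)
  by (simp add: before_def fibs_def)

lemma fibs_nth_within:
  assumes t: "t \<in> pruned_trees" and i: "i < length (fibs t)" "j < length (fibs t ! i)"
    and i': "i' < length (fibs t)" "j' < length (fibs t ! i')"
  shows "(fibs t ! i ! j, fibs t ! i' ! j') \<in> within t \<longleftrightarrow> i = i' \<and> j \<le> j'"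
proof (cases "i = i'")
  case True
  have "set (fibre t x) \<subseteq> nodes2 t" for x using fibre_props(2)[OF t] by auto
  note sorted_wrt_nth_iff[OF pruned_treeD(2)[OF t] fibre_props(1)[OF t] this fibre_props(3)[OF t]]
  then show ?thesis
    using True i i' fibs_nth[OF t i] fibs_nth[OF t i'] by (auto simp: within_def fibs_def)
next
  case False
  then have "base_list t ! i \<noteq> base_list t ! i'"
    using base_list_props(1)[OF t] i i' by (simp add: fibs_def nth_eq_iff_index_eq)
  then show ?thesis
    using False fibs_nth[OF t i] fibs_nth[OF t i'] by (auto simp: within_def)
qed

lemma node_fibs_nth:
  assumes "t \<in> pruned_trees" "x \<in> nodes2 t"
  obtains i j where "i < length (fibs t)" "j < length (fibs t ! i)" "x = fibs t ! i ! j"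
proof -
  have "x \<in> set (concat (fibs t))" using wf_blocks_fibs(2) assms by blast
  then show thesis using that by (auto simp: in_set_conv_nth)
qed

subsection \<open>Rigid arrows\<close>

text \<open>Two parallel rigid arrows are equal, so that diagrams of structural isomorphisms of
  \<^term>\<open>Omega2\<close> commute without computation.\<close>

definition rigid :: "tree \<Rightarrow> tree \<Rightarrow> tree_arrow \<Rightarrow> bool" where
  "rigid s t F \<longleftrightarrow> F \<in> hom Omega2 s t \<and> map (map (leaf F)) (fibs s) = fibs t"

lemma rigid_hom: "rigid s t F \<Longrightarrow> F \<in> hom Omega2 s t"
  by (simp add: rigid_def)

lemma rigid_unique:
  assumes "rigid s t F" "rigid s t G"
  shows "F = G"
proof (rule tree_arrow_eqI)
  fix x assume "x \<in> nodes2 s"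
  then have "x \<in> set (concat (fibs s))"
    using wf_blocks_fibs(2)[of s] hom_pruned rigid_hom[OF assms(1)] by blast
  moreover have "map (map (leaf F)) (fibs s) = map (map (leaf G)) (fibs s)"
    using assms by (simp add: rigid_def)
  ultimately show "leaf F x = leaf G x" by auto
qed (use assms rigid_hom in auto)

lemma map_fibs_cong:
  assumes "s \<in> pruned_trees" "\<And>x. x \<in> nodes2 s \<Longrightarrow> f x = g x"
  shows "map (map f) (fibs s) = map (map g) (fibs s)"
  using wf_blocks_fibs(2)[OF assms(1)] assms(2) by auto

lemma rigid_ident: "s \<in> pruned_trees \<Longrightarrow> rigid s s (Ident Omega2 s)"
  using map_fibs_cong[of s "leaf (Ident Omega2 s)" id] leaf_ident[of _ s] ident_tree_hom[of s]
  by (simp add: rigid_def)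

lemma rigid_comp:
  assumes "rigid s t F" "rigid t u G"
  shows "rigid s u (G \<cdot>\<^bsub>Omega2\<^esub> F)"
proof -
  note F = rigid_hom[OF assms(1)] and G = rigid_hom[OF assms(2)]
  have "map (map (leaf (G \<cdot>\<^bsub>Omega2\<^esub> F))) (fibs s) = map (map (leaf G \<circ> leaf F)) (fibs s)"
    by (rule map_fibs_cong[OF hom_pruned(1)[OF F]]) (simp add: leaf_comp[OF F])
  then show ?thesis
    using assms tree_maps_comp[OF F G] by (simp add: rigid_def flip: map_map map_comp_map)
qed

lemma rigid_tensor:
  assumes "rigid s s' F" "rigid t t' G"
  shows "rigid (tree_sum s t) (tree_sum s' t') (F \<boxtimes>\<^bsub>Omega2\<^esub> G)"
proof -
  note F = rigid_hom[OF assms(1)] and G = rigid_hom[OF assms(2)]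
  have "map (map (leaf (F \<boxtimes>\<^bsub>Omega2\<^esub> G) \<circ> inl)) (fibs s) = map (map (inl \<circ> leaf F)) (fibs s)"
    "map (map (leaf (F \<boxtimes>\<^bsub>Omega2\<^esub> G) \<circ> inr)) (fibs t) = map (map (inr \<circ> leaf G)) (fibs t)"
    by (rule map_fibs_cong[OF hom_pruned(1)[OF F]] map_fibs_cong[OF hom_pruned(1)[OF G]],
      simp add: leaf_tensor[OF F G])+
  moreover have "map (map (inl \<circ> leaf F)) (fibs s) = map (map inl) (fibs s')"
    "map (map (inr \<circ> leaf G)) (fibs t) = map (map inr) (fibs t')"
    using assms by (simp_all add: rigid_def flip: map_map map_comp_map)
  ultimately show ?thesis
    using tensor_tree_hom[OF F G] hom_pruned[OF F] hom_pruned[OF G]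
    by (simp add: rigid_def fibs_tree_sum)
qed

lemma map_concat_eqI:
  "\<lbrakk>map f (concat xss) = concat yss; map length xss = map length yss\<rbrakk> \<Longrightarrow> map (map f) xss = yss"
proof (induction xss arbitrary: yss)
  case (Cons xs xss)
  then obtain ys yss' where "yss = ys # yss'" "length xs = length ys" by auto
  then show ?case using Cons by auto
qed auto

text \<open>Leaves are matched by their places in the two concatenated lists of fibres. Equal shapes
  make the matching respect block numbers and positions, and both relations depend only on
  these.\<close>

lemma rigid_exists:
  assumes s: "s \<in> pruned_trees" and t: "t \<in> pruned_trees" and "shape s = shape t"
  shows "\<exists>F. rigid s t F"
proof -
  let ?xs = "concat (fibs s)" and ?ys = "concat (fibs t)"
  define f where "f z = the (map_of (zip ?xs ?ys) z)" for z
  have len: "length ?xs = length ?ys" using assms(3) by (simp add: length_concat)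
  have "map f ?xs = ?ys"
    using wf_blocks_fibs(1)[OF s] len
    by (intro nth_equalityI) (auto simp: f_def wf_blocks_def map_of_zip_nth simp del: map_concat)
  then have eq: "map (map f) (fibs s) = fibs t" by (rule map_concat_eqI[OF _ assms(3)])
  have lens: "length (fibs s) = length (fibs t)" using arg_cong[OF assms(3), of length] by simp
  have lens2: "length (fibs s ! i) = length (fibs t ! i)" if "i < length (fibs s)" for i
    using that lens arg_cong[OF assms(3), of "\<lambda>l. l ! i"] by simp
  have f: "f (fibs s ! i ! j) = fibs t ! i ! j" if "i < length (fibs s)" "j < length (fibs s ! i)" for i j
    using that by (simp flip: eq)
  have "f x \<in> nodes2 t" if "x \<in> nodes2 s" for x
    using that by (rule node_fibs_nth[OF s]) (use lens lens2 f fibs_nth[OF t] in auto)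
  moreover have "(f x, f y) \<in> before t" if xy: "(x, y) \<in> before s" for x y
  proof -
    have "x \<in> nodes2 s" "y \<in> nodes2 s" using xy by (auto simp: before_def)
    then show ?thesis
      using xy lens lens2 fibs_nth_before[OF t] fibs_nth_before[OF s] f
      by (elim node_fibs_nth[OF s]) auto
  qed
  moreover have "(f x, f y) \<in> within t" if xy: "(x, y) \<in> within s" for x y
  proof -
    have "x \<in> nodes2 s" "y \<in> nodes2 s" using xy by (auto simp: within_def FieldI1 FieldI2)
    then show ?thesis
      using xy lens lens2 fibs_nth_within[OF t] fibs_nth_within[OF s] f
      by (elim node_fibs_nth[OF s]) auto
  qed
  ultimately have "leaf_map s t f" by (auto simp: leaf_map_def)
  then have "leaf_arrow s t f \<in> hom Omega2 s t" by (rule leaf_arrow_hom[OF s t])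
  moreover have "map (map (leaf (leaf_arrow s t f))) (fibs s) = fibs t"
    unfolding eq[symmetric] by (rule map_fibs_cong[OF s leaf_leaf_arrow])
  ultimately show ?thesis unfolding rigid_def by blast
qed

lemma rigid_shape: "rigid s t F \<Longrightarrow> shape s = shape t"
proof -
  assume "rigid s t F"
  then have "shape t = map length (map (map (leaf F)) (fibs s))" by (simp only: rigid_def)
  then show ?thesis by (simp add: comp_def)
qed

text \<open>Any rigid arrow in the other direction is inverse: both composites are rigid, hence
  equal to identities by uniqueness.\<close>

lemma rigid_inverse:
  assumes "rigid s t F"
  obtains G where "rigid t s G" "G \<cdot>\<^bsub>Omega2\<^esub> F = Ident Omega2 s" "F \<cdot>\<^bsub>Omega2\<^esub> G = Ident Omega2 t"
proof -
  note st = hom_pruned[OF rigid_hom[OF assms]]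
  obtain G where G: "rigid t s G" using rigid_exists[OF st(2,1)] rigid_shape[OF assms] by auto
  show thesis
    using that[OF G] rigid_unique[OF rigid_comp[OF assms G] rigid_ident[OF st(1)]]
      rigid_unique[OF rigid_comp[OF G assms] rigid_ident[OF st(2)]] by blast
qed

lemma rigid_iso:
  assumes "rigid s t F"
  shows "F \<in> isos Omega2 s t"
  using rigid_inverse[OF assms] rigid_hom assms Omega2.isosI by metis

lemma rigid_inverse_arr:
  assumes "rigid s t F"
  shows "rigid t s (inverse_arr Omega2 F)"
proof (rule rigid_inverse[OF assms])
  fix G assume G: "rigid t s G" "G \<cdot>\<^bsub>Omega2\<^esub> F = Ident Omega2 s"
  then have "inverse_arr Omega2 F = G"
    by (intro Omega2.inverse_arr_unique[OF rigid_iso[OF assms]])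
      (use rigid_hom[OF G(1)] in \<open>auto simp: hom_def\<close>)
  then show ?thesis using G(1) by simp
qed

text \<open>Rebracketing only changes the tags of leaves; in both trees the fibres of s, of t and of
  u follow each other in this order.\<close>

lemma rigid_assoc:
  assumes "s \<in> pruned_trees" "t \<in> pruned_trees" "u \<in> pruned_trees"
  shows "rigid (tree_sum (tree_sum s t) u) (tree_sum s (tree_sum t u)) (Assoc Omega2 s t u)"
proof -
  have "map (map (leaf (Assoc Omega2 s t u))) (fibs (tree_sum (tree_sum s t) u)) =
    map (map (copair (copair inl (inr \<circ> inl)) (inr \<circ> inr))) (fibs (tree_sum (tree_sum s t) u))"
    by (rule map_fibs_cong)
      (use assms in \<open>auto simp: Omega2_tensor_simps leaf_same_map simp del: tree_sum_simps Field_ordered_sum\<close>)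
  then show ?thesis
    using tree_assoc_hom[OF assms] assms by (simp add: rigid_def fibs_tree_sum comp_def)
qed

lemma rigid_unit:
  assumes "t \<in> pruned_trees"
  shows "rigid (tree_sum empty_tree t) t (LUnit Omega2 t)" "rigid (tree_sum t empty_tree) t (RUnit Omega2 t)"
proof -
  have "map (map (leaf (LUnit Omega2 t))) (fibs (tree_sum empty_tree t)) =
    map (map (copair id id)) (fibs (tree_sum empty_tree t))"
    by (rule map_fibs_cong)
      (use assms in \<open>auto simp: Omega2_tensor_simps leaf_same_map simp del: tree_sum_simps Field_ordered_sum\<close>)
  moreover have "map (map (leaf (RUnit Omega2 t))) (fibs (tree_sum t empty_tree)) =
    map (map (copair id id)) (fibs (tree_sum t empty_tree))"
    by (rule map_fibs_cong)
      (use assms in \<open>auto simp: Omega2_tensor_simps leaf_same_map simp del: tree_sum_simps Field_ordered_sum\<close>)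
  ultimately show "rigid (tree_sum empty_tree t) t (LUnit Omega2 t)"
    "rigid (tree_sum t empty_tree) t (RUnit Omega2 t)"
    using tree_lunit_hom[OF assms] tree_runit_hom[OF assms] assms
    by (simp_all add: rigid_def fibs_tree_sum comp_def)
qed

lemma tree_sum_eqI:
  assumes "F \<in> hom Omega2 (tree_sum s t) u" "G \<in> hom Omega2 (tree_sum s t) u"
    "\<And>x. x \<in> nodes2 s \<Longrightarrow> leaf F (inl x) = leaf G (inl x)"
    "\<And>x. x \<in> nodes2 t \<Longrightarrow> leaf F (inr x) = leaf G (inr x)"
  shows "F = G"
  by (rule tree_arrow_eqI[OF assms(1,2)]) (use assms(3,4) in auto)

lemma leaf_structural [simp]:
  "x \<in> nodes2 (tree_sum (tree_sum s t) u) \<Longrightarrow>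
    leaf (Assoc Omega2 s t u) x = copair (copair inl (inr \<circ> inl)) (inr \<circ> inr) x"
  "x \<in> nodes2 (tree_sum empty_tree t) \<Longrightarrow> leaf (LUnit Omega2 t) x = copair id id x"
  "x \<in> nodes2 (tree_sum t empty_tree) \<Longrightarrow> leaf (RUnit Omega2 t) x = copair id id x"
  unfolding Omega2_tensor_simps by (rule leaf_same_map, assumption)+

interpretation Omega2: monoidal_category Omega2
proof
  fix F F' G G' H H' s s' s'' t t' t'' u u' v
  show "Unit Omega2 \<in> Obj Omega2" by simp
  { assume "F \<in> hom Omega2 s s'" "G \<in> hom Omega2 t t'"
    then show "F \<boxtimes>\<^bsub>Omega2\<^esub> G \<in> hom Omega2 (s \<otimes>\<^bsub>Omega2\<^esub> t) (s' \<otimes>\<^bsub>Omega2\<^esub> t')"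
      using tensor_tree_hom by simp }
  { assume F: "F \<in> hom Omega2 s s'" "F' \<in> hom Omega2 s' s''" and G: "G \<in> hom Omega2 t t'" "G' \<in> hom Omega2 t' t''"
    note FG = tensor_tree_hom[OF F(1) G(1)] tensor_tree_hom[OF F(2) G(2)]
    note FF = Omega2.comp_hom[OF F] Omega2.comp_hom[OF G]
    show "(F' \<cdot>\<^bsub>Omega2\<^esub> F) \<boxtimes>\<^bsub>Omega2\<^esub> (G' \<cdot>\<^bsub>Omega2\<^esub> G) = (F' \<boxtimes>\<^bsub>Omega2\<^esub> G') \<cdot>\<^bsub>Omega2\<^esub> (F \<boxtimes>\<^bsub>Omega2\<^esub> G)"
      by (rule tree_sum_eqI[OF tensor_tree_hom[OF FF] Omega2.comp_hom[OF FG]])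
        (simp_all add: leaf_tensor[OF FF] leaf_comp[OF FG(1)] leaf_tensor[OF F(1) G(1)]
          leaf_tensor[OF F(2) G(2)] leaf_hom[OF F(1)] leaf_hom[OF G(1)] leaf_comp[OF F(1)] leaf_comp[OF G(1)]) }
  { assume F: "F \<in> hom Omega2 s s'" and G: "G \<in> hom Omega2 t t'" and H: "H \<in> hom Omega2 u u'"
    note P = hom_pruned[OF F] hom_pruned[OF G] hom_pruned[OF H]
    note T = tensor_tree_hom[OF tensor_tree_hom[OF F G] H] tensor_tree_hom[OF F tensor_tree_hom[OF G H]]
    note A = tree_assoc_hom[OF P(1,3,5)] tree_assoc_hom[OF P(2,4,6)]
    show "Assoc Omega2 s' t' u' \<cdot>\<^bsub>Omega2\<^esub> ((F \<boxtimes>\<^bsub>Omega2\<^esub> G) \<boxtimes>\<^bsub>Omega2\<^esub> H) =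
        (F \<boxtimes>\<^bsub>Omega2\<^esub> (G \<boxtimes>\<^bsub>Omega2\<^esub> H)) \<cdot>\<^bsub>Omega2\<^esub> Assoc Omega2 s t u"
      by (rule tree_arrow_eqI[OF Omega2.comp_hom[OF T(1) A(2)] Omega2.comp_hom[OF A(1) T(2)]])
        (auto simp: leaf_comp[OF T(1)] leaf_comp[OF A(1)] leaf_hom[OF F] leaf_hom[OF G] leaf_hom[OF H]
          leaf_tensor[OF F tensor_tree_hom[OF G H]] leaf_tensor[OF tensor_tree_hom[OF F G] H]
          leaf_tensor[OF G H] leaf_tensor[OF F G]) }
  { assume F: "F \<in> hom Omega2 s s'"
    note P = hom_pruned[OF F] and E = ident_tree_hom[OF empty_tree_pruned]
    note T = tensor_tree_hom[OF E F] tensor_tree_hom[OF F E]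
    note L = tree_lunit_hom[OF P(1)] tree_lunit_hom[OF P(2)] tree_runit_hom[OF P(1)] tree_runit_hom[OF P(2)]
    show "LUnit Omega2 s' \<cdot>\<^bsub>Omega2\<^esub> (Ident Omega2 (Unit Omega2) \<boxtimes>\<^bsub>Omega2\<^esub> F) = F \<cdot>\<^bsub>Omega2\<^esub> LUnit Omega2 s"
      unfolding Omega2_tensor_simps(2)
      by (rule tree_arrow_eqI[OF Omega2.comp_hom[OF T(1) L(2)] Omega2.comp_hom[OF L(1) F]])
        (auto simp: leaf_comp[OF T(1)] leaf_comp[OF L(1)] leaf_hom[OF F] leaf_tensor[OF E F])
    show "RUnit Omega2 s' \<cdot>\<^bsub>Omega2\<^esub> (F \<boxtimes>\<^bsub>Omega2\<^esub> Ident Omega2 (Unit Omega2)) = F \<cdot>\<^bsub>Omega2\<^esub> RUnit Omega2 s"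
      unfolding Omega2_tensor_simps(2)
      by (rule tree_arrow_eqI[OF Omega2.comp_hom[OF T(2) L(4)] Omega2.comp_hom[OF L(3) F]])
        (auto simp: leaf_comp[OF T(2)] leaf_comp[OF L(3)] leaf_hom[OF F] leaf_tensor[OF F E]) }
  { assume s: "s \<in> Obj Omega2"
    then show "LUnit Omega2 s \<in> isos Omega2 (Unit Omega2 \<otimes>\<^bsub>Omega2\<^esub> s) s"
      "RUnit Omega2 s \<in> isos Omega2 (s \<otimes>\<^bsub>Omega2\<^esub> Unit Omega2) s"
      using rigid_iso rigid_unit by simp_all
    assume t: "t \<in> Obj Omega2"
    with s show "s \<otimes>\<^bsub>Omega2\<^esub> t \<in> Obj Omega2" by simp
    show "Ident Omega2 s \<boxtimes>\<^bsub>Omega2\<^esub> Ident Omega2 t = Ident Omega2 (s \<otimes>\<^bsub>Omega2\<^esub> t)"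
      using s t rigid_unique[OF rigid_tensor[OF rigid_ident rigid_ident] rigid_ident] by simp
    show "(Ident Omega2 s \<boxtimes>\<^bsub>Omega2\<^esub> LUnit Omega2 t) \<cdot>\<^bsub>Omega2\<^esub> Assoc Omega2 s (Unit Omega2) t =
        RUnit Omega2 s \<boxtimes>\<^bsub>Omega2\<^esub> Ident Omega2 t"
      unfolding Omega2_tensor_simps(2)
      by (rule rigid_unique) (rule rigid_comp rigid_tensor rigid_ident rigid_unit rigid_assoc | use s t in simp)+
    assume u: "u \<in> Obj Omega2"
    show "Assoc Omega2 s t u \<in> isos Omega2 ((s \<otimes>\<^bsub>Omega2\<^esub> t) \<otimes>\<^bsub>Omega2\<^esub> u) (s \<otimes>\<^bsub>Omega2\<^esub> (t \<otimes>\<^bsub>Omega2\<^esub> u))"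
      using s t u rigid_iso[OF rigid_assoc] by simp
    assume v: "v \<in> Obj Omega2"
    show "Assoc Omega2 s t (u \<otimes>\<^bsub>Omega2\<^esub> v) \<cdot>\<^bsub>Omega2\<^esub> Assoc Omega2 (s \<otimes>\<^bsub>Omega2\<^esub> t) u v =
      (Ident Omega2 s \<boxtimes>\<^bsub>Omega2\<^esub> Assoc Omega2 t u v) \<cdot>\<^bsub>Omega2\<^esub> Assoc Omega2 s (t \<otimes>\<^bsub>Omega2\<^esub> u) v \<cdot>\<^bsub>Omega2\<^esub>
        (Assoc Omega2 s t u \<boxtimes>\<^bsub>Omega2\<^esub> Ident Omega2 v)"
      unfolding Omega2_tensor_simps(1)
      by (rule rigid_unique) (rule rigid_comp rigid_tensor rigid_ident rigid_unit rigid_assoc | use s t u v in simp)+ }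
qed

section \<open>Functors, monoids and transformations\<close>

context category_functor
begin

declare amap_ident [simp] omap_obj [simp]

lemma amap_arr [simp]:
  assumes "f \<in> Arr A"
  shows "amap F f \<in> Arr B" "Dom B (amap F f) = omap F (Dom A f)" "Cod B (amap F f) = omap F (Cod A f)"
  using amap_hom[OF A.arr_hom[OF assms]] by auto

lemma amap_comp_arr [simp]:
  "\<lbrakk>f \<in> Arr A; g \<in> Arr A; Dom A g = Cod A f\<rbrakk> \<Longrightarrow> amap F (g \<cdot>\<^bsub>A\<^esub> f) = amap F g \<cdot>\<^bsub>B\<^esub> amap F f"
  by (rule amap_comp) (auto intro: A.homI)

lemma amap_iso: "f \<in> isos A x y \<Longrightarrow> amap F f \<in> isos B (omap F x) (omap F y)"
proof (rule B.isosI[where g = "amap F (inverse_arr A f)"])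
  assume f: "f \<in> isos A x y"
  show "amap F f \<in> hom B (omap F x) (omap F y)"
    "amap F (inverse_arr A f) \<in> hom B (omap F y) (omap F x)"
    using f by (auto intro: amap_hom A.isos_hom A.inverse_arr_hom)
  show "amap F (inverse_arr A f) \<cdot>\<^bsub>B\<^esub> amap F f = Ident B (omap F x)"
    "amap F f \<cdot>\<^bsub>B\<^esub> amap F (inverse_arr A f) = Ident B (omap F y)"
    using f A.iso_obj[OF f] by (simp_all flip: amap_comp_arr)
qed

end

lemma comp_functor_functor:
  assumes F: "category_functor A B F" and G: "category_functor B D G"
  shows "category_functor A D (comp_functor A G F)"
proof -
  interpret F: category_functor A B F by fact
  interpret G: category_functor B D G by fact
  show ?thesis
  proof
    fix f g x y z
    { assume f: "f \<in> hom A x y"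
      then have fa: "f \<in> Arr A" "x \<in> Obj A" "y \<in> Obj A" by (auto simp: F.A.hom_obj)
      show "amap (comp_functor A G F) f \<in> hom D (omap (comp_functor A G F) x) (omap (comp_functor A G F) y)"
        using G.amap_hom[OF F.amap_hom[OF f]] fa by (simp add: comp_functor_def compose_def)
      assume "g \<in> hom A y z"
      then show "amap (comp_functor A G F) (g \<cdot>\<^bsub>A\<^esub> f) =
          amap (comp_functor A G F) g \<cdot>\<^bsub>D\<^esub> amap (comp_functor A G F) f"
        using f by (simp add: comp_functor_def compose_def) }
  qed (auto simp: comp_functor_def compose_def)
qed

lemma id_functor_functor: "category A \<Longrightarrow> category_functor A A (id_functor A)"
proof -
  assume "category A"
  then interpret A: category A .
  show ?thesis by unfold_locales (auto simp: id_functor_def A.hom_obj intro: A.homI)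
qed

lemma (in natural_transformation) component_arr [simp]:
  "x \<in> Obj A \<Longrightarrow> \<eta> x \<in> Arr B"
  "x \<in> Obj A \<Longrightarrow> Dom B (\<eta> x) = omap F x"
  "x \<in> Obj A \<Longrightarrow> Cod B (\<eta> x) = omap G x"
  using component_hom[of x] by auto

lemma natural_transformation_ident:
  assumes "category_functor A B F"
  shows "natural_transformation A B F F (\<lambda>x \<in> Obj A. Ident B (omap F x))"
proof -
  interpret F: category_functor A B F by fact
  show ?thesis
    by unfold_locales (auto simp: F.A.hom_obj F.B.ident_hom intro: F.B.homI)
qed

lemma natural_transformation_comp:
  assumes "natural_transformation A B F G \<eta>" "natural_transformation A B G H \<theta>"
  shows "natural_transformation A B F H (\<lambda>x \<in> Obj A. \<theta> x \<cdot>\<^bsub>B\<^esub> \<eta> x)"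
proof -
  interpret eta: natural_transformation A B F G \<eta> by fact
  interpret theta: natural_transformation A B G H \<theta> by fact
  show ?thesis
  proof
    fix f x y
    assume f: "f \<in> hom A x y"
    then have xy: "x \<in> Obj A" "y \<in> Obj A" "f \<in> Arr A" by (auto simp: eta.F.A.hom_obj)
    have "(\<theta> y \<cdot>\<^bsub>B\<^esub> \<eta> y) \<cdot>\<^bsub>B\<^esub> amap F f = \<theta> y \<cdot>\<^bsub>B\<^esub> (amap G f \<cdot>\<^bsub>B\<^esub> \<eta> x)"
      using eta.natural[OF f] f xy by simp
    also have "\<dots> = (\<theta> y \<cdot>\<^bsub>B\<^esub> amap G f) \<cdot>\<^bsub>B\<^esub> \<eta> x" using f xy by simp
    also have "\<dots> = amap H f \<cdot>\<^bsub>B\<^esub> (\<theta> x \<cdot>\<^bsub>B\<^esub> \<eta> x)" unfolding theta.natural[OF f] using f xy by simp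
    finally show "(\<lambda>x\<in>Obj A. \<theta> x \<cdot>\<^bsub>B\<^esub> \<eta> x) y \<cdot>\<^bsub>B\<^esub> amap F f = amap H f \<cdot>\<^bsub>B\<^esub> (\<lambda>x\<in>Obj A. \<theta> x \<cdot>\<^bsub>B\<^esub> \<eta> x) x"
      using xy by simp
  qed (auto intro!: eta.F.B.homI)
qed

lemma natural_transformation_inverse:
  assumes "natural_transformation A B F G \<eta>" "\<And>x. x \<in> Obj A \<Longrightarrow> \<eta> x \<in> isos B (omap F x) (omap G x)"
  shows "natural_transformation A B G F (\<lambda>x \<in> Obj A. inverse_arr B (\<eta> x))"
proof -
  interpret eta: natural_transformation A B F G \<eta> by fact
  show ?thesis
  proof
    fix f x y
    assume f: "f \<in> hom A x y"
    then have xy: "x \<in> Obj A" "y \<in> Obj A" by (auto simp: eta.F.A.hom_obj)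
    show "(\<lambda>x\<in>Obj A. inverse_arr B (\<eta> x)) y \<cdot>\<^bsub>B\<^esub> amap G f =
      amap F f \<cdot>\<^bsub>B\<^esub> (\<lambda>x\<in>Obj A. inverse_arr B (\<eta> x)) x"
      using eta.F.B.comp_inverse_eq[OF assms(2)[OF xy(1)] assms(2)[OF xy(2)] eta.G.amap_hom[OF f]
        eta.F.amap_hom[OF f]] eta.natural[OF f] xy by simp
  qed (auto intro!: eta.F.B.inverse_arr_hom assms(2))
qed

lemma functor_category_category:
  assumes "category A" "category B"
  shows "category (functor_category A B)"
proof -
  interpret B: category B by fact
  show ?thesis
    unfolding functor_category_def
  proof (rule hom_cat_category)
    fix F G H K \<eta> \<theta> \<zeta>
    assume "F \<in> {F. category_functor A B F}"
    then show "(\<lambda>x\<in>Obj A. Ident B (omap F x)) \<in> {\<eta>. natural_transformation A B F F \<eta>}"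
      by (simp add: natural_transformation_ident)
    { assume "\<eta> \<in> {\<eta>. natural_transformation A B F G \<eta>}"
      then interpret eta: natural_transformation A B F G \<eta> by simp
      show "(\<lambda>x\<in>Obj A. \<eta> x \<cdot>\<^bsub>B\<^esub> (\<lambda>x\<in>Obj A. Ident B (omap F x)) x) = \<eta>"
        "(\<lambda>x\<in>Obj A. (\<lambda>x\<in>Obj A. Ident B (omap G x)) x \<cdot>\<^bsub>B\<^esub> \<eta> x) = \<eta>"
        by (rule extensionalityI[OF restrict_extensional eta.component_ext]; simp)+
      assume "\<theta> \<in> {\<eta>. natural_transformation A B G H \<eta>}"
      then interpret theta: natural_transformation A B G H \<theta> by simp
      show "(\<lambda>x\<in>Obj A. \<theta> x \<cdot>\<^bsub>B\<^esub> \<eta> x) \<in> {\<eta>. natural_transformation A B F H \<eta>}"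
        using natural_transformation_comp eta.natural_transformation_axioms theta.natural_transformation_axioms
        by blast
      assume "\<zeta> \<in> {\<eta>. natural_transformation A B H K \<eta>}"
      then interpret zeta: natural_transformation A B H K \<zeta> by simp
      show "(\<lambda>x\<in>Obj A. \<zeta> x \<cdot>\<^bsub>B\<^esub> (\<lambda>x\<in>Obj A. \<theta> x \<cdot>\<^bsub>B\<^esub> \<eta> x) x) =
          (\<lambda>x\<in>Obj A. (\<lambda>x\<in>Obj A. \<zeta> x \<cdot>\<^bsub>B\<^esub> \<theta> x) x \<cdot>\<^bsub>B\<^esub> \<eta> x)"
        by (rule extensionalityI[OF restrict_extensional restrict_extensional]) simp }
  qed
qed

lemma hom_functor_category:
  "\<alpha> \<in> hom (functor_category A B) F G \<longleftrightarrow>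
    (\<exists>\<eta>. \<alpha> = Arrow F G \<eta> \<and> natural_transformation A B F G \<eta>)"
  by (auto simp: functor_category_def hom_hom_cat natural_transformation_def)

section \<open>Monoidal functors and the monoids they transport\<close>

context monoidal_functor
begin

lemma Fmult_arr [simp]:
  assumes "x \<in> Obj C" "y \<in> Obj C"
  shows "Fmult F (x, y) \<in> Arr D" "Dom D (Fmult F (x, y)) = omap F x \<otimes> omap F y"
    "Cod D (Fmult F (x, y)) = omap F (x \<otimes>\<^bsub>C\<^esub> y)"
  using Fmult_iso[OF assms] by simp_all

lemma Funit_arr [simp]:
  shows "Funit F \<in> Arr D" "Dom D (Funit F) = Unit D" "Cod D (Funit F) = omap F (Unit C)"
  using Funit_iso by simp_all

lemma Fmult_natural_arr:
  "\<lbrakk>f \<in> Arr C; g \<in> Arr C; Dom C f = x; Dom C g = y\<rbrakk>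
    \<Longrightarrow> amap F (f \<boxtimes>\<^bsub>C\<^esub> g) \<cdot> Fmult F (x, y) = Fmult F (Cod C f, Cod C g) \<cdot> (amap F f \<boxtimes> amap F g)"
  by (rule Fmult_natural[symmetric]) (auto intro: C.homI)

lemma Fmult_natural_arr2:
  assumes "f \<in> Arr C" "g \<in> Arr C" "Dom C f = x" "Dom C g = y" "k \<in> Arr D"
    "Cod D k = omap F x \<otimes> omap F y"
  shows "amap F (f \<boxtimes>\<^bsub>C\<^esub> g) \<cdot> (Fmult F (x, y) \<cdot> k) =
    Fmult F (Cod C f, Cod C g) \<cdot> ((amap F f \<boxtimes> amap F g) \<cdot> k)"
  using assms Fmult_natural_arr[OF assms(1-4)] by (auto simp flip: D.comp_assoc_arr)

lemma Fmult_assoc_arr: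
  assumes "x \<in> Obj C" "y \<in> Obj C" "z \<in> Obj C"
  shows "amap F (Assoc C x y z) \<cdot> (Fmult F (x \<otimes>\<^bsub>C\<^esub> y, z) \<cdot> (Fmult F (x, y) \<boxtimes> Ident D (omap F z))) =
    Fmult F (x, y \<otimes>\<^bsub>C\<^esub> z) \<cdot> ((Ident D (omap F x) \<boxtimes> Fmult F (y, z)) \<cdot>
      Assoc D (omap F x) (omap F y) (omap F z))"
  using Fmult_assoc[OF assms] assms by simp

end

lemma monoid_homs_hom: "f \<in> monoid_homs C M N \<Longrightarrow> f \<in> hom C (carr M) (carr N)"
  by (simp add: monoid_homs_def)

context monoid_in
begin

lemma mult_arr [simp]: "mult M \<in> Arr C" "Dom C (mult M) = carr M \<otimes> carr M" "Cod C (mult M) = carr M"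
  using mult_hom by auto

lemma unit_arr [simp]: "unit M \<in> Arr C" "Dom C (unit M) = Unit C" "Cod C (unit M) = carr M"
  using unit_hom by auto

declare carr_obj [simp]

end

lemma Mon_simps [simp]:
  "Obj (Mon C) = {M. monoid_in C M}"
  "Dom (Mon C) = source"
  "Cod (Mon C) = target"
  "Ident (Mon C) M = Arrow M M (Ident C (carr M))"
  "Comp (Mon C) g f = Arrow (source f) (target g) (underlying g \<cdot>\<^bsub>C\<^esub> underlying f)"
  "f \<in> Arr (Mon C) \<longleftrightarrow> monoid_in C (source f) \<and> monoid_in C (target f) \<and>
    underlying f \<in> monoid_homs C (source f) (target f)"
  by (simp_all add: Mon_def)

lemma hom_Mon:
  "f \<in> hom (Mon C) M N \<longleftrightarrow>
    monoid_in C M \<and> monoid_in C N \<and> (\<exists>m \<in> monoid_homs C M N. f = Arrow M N m)"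
  by (auto simp: Mon_def hom_hom_cat)

lemma Mon_category:
  assumes "monoidal_category C"
  shows "category (Mon C)"
  unfolding Mon_def
proof (rule hom_cat_category)
  interpret C: monoidal_category C by fact
  fix M N K L f g h
  assume "M \<in> {M. monoid_in C M}"
  then interpret M: monoid_in C M by simp
  show "Ident C (carr M) \<in> monoid_homs C M M"
    by (auto simp: monoid_homs_def intro!: C.homI)
  assume "N \<in> {M. monoid_in C M}"
  then interpret N: monoid_in C N by simp
  { assume "f \<in> monoid_homs C M N"
    then have f: "f \<in> hom C (carr M) (carr N)" "f \<cdot>\<^bsub>C\<^esub> mult M = mult N \<cdot>\<^bsub>C\<^esub> (f \<boxtimes>\<^bsub>C\<^esub> f)"
      "f \<cdot>\<^bsub>C\<^esub> unit M = unit N" by (auto simp: monoid_homs_def)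
    show "f \<cdot>\<^bsub>C\<^esub> Ident C (carr M) = f" "Ident C (carr N) \<cdot>\<^bsub>C\<^esub> f = f" using f(1) by simp_all
    assume "K \<in> {M. monoid_in C M}"
    then interpret K: monoid_in C K by simp
    assume "g \<in> monoid_homs C N K"
    then have g: "g \<in> hom C (carr N) (carr K)" "g \<cdot>\<^bsub>C\<^esub> mult N = mult K \<cdot>\<^bsub>C\<^esub> (g \<boxtimes>\<^bsub>C\<^esub> g)"
      "g \<cdot>\<^bsub>C\<^esub> unit N = unit K" by (auto simp: monoid_homs_def)
    have "g \<cdot>\<^bsub>C\<^esub> (f \<cdot>\<^bsub>C\<^esub> mult M) = (g \<cdot>\<^bsub>C\<^esub> mult N) \<cdot>\<^bsub>C\<^esub> (f \<boxtimes>\<^bsub>C\<^esub> f)"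
      unfolding f(2) using f(1) g(1) by simp
    also have "\<dots> = mult K \<cdot>\<^bsub>C\<^esub> ((g \<cdot>\<^bsub>C\<^esub> f) \<boxtimes>\<^bsub>C\<^esub> (g \<cdot>\<^bsub>C\<^esub> f))"
      unfolding g(2) using f(1) g(1) by simp
    finally have "(g \<cdot>\<^bsub>C\<^esub> f) \<cdot>\<^bsub>C\<^esub> mult M = mult K \<cdot>\<^bsub>C\<^esub> ((g \<cdot>\<^bsub>C\<^esub> f) \<boxtimes>\<^bsub>C\<^esub> (g \<cdot>\<^bsub>C\<^esub> f))"
      using f(1) g(1) by simp
    moreover have "(g \<cdot>\<^bsub>C\<^esub> f) \<cdot>\<^bsub>C\<^esub> unit M = g \<cdot>\<^bsub>C\<^esub> (f \<cdot>\<^bsub>C\<^esub> unit M)"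
      using f(1) g(1) by simp
    ultimately show "g \<cdot>\<^bsub>C\<^esub> f \<in> monoid_homs C M K"
      unfolding f(3) g(3) using C.comp_hom[OF f(1) g(1)] by (simp only: monoid_homs_def mem_Collect_eq)
  }
  assume "K \<in> {M. monoid_in C M}" "L \<in> {M. monoid_in C M}"
    "f \<in> monoid_homs C M N" "g \<in> monoid_homs C N K" "h \<in> monoid_homs C K L"
  then show "h \<cdot>\<^bsub>C\<^esub> (g \<cdot>\<^bsub>C\<^esub> f) = (h \<cdot>\<^bsub>C\<^esub> g) \<cdot>\<^bsub>C\<^esub> f"
    using C.comp_assoc monoid_homs_hom by metis
qed

text \<open>The object part of \<open>Mon_functor\<close> before its restriction to monoids, so that
  carrier, multiplication and unit simplify without a side condition.\<close>

definition image_monoid ::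
  "('p, 'b) moncat \<Rightarrow> ('o, 'a, 'p, 'b) monfctr \<Rightarrow> ('o, 'a) mon \<Rightarrow> ('p, 'b) mon" where
  "image_monoid D F M = \<lparr>carr = omap F (carr M),
     mult = amap F (mult M) \<cdot>\<^bsub>D\<^esub> Fmult F (carr M, carr M),
     unit = amap F (unit M) \<cdot>\<^bsub>D\<^esub> Funit F\<rparr>"

lemma image_monoid_simps [simp]:
  "carr (image_monoid D F M) = omap F (carr M)"
  "mult (image_monoid D F M) = amap F (mult M) \<cdot>\<^bsub>D\<^esub> Fmult F (carr M, carr M)"
  "unit (image_monoid D F M) = amap F (unit M) \<cdot>\<^bsub>D\<^esub> Funit F"
  by (simp_all add: image_monoid_def)

lemma Mon_functor_simps:
  "monoid_in C M \<Longrightarrow> omap (Mon_functor C D F) M = image_monoid D F M"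
  "f \<in> Arr (Mon C) \<Longrightarrow> amap (Mon_functor C D F) f =
    Arrow (image_monoid D F (source f)) (image_monoid D F (target f)) (amap F (underlying f))"
  "omap (Mon_functor C D F) \<in> extensional (Obj (Mon C))"
  "amap (Mon_functor C D F) \<in> extensional (Arr (Mon C))"
  by (simp_all add: Mon_functor_def Let_def image_monoid_def)

context monoidal_functor
begin

text \<open>Naturality of \<open>Fmult\<close> brings the two multiplications together under F,
  where associativity of M applies; the coherence of \<open>Fmult\<close> then trades the image of
  the associator of C for the associator of D. The unit laws pass through \<open>Fmult_lunit\<close>
  and \<open>Fmult_runit\<close> in the same way.\<close>

lemma image_monoid:
  assumes "monoid_in C M"
  shows "monoid_in D (image_monoid D F M)"
proof -
  interpret M: monoid_in C M by fact
  let ?c = "carr M" and ?m = "mult M" and ?u = "unit M"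
  let ?one = "Ident D (omap F ?c)"
  show ?thesis
  proof (unfold_locales, unfold image_monoid_simps)
    show "omap F ?c \<in> Obj D" by simp
    show "amap F ?m \<cdot> Fmult F (?c, ?c) \<in> hom D (omap F ?c \<otimes> omap F ?c) (omap F ?c)"
      "amap F ?u \<cdot> Funit F \<in> hom D (Unit D) (omap F ?c)"
      by (auto intro!: D.homI)
    have "amap F ?m \<cdot> Fmult F (?c, ?c) \<cdot> ((amap F ?m \<cdot> Fmult F (?c, ?c)) \<boxtimes> ?one) =
        amap F ?m \<cdot> ((Fmult F (?c, ?c) \<cdot> (amap F ?m \<boxtimes> amap F (Ident C ?c))) \<cdot> (Fmult F (?c, ?c) \<boxtimes> ?one))"
      by simp
    also have "\<dots> = amap F (?m \<cdot>\<^bsub>C\<^esub> (?m \<boxtimes>\<^bsub>C\<^esub> Ident C ?c)) \<cdot> (Fmult F (?c \<otimes>\<^bsub>C\<^esub> ?c, ?c) \<cdot> (Fmult F (?c, ?c) \<boxtimes> ?one))"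
      by (subst Fmult_natural[of _ "?c \<otimes>\<^bsub>C\<^esub> ?c" ?c _ ?c ?c]) (auto intro: C.homI)
    also have "\<dots> = amap F (?m \<cdot>\<^bsub>C\<^esub> (Ident C ?c \<boxtimes>\<^bsub>C\<^esub> ?m)) \<cdot> (amap F (Assoc C ?c ?c ?c) \<cdot>
        (Fmult F (?c \<otimes>\<^bsub>C\<^esub> ?c, ?c) \<cdot> (Fmult F (?c, ?c) \<boxtimes> ?one)))"
      unfolding M.mult_assoc by simp
    also have "\<dots> = amap F ?m \<cdot> (amap F (Ident C ?c \<boxtimes>\<^bsub>C\<^esub> ?m) \<cdot> (Fmult F (?c, ?c \<otimes>\<^bsub>C\<^esub> ?c) \<cdot>
        ((?one \<boxtimes> Fmult F (?c, ?c)) \<cdot> Assoc D (omap F ?c) (omap F ?c) (omap F ?c))))"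
      by (subst Fmult_assoc_arr) auto
    also have "\<dots> = amap F ?m \<cdot> Fmult F (?c, ?c) \<cdot> (?one \<boxtimes> (amap F ?m \<cdot> Fmult F (?c, ?c))) \<cdot>
        Assoc D (omap F ?c) (omap F ?c) (omap F ?c)"
      by (subst Fmult_natural_arr2) auto
    finally show "amap F ?m \<cdot> Fmult F (?c, ?c) \<cdot> ((amap F ?m \<cdot> Fmult F (?c, ?c)) \<boxtimes> ?one) =
      amap F ?m \<cdot> Fmult F (?c, ?c) \<cdot> (?one \<boxtimes> (amap F ?m \<cdot> Fmult F (?c, ?c))) \<cdot>
        Assoc D (omap F ?c) (omap F ?c) (omap F ?c)" .
    have "amap F ?m \<cdot> Fmult F (?c, ?c) \<cdot> ((amap F ?u \<cdot> Funit F) \<boxtimes> ?one) =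
        amap F ?m \<cdot> ((Fmult F (?c, ?c) \<cdot> (amap F ?u \<boxtimes> amap F (Ident C ?c))) \<cdot> (Funit F \<boxtimes> ?one))"
      by simp
    also have "\<dots> = amap F (?m \<cdot>\<^bsub>C\<^esub> (?u \<boxtimes>\<^bsub>C\<^esub> Ident C ?c)) \<cdot> (Fmult F (Unit C, ?c) \<cdot> (Funit F \<boxtimes> ?one))"
      by (subst Fmult_natural[of _ "Unit C" ?c _ ?c ?c]) (auto intro: C.homI)
    finally show "amap F ?m \<cdot> Fmult F (?c, ?c) \<cdot> ((amap F ?u \<cdot> Funit F) \<boxtimes> ?one) = LUnit D (omap F ?c)"
      unfolding M.mult_lunit using Fmult_lunit[of ?c] by simp
    have "amap F ?m \<cdot> Fmult F (?c, ?c) \<cdot> (?one \<boxtimes> (amap F ?u \<cdot> Funit F)) =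
        amap F ?m \<cdot> ((Fmult F (?c, ?c) \<cdot> (amap F (Ident C ?c) \<boxtimes> amap F ?u)) \<cdot> (?one \<boxtimes> Funit F))"
      by simp
    also have "\<dots> = amap F (?m \<cdot>\<^bsub>C\<^esub> (Ident C ?c \<boxtimes>\<^bsub>C\<^esub> ?u)) \<cdot> (Fmult F (?c, Unit C) \<cdot> (?one \<boxtimes> Funit F))"
      by (subst Fmult_natural[of _ ?c ?c _ "Unit C" ?c]) (auto intro: C.homI)
    finally show "amap F ?m \<cdot> Fmult F (?c, ?c) \<cdot> (?one \<boxtimes> (amap F ?u \<cdot> Funit F)) = RUnit D (omap F ?c)"
      unfolding M.mult_runit using Fmult_runit[of ?c] by simp
  qed
qed

lemma image_monoid_hom:
  assumes "monoid_in C M" "monoid_in C N" "f \<in> monoid_homs C M N"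
  shows "amap F f \<in> monoid_homs D (image_monoid D F M) (image_monoid D F N)"
proof -
  interpret M: monoid_in C M by fact
  interpret N: monoid_in C N by fact
  have f: "f \<in> hom C (carr M) (carr N)" "f \<cdot>\<^bsub>C\<^esub> mult M = mult N \<cdot>\<^bsub>C\<^esub> (f \<boxtimes>\<^bsub>C\<^esub> f)"
    "f \<cdot>\<^bsub>C\<^esub> unit M = unit N" using assms(3) by (auto simp: monoid_homs_def)
  have "amap F f \<cdot> (amap F (mult M) \<cdot> Fmult F (carr M, carr M)) =
      amap F (f \<cdot>\<^bsub>C\<^esub> mult M) \<cdot> Fmult F (carr M, carr M)"
    using f(1) by simp
  also have "\<dots> = amap F (mult N) \<cdot> (amap F (f \<boxtimes>\<^bsub>C\<^esub> f) \<cdot> Fmult F (carr M, carr M))"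
    unfolding f(2) using f(1) by simp
  also have "\<dots> = amap F (mult N) \<cdot> Fmult F (carr N, carr N) \<cdot> (amap F f \<boxtimes> amap F f)"
    by (subst Fmult_natural_arr) (use f(1) in auto)
  finally have "amap F f \<cdot> (amap F (mult M) \<cdot> Fmult F (carr M, carr M)) =
    amap F (mult N) \<cdot> Fmult F (carr N, carr N) \<cdot> (amap F f \<boxtimes> amap F f)" .
  moreover have "amap F f \<cdot> (amap F (unit M) \<cdot> Funit F) = amap F (unit N) \<cdot> Funit F"
    unfolding f(3)[symmetric] using f(1) by simp
  ultimately show ?thesis using amap_hom[OF f(1)] by (simp add: monoid_homs_def)
qed

lemma Mon_functor_functor: "category_functor (Mon C) (Mon D) (Mon_functor C D F)"
proof -
  interpret MC: category "Mon C" by (rule Mon_category) unfold_locales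
  interpret MD: category "Mon D" by (rule Mon_category) unfold_locales
  show ?thesis
  proof
    fix M N K f g
    { assume f: "f \<in> hom (Mon C) M N"
      then obtain m where m: "f = Arrow M N m" "m \<in> monoid_homs C M N" "monoid_in C M" "monoid_in C N"
        by (auto simp: hom_Mon)
      then show "amap (Mon_functor C D F) f \<in> hom (Mon D) (omap (Mon_functor C D F) M) (omap (Mon_functor C D F) N)"
        using image_monoid_hom[of M N m] image_monoid[of M] image_monoid[of N]
        by (simp add: Mon_functor_simps hom_Mon)
      assume g: "g \<in> hom (Mon C) N K"
      then obtain n where n: "g = Arrow N K n" "n \<in> monoid_homs C N K" "monoid_in C K"
        by (auto simp: hom_Mon)
      have "g \<cdot>\<^bsub>Mon C\<^esub> f \<in> Arr (Mon C)" using MC.comp_hom[OF f g] by (rule MC.hom_arr)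
      then show "amap (Mon_functor C D F) (g \<cdot>\<^bsub>Mon C\<^esub> f) =
          amap (Mon_functor C D F) g \<cdot>\<^bsub>Mon D\<^esub> amap (Mon_functor C D F) f"
        using m n amap_comp[OF monoid_homs_hom[OF m(2)] monoid_homs_hom[OF n(2)]]
        by (simp add: Mon_functor_simps) }
    { assume M: "M \<in> Obj (Mon C)"
      then interpret M: monoid_in C M by simp
      show "omap (Mon_functor C D F) M \<in> Obj (Mon D)"
        using M image_monoid[of M] by (simp add: Mon_functor_simps)
      have "Ident (Mon C) M \<in> Arr (Mon C)" using MC.ident_hom[OF M] by (rule MC.hom_arr)
      then show "amap (Mon_functor C D F) (Ident (Mon C) M) = Ident (Mon D) (omap (Mon_functor C D F) M)"
        using M by (simp add: Mon_functor_simps) }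
  qed (rule Mon_functor_simps)+
qed

end

section \<open>Monoidal transformations and the category of monoidal functors\<close>

lemma monoidal_transformation_ident:
  assumes "monoidal_functor C D F"
  shows "monoidal_transformation C D F F (\<lambda>x \<in> Obj C. Ident D (omap F x))"
proof -
  interpret F: monoidal_functor C D F by fact
  interpret natural_transformation C D F F "\<lambda>x \<in> Obj C. Ident D (omap F x)"
    by (rule natural_transformation_ident) unfold_locales
  show ?thesis by unfold_locales auto
qed

lemma (in monoidal_transformation) component_mult_arr:
  "\<lbrakk>x \<in> Obj C; y \<in> Obj C; k \<in> Arr D; Cod D k = omap F x \<otimes> omap F y\<rbrakk>
      \<Longrightarrow> \<eta> (x \<otimes>\<^bsub>C\<^esub> y) \<cdot> (Fmult F (x, y) \<cdot> k) = Fmult G (x, y) \<cdot> ((\<eta> x \<boxtimes> \<eta> y) \<cdot> k)"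
  using component_mult[of x y] by (auto simp flip: F.D.comp_assoc_arr)

lemma monoidal_transformation_comp:
  assumes "monoidal_transformation C D F G \<eta>" "monoidal_transformation C D G H \<theta>"
  shows "monoidal_transformation C D F H (\<lambda>x \<in> Obj C. \<theta> x \<cdot>\<^bsub>D\<^esub> \<eta> x)"
proof -
  interpret eta: monoidal_transformation C D F G \<eta> by fact
  interpret theta: monoidal_transformation C D G H \<theta> by fact
  interpret natural_transformation C D F H "\<lambda>x \<in> Obj C. \<theta> x \<cdot>\<^bsub>D\<^esub> \<eta> x"
    by (rule natural_transformation_comp) unfold_locales
  show ?thesis
    by unfold_locales
      (simp_all add: eta.component_mult theta.component_mult_arr eta.component_unit theta.component_unit)
qed

lemma monoidal_transformation_inverse:
  assumes "monoidal_transformation C D F G \<eta>" "\<And>x. x \<in> Obj C \<Longrightarrow> \<eta> x \<in> isos D (omap F x) (omap G x)"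
  shows "monoidal_transformation C D G F (\<lambda>x \<in> Obj C. inverse_arr D (\<eta> x))"
proof -
  interpret eta: monoidal_transformation C D F G \<eta> by fact
  interpret natural_transformation C D G F "\<lambda>x \<in> Obj C. inverse_arr D (\<eta> x)"
    by (rule natural_transformation_inverse[OF _ assms(2)]) unfold_locales
  show ?thesis
  proof
    fix x y
    assume xy [simp]: "x \<in> Obj C" "y \<in> Obj C"
    \<comment> \<open>The inverse components are inserted together with the components themselves,
      so that the compatibility of \<eta> with the structure maps becomes applicable.\<close>
    have "inverse_arr D (\<eta> (x \<otimes>\<^bsub>C\<^esub> y)) \<cdot>\<^bsub>D\<^esub> Fmult G (x, y) =
        inverse_arr D (\<eta> (x \<otimes>\<^bsub>C\<^esub> y)) \<cdot>\<^bsub>D\<^esub> ((Fmult G (x, y) \<cdot>\<^bsub>D\<^esub> (\<eta> x \<boxtimes>\<^bsub>D\<^esub> \<eta> y)) \<cdot>\<^bsub>D\<^esub> (inverse_arr D (\<eta> x) \<boxtimes>\<^bsub>D\<^esub> inverse_arr D (\<eta> y)))"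
      using assms(2)[OF xy(1)] assms(2)[OF xy(2)] assms(2)[of "x \<otimes>\<^bsub>C\<^esub> y"] by simp
    also have "\<dots> = inverse_arr D (\<eta> (x \<otimes>\<^bsub>C\<^esub> y)) \<cdot>\<^bsub>D\<^esub> (\<eta> (x \<otimes>\<^bsub>C\<^esub> y) \<cdot>\<^bsub>D\<^esub> (Fmult F (x, y) \<cdot>\<^bsub>D\<^esub> (inverse_arr D (\<eta> x) \<boxtimes>\<^bsub>D\<^esub> inverse_arr D (\<eta> y))))"
      using assms(2)[OF xy(1)] assms(2)[OF xy(2)] by (subst eta.component_mult[symmetric]) auto
    also have "\<dots> = Fmult F (x, y) \<cdot>\<^bsub>D\<^esub> (inverse_arr D (\<eta> x) \<boxtimes>\<^bsub>D\<^esub> inverse_arr D (\<eta> y))"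
      using assms(2)[OF xy(1)] assms(2)[OF xy(2)] by (intro eta.F.D.iso_cancel(1)[OF assms(2)]) auto
    finally show "(\<lambda>x\<in>Obj C. inverse_arr D (\<eta> x)) (x \<otimes>\<^bsub>C\<^esub> y) \<cdot>\<^bsub>D\<^esub> Fmult G (x, y) =
        Fmult F (x, y) \<cdot>\<^bsub>D\<^esub> ((\<lambda>x\<in>Obj C. inverse_arr D (\<eta> x)) x \<boxtimes>\<^bsub>D\<^esub> (\<lambda>x\<in>Obj C. inverse_arr D (\<eta> x)) y)"
      by simp
  next
    have "inverse_arr D (\<eta> (Unit C)) \<cdot>\<^bsub>D\<^esub> Funit G = inverse_arr D (\<eta> (Unit C)) \<cdot>\<^bsub>D\<^esub> (\<eta> (Unit C) \<cdot>\<^bsub>D\<^esub> Funit F)"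
      by (simp only: eta.component_unit)
    also have "\<dots> = Funit F" by (rule eta.F.D.iso_cancel(1)[OF assms(2)]) auto
    finally show "(\<lambda>x\<in>Obj C. inverse_arr D (\<eta> x)) (Unit C) \<cdot>\<^bsub>D\<^esub> Funit G = Funit F" by simp
  qed
qed

lemma hom_monoidal_functor_category:
  "\<alpha> \<in> hom (monoidal_functor_category C D) F G \<longleftrightarrow>
    (\<exists>\<eta>. \<alpha> = Arrow F G \<eta> \<and> monoidal_transformation C D F G \<eta>)"
  by (auto simp: monoidal_functor_category_def hom_hom_cat monoidal_transformation_def)

lemma monoidal_functor_category_category: "category (monoidal_functor_category C D)"
  unfolding monoidal_functor_category_def
proof (rule hom_cat_category)
  fix F G H K \<eta> \<theta> \<zeta>
  assume "F \<in> {F. monoidal_functor C D F}"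
  then show "(\<lambda>x\<in>Obj C. Ident D (omap F x)) \<in> {\<eta>. monoidal_transformation C D F F \<eta>}"
    by (simp add: monoidal_transformation_ident)
  { assume "\<eta> \<in> {\<eta>. monoidal_transformation C D F G \<eta>}"
    then interpret eta: monoidal_transformation C D F G \<eta> by simp
    show "(\<lambda>x\<in>Obj C. \<eta> x \<cdot>\<^bsub>D\<^esub> (\<lambda>x\<in>Obj C. Ident D (omap F x)) x) = \<eta>"
      "(\<lambda>x\<in>Obj C. (\<lambda>x\<in>Obj C. Ident D (omap G x)) x \<cdot>\<^bsub>D\<^esub> \<eta> x) = \<eta>"
      by (rule extensionalityI[OF restrict_extensional eta.component_ext]; simp)+
    assume "\<theta> \<in> {\<eta>. monoidal_transformation C D G H \<eta>}"
    then interpret theta: monoidal_transformation C D G H \<theta> by simp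
    show "(\<lambda>x\<in>Obj C. \<theta> x \<cdot>\<^bsub>D\<^esub> \<eta> x) \<in> {\<eta>. monoidal_transformation C D F H \<eta>}"
      using monoidal_transformation_comp eta.monoidal_transformation_axioms theta.monoidal_transformation_axioms
      by blast
    assume "\<zeta> \<in> {\<eta>. monoidal_transformation C D H K \<eta>}"
    then interpret zeta: monoidal_transformation C D H K \<zeta> by simp
    show "(\<lambda>x\<in>Obj C. \<zeta> x \<cdot>\<^bsub>D\<^esub> (\<lambda>x\<in>Obj C. \<theta> x \<cdot>\<^bsub>D\<^esub> \<eta> x) x) =
        (\<lambda>x\<in>Obj C. (\<lambda>x\<in>Obj C. \<zeta> x \<cdot>\<^bsub>D\<^esub> \<theta> x) x \<cdot>\<^bsub>D\<^esub> \<eta> x)"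
      by (rule extensionalityI[OF restrict_extensional restrict_extensional]) simp }
qed

lemma Delta_category: "category Delta"
  unfolding Delta_def
proof (rule hom_cat_category)
  fix l m n k :: nat and f g h
  show "(\<lambda>i\<in>{1..n}. i) \<in> {f \<in> {1..n} \<rightarrow>\<^sub>E {1..n}. mono_on {1..n} f}"
    by (auto simp: mono_on_def)
  { assume f: "f \<in> {f \<in> {1..m} \<rightarrow>\<^sub>E {1..n}. mono_on {1..m} f}"
    then show "compose {1..m} f (\<lambda>i\<in>{1..m}. i) = f" "compose {1..m} (\<lambda>i\<in>{1..n}. i) f = f"
      by (intro PiE_ext[of _ "{1..m}" "\<lambda>_. {1..n}"]; auto simp: compose_def)+
    assume "g \<in> {f \<in> {1..n} \<rightarrow>\<^sub>E {1..k}. mono_on {1..n} f}"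
    moreover have "f i \<in> {1..n}" if "i \<in> {1..m}" for i using f that by blast
    ultimately show "compose {1..m} g f \<in> {f \<in> {1..m} \<rightarrow>\<^sub>E {1..k}. mono_on {1..m} f}"
      using f by (auto simp: compose_def mono_on_def)
  }
  assume "f \<in> {f \<in> {1..l} \<rightarrow>\<^sub>E {1..m}. mono_on {1..l} f}"
  then show "compose {1..l} h (compose {1..l} g f) = compose {1..l} (compose {1..m} h g) f"
    by (auto simp: compose_def fun_eq_iff)
qed

declare Omega2_hom_cat_simps(2,3,6) [simp del]

section \<open>The cosimplicial monoid of pruned trees\<close>

lemma Delta_simps [simp]:
  "Obj Delta = {n. n \<ge> 1}"
  "Dom Delta = source"
  "Cod Delta = target"
  "Ident Delta n = Arrow n n (\<lambda>i \<in> {1..n}. i)"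
  "Comp Delta g f = Arrow (source f) (target g) (compose {1..source f} (underlying g) (underlying f))"
  by (simp_all add: Delta_def)

lemma Delta_arr: "d \<in> Arr Delta \<longleftrightarrow> source d \<ge> 1 \<and> target d \<ge> 1 \<and>
    underlying d \<in> {1..source d} \<rightarrow>\<^sub>E {1..target d} \<and> mono_on {1..source d} (underlying d)"
  by (simp add: Delta_def)

lemma Delta_homD:
  assumes "d \<in> hom Delta m n"
  shows "d \<in> Arr Delta" "source d = m" "target d = n" "m \<ge> 1" "n \<ge> 1"
  using assms by (auto simp: hom_def Delta_arr)

interpretation Delta: category Delta
  by (rule Delta_category)

interpretation MonOmega2: category "Mon Omega2"
  by (rule Mon_category) unfold_locales

lemma Field_ordinal [simp]: "Field (ordinal n) = {1..n}"
  by (auto simp: ordinal_def Field_def Domain_iff Range_iff)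

lemma ordinal_iff: "(i, j) \<in> ordinal n \<longleftrightarrow> 1 \<le> i \<and> i \<le> j \<and> j \<le> n"
  by (simp add: ordinal_def)

lemma Linear_order_ordinal: "Linear_order (ordinal n)"
  by (rule linear_orderI) (auto simp: ordinal_iff)

lemma fin_ordered_ordinal: "fin_ordered (ordinal n)"
  using Linear_order_ordinal[of n] by (simp add: fin_ordered_def)

abbreviation corolla :: "nat \<Rightarrow> tree" where
  "corolla n \<equiv> S_tree (ordinal n)"

lemma corolla_simps [simp]:
  "lev2 (corolla n) = ordinal n" "lev1 (corolla n) = ordinal 1"
  "x \<in> {1..n} \<Longrightarrow> proj (corolla n) x = 1"
  by (simp_all add: S_tree_def)

lemma corolla_pruned [simp]:
  assumes "n \<ge> 1"
  shows "corolla n \<in> pruned_trees"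
proof -
  have "(\<lambda>x\<in>{1..n}. 1) ` {1..n} = {1::nat}" using assms by auto
  then show ?thesis
    unfolding pruned_trees_def S_tree_def
    using fin_ordered_ordinal[of n] fin_ordered_ordinal[of 1] by simp
qed

lemma before_corolla [simp]: "(x, y) \<in> before (corolla n) \<longleftrightarrow> x \<in> {1..n} \<and> y \<in> {1..n}"
  by (auto simp: before_def ordinal_iff S_tree_def)

lemma within_corolla [simp]: "(x, y) \<in> within (corolla n) \<longleftrightarrow> 1 \<le> x \<and> x \<le> y \<and> y \<le> n"
  by (auto simp: within_def ordinal_iff S_tree_def)

lemma fibs_corolla [simp]:
  assumes "n \<ge> 1"
  shows "fibs (corolla n) = [[1..<Suc n]]"
proof -
  have sorted: "sorted_wrt (\<lambda>x y. (x, y) \<in> ordinal n) [1..<Suc n]"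
    by (simp add: sorted_wrt_iff_nth_less ordinal_iff del: upt_Suc)
  have "base_list (corolla n) = [1]"
    unfolding base_list_def corolla_simps(2)
    by (rule enum_list_eqI[OF Linear_order_ordinal]) simp_all
  moreover have "fibre (corolla n) 1 = [1..<Suc n]"
    unfolding fibre_def corolla_simps(1)
  proof (rule enum_list_eqI[OF Linear_order_ordinal _ _ sorted])
    show "set [1..<Suc n] = {z \<in> Field (ordinal n). proj (corolla n) z = 1}"
      unfolding set_upt atLeastLessThanSuc_atLeastAtMost Field_ordinal by (auto simp: corolla_simps(3))
  qed simp
  ultimately show ?thesis by (simp add: fibs_def del: upt_Suc)
qed

abbreviation Smon :: "nat \<Rightarrow> (tree, tree_arrow) mon" where
  "Smon n \<equiv> S_monoid (ordinal n)"

lemma carr_Smon [simp]: "carr (Smon n) = corolla n"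
  by (simp add: S_monoid_def Let_def)

text \<open>The codiagonal does not preserve the order of the sum, in which the second copy follows
  the first. It is an arrow all the same: the two copies are different fibres, and in a corolla any
  two leaves are before each other.\<close>

lemma mult_Smon:
  assumes "n \<ge> 1"
  shows "mult (Smon n) \<in> hom Omega2 (tree_sum (corolla n) (corolla n)) (corolla n)"
    "x \<in> {1..n} \<Longrightarrow> leaf (mult (Smon n)) (inl x) = x"
    "x \<in> {1..n} \<Longrightarrow> leaf (mult (Smon n)) (inr x) = x"
proof -
  show "mult (Smon n) \<in> hom Omega2 (tree_sum (corolla n) (corolla n)) (corolla n)"
    unfolding S_monoid_def Let_def mon.simps
    by (rule tree_arrow_hom) (use assms in \<open>auto simp: leaf_map_tree_sum\<close>, auto simp: leaf_map_def)
qed (auto simp: S_monoid_def Let_def)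

lemma unit_Smon: "n \<ge> 1 \<Longrightarrow> unit (Smon n) \<in> hom Omega2 empty_tree (corolla n)"
  unfolding S_monoid_def Let_def mon.simps by (rule tree_arrow_hom) auto

definition Smap :: "(nat, nat \<Rightarrow> nat) arrow \<Rightarrow> tree_arrow" where
  "Smap d = Arrow (corolla (source d)) (corolla (target d))
     (restrict_levels (corolla (source d)) (underlying d, id))"

lemma Smap:
  assumes "d \<in> Arr Delta"
  shows "Smap d \<in> hom Omega2 (corolla (source d)) (corolla (target d))"
    "x \<in> {1..source d} \<Longrightarrow> leaf (Smap d) x = underlying d x"
proof -
  have d: "underlying d x \<in> {1..target d}" if "x \<in> {1..source d}" for x
    using assms that by (auto simp: Delta_arr)
  have "leaf_map (corolla (source d)) (corolla (target d)) (underlying d)"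
    using assms d by (auto simp: leaf_map_def Delta_arr mono_on_def)
  then show "Smap d \<in> hom Omega2 (corolla (source d)) (corolla (target d))"
    unfolding Smap_def by (intro tree_arrow_hom) (use assms d in \<open>auto simp: Delta_arr\<close>)
qed (auto simp: Smap_def)

lemma monoid_Smon:
  assumes n: "n \<ge> 1"
  shows "monoid_in Omega2 (Smon n)"
proof (unfold_locales, unfold carr_Smon Omega2_tensor_simps(1,2))
  note m = mult_Smon[OF n] and u = unit_Smon[OF n] and i = ident_tree_hom[OF corolla_pruned[OF n]]
  note mi = tensor_tree_hom[OF m(1) i] and im = tensor_tree_hom[OF i m(1)]
  note ui = tensor_tree_hom[OF u i] and iu = tensor_tree_hom[OF i u]
  note P = corolla_pruned[OF n]
  note a = tree_assoc_hom[OF P P P]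
  show "corolla n \<in> Obj Omega2" using n by simp
  show "mult (Smon n) \<in> hom Omega2 (tree_sum (corolla n) (corolla n)) (corolla n)"
    "unit (Smon n) \<in> hom Omega2 empty_tree (corolla n)" by fact+
  show "mult (Smon n) \<cdot>\<^bsub>Omega2\<^esub> (mult (Smon n) \<boxtimes>\<^bsub>Omega2\<^esub> Ident Omega2 (corolla n)) =
    mult (Smon n) \<cdot>\<^bsub>Omega2\<^esub> (Ident Omega2 (corolla n) \<boxtimes>\<^bsub>Omega2\<^esub> mult (Smon n)) \<cdot>\<^bsub>Omega2\<^esub>
      Assoc Omega2 (corolla n) (corolla n) (corolla n)"
    by (rule tree_arrow_eqI[OF Omega2.comp_hom[OF mi m(1)]
          Omega2.comp_hom[OF a Omega2.comp_hom[OF im m(1)]]])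
      (auto simp: leaf_comp[OF mi] leaf_comp[OF a] leaf_comp[OF im] leaf_tensor[OF m(1) i]
        leaf_tensor[OF i m(1)] m(2,3))
  show "mult (Smon n) \<cdot>\<^bsub>Omega2\<^esub> (unit (Smon n) \<boxtimes>\<^bsub>Omega2\<^esub> Ident Omega2 (corolla n)) = LUnit Omega2 (corolla n)"
    by (rule tree_arrow_eqI[OF Omega2.comp_hom[OF ui m(1)] tree_lunit_hom[OF P]])
      (auto simp: leaf_comp[OF ui] leaf_tensor[OF u i] m(2,3))
  show "mult (Smon n) \<cdot>\<^bsub>Omega2\<^esub> (Ident Omega2 (corolla n) \<boxtimes>\<^bsub>Omega2\<^esub> unit (Smon n)) = RUnit Omega2 (corolla n)"
    by (rule tree_arrow_eqI[OF Omega2.comp_hom[OF iu m(1)] tree_runit_hom[OF P]])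
      (auto simp: leaf_comp[OF iu] leaf_tensor[OF i u] m(2,3))
qed

lemma Smap_monoid_hom:
  assumes d: "d \<in> Arr Delta"
  shows "Smap d \<in> monoid_homs Omega2 (Smon (source d)) (Smon (target d))"
proof -
  have n: "source d \<ge> 1" "target d \<ge> 1" using d by (auto simp: Delta_arr)
  note S = Smap[OF d]
  note SS = tensor_tree_hom[OF S(1) S(1)]
  note m = mult_Smon[OF n(1)] and m' = mult_Smon[OF n(2)]
  have d': "underlying d x \<in> {1..target d}" if "x \<in> {1..source d}" for x
    using d that by (auto simp: Delta_arr)
  have "Smap d \<cdot>\<^bsub>Omega2\<^esub> mult (Smon (source d)) =
      mult (Smon (target d)) \<cdot>\<^bsub>Omega2\<^esub> (Smap d \<boxtimes>\<^bsub>Omega2\<^esub> Smap d)"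
    by (rule tree_arrow_eqI[OF Omega2.comp_hom[OF m(1) S(1)] Omega2.comp_hom[OF SS m'(1)]])
      (use d' in \<open>auto simp: leaf_comp[OF m(1)] leaf_comp[OF SS] leaf_tensor[OF S(1) S(1)] S(2) m m'\<close>)
  moreover have "Smap d \<cdot>\<^bsub>Omega2\<^esub> unit (Smon (source d)) = unit (Smon (target d))"
    by (rule tree_arrow_eqI[OF Omega2.comp_hom[OF unit_Smon[OF n(1)] S(1)] unit_Smon[OF n(2)]]) simp
  ultimately show ?thesis using S(1) by (simp add: monoid_homs_def)
qed

lemma S_star_simps:
  "n \<ge> 1 \<Longrightarrow> omap S_star n = Smon n"
  "d \<in> Arr Delta \<Longrightarrow> amap S_star d = Arrow (Smon (source d)) (Smon (target d)) (Smap d)"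
  "omap S_star \<in> extensional (Obj Delta)" "amap S_star \<in> extensional (Arr Delta)"
  by (simp_all add: S_star_def Let_def Smap_def)

lemma Smap_ident:
  assumes n: "n \<ge> 1"
  shows "Smap (Ident Delta n) = Ident Omega2 (corolla n)"
proof (rule tree_arrow_eqI)
  have d: "Ident Delta n \<in> Arr Delta" using n by (intro Delta.ident_arr) simp
  show "Smap (Ident Delta n) \<in> hom Omega2 (corolla n) (corolla n)" using Smap(1)[OF d] by simp
  show "leaf (Smap (Ident Delta n)) x = leaf (Ident Omega2 (corolla n)) x" if "x \<in> nodes2 (corolla n)" for x
    using Smap(2)[OF d] that leaf_ident[OF that] by simp
qed (rule ident_tree_hom[OF corolla_pruned[OF n]])

lemma Smap_comp:
  assumes f: "f \<in> hom Delta l m" and g: "g \<in> hom Delta m n"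
  shows "Smap (g \<cdot>\<^bsub>Delta\<^esub> f) = Smap g \<cdot>\<^bsub>Omega2\<^esub> Smap f"
proof (rule tree_arrow_eqI)
  have fg: "f \<in> Arr Delta" "g \<in> Arr Delta" "source f = l" "target f = m" "source g = m" "target g = n"
    using Delta_homD[OF f] Delta_homD[OF g] by simp_all
  have gf: "g \<cdot>\<^bsub>Delta\<^esub> f \<in> Arr Delta" using Delta.comp_hom[OF f g] by (rule Delta.hom_arr)
  show "Smap (g \<cdot>\<^bsub>Delta\<^esub> f) \<in> hom Omega2 (corolla l) (corolla n)" using Smap(1)[OF gf] fg by simp
  note S = Smap[OF fg(1), unfolded fg(3,4)] and S' = Smap[OF fg(2), unfolded fg(5,6)]
  show "Smap g \<cdot>\<^bsub>Omega2\<^esub> Smap f \<in> hom Omega2 (corolla l) (corolla n)"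
    by (rule Omega2.comp_hom[OF S(1) S'(1)])
  fix x assume x: "x \<in> nodes2 (corolla l)"
  have "underlying f x \<in> {1..m}" using fg x by (auto simp: Delta_arr)
  then show "leaf (Smap (g \<cdot>\<^bsub>Delta\<^esub> f)) x = leaf (Smap g \<cdot>\<^bsub>Omega2\<^esub> Smap f) x"
    using x Smap(2)[OF gf] fg leaf_comp[OF S(1) x] S(2) S'(2) by (simp add: compose_def)
qed

lemma S_star_functor: "category_functor Delta (Mon Omega2) S_star"
proof
  fix d e l m n
  { assume d: "d \<in> hom Delta l m"
    note d' = Delta_homD[OF d]
    show "amap S_star d \<in> hom (Mon Omega2) (omap S_star l) (omap S_star m)"
      using d' Smap_monoid_hom[OF d'(1)] by (simp add: S_star_simps hom_Mon monoid_Smon)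
    assume e: "e \<in> hom Delta m n"
    note e' = Delta_homD[OF e]
    have ed: "e \<cdot>\<^bsub>Delta\<^esub> d \<in> Arr Delta" using Delta.comp_hom[OF d e] by (rule Delta.hom_arr)
    show "amap S_star (e \<cdot>\<^bsub>Delta\<^esub> d) = amap S_star e \<cdot>\<^bsub>Mon Omega2\<^esub> amap S_star d"
      unfolding S_star_simps(2)[OF ed] S_star_simps(2)[OF e'(1)] S_star_simps(2)[OF d'(1)]
      unfolding Smap_comp[OF d e] using d' e' by simp }
  { assume n: "n \<in> Obj Delta"
    then have n': "n \<ge> 1" by simp
    from n show "omap S_star n \<in> Obj (Mon Omega2)" by (simp add: S_star_simps monoid_Smon)
    show "amap S_star (Ident Delta n) = Ident (Mon Omega2) (omap S_star n)"
      unfolding S_star_simps(2)[OF Delta.ident_arr(1)[OF n]] Smap_ident[OF n']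
      using n by (simp add: S_star_simps) }
qed (rule S_star_simps)+

subsection \<open>Generation of the category of pruned trees\<close>

text \<open>The standard tree of each shape. Its nesting and its final empty tree copy those of the
  tensor products built from a cosimplicial monoid, so the comparison between the two is defined by
  the same recursion.\<close>

fun forest :: "nat list \<Rightarrow> tree" where
  "forest [] = empty_tree"
| "forest (n # ns) = tree_sum (corolla n) (forest ns)"

lemma forest_pruned [simp]: "\<forall>n \<in> set ns. n \<ge> 1 \<Longrightarrow> forest ns \<in> pruned_trees"
  by (induction ns) auto

lemma shape_forest: "\<forall>n \<in> set ns. n \<ge> 1 \<Longrightarrow> shape (forest ns) = ns"
  by (induction ns) (auto simp: shape_tree_sum simp del: upt_Suc)

lemma shape_positive: "t \<in> pruned_trees \<Longrightarrow> \<forall>n \<in> set (shape t). n \<ge> 1"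
  using wf_blocks_fibs(1)[of t] by (auto simp: wf_blocks_def Suc_le_eq)

text \<open>The generators are arrows on which two monoidal functors can be compared by hand. The
  closure provides the induction for \<open>kappa_natural\<close>; source and target of the
  components are recorded in the last two rules because naturality squares have to be composed and
  tensored there.\<close>

inductive generated :: "tree_arrow \<Rightarrow> bool" where
  generated_rigid: "rigid s t F \<Longrightarrow> generated F"
| generated_Smap: "d \<in> Arr Delta \<Longrightarrow> generated (Smap d)"
| generated_mult: "n \<ge> 1 \<Longrightarrow> generated (mult (Smon n))"
| generated_unit: "n \<ge> 1 \<Longrightarrow> generated (unit (Smon n))"
| generated_comp: "\<lbrakk>F \<in> hom Omega2 s t; G \<in> hom Omega2 t u; generated F; generated G\<rbrakk>
    \<Longrightarrow> generated (G \<cdot>\<^bsub>Omega2\<^esub> F)"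
| generated_tensor: "\<lbrakk>F \<in> hom Omega2 s s'; G \<in> hom Omega2 t t'; generated F; generated G\<rbrakk>
    \<Longrightarrow> generated (F \<boxtimes>\<^bsub>Omega2\<^esub> G)"

lemma leaf_map_precomp:
  "leaf_map (tree_sum s t) u f \<Longrightarrow> s \<in> pruned_trees \<Longrightarrow> t \<in> pruned_trees \<Longrightarrow>
    leaf_map s u (f \<circ> inl) \<and> leaf_map t u (f \<circ> inr)"
  by (simp add: leaf_map_tree_sum)

abbreviation strip :: "nat \<Rightarrow> nat" where
  "strip \<equiv> copair id id"

text \<open>Factorisation through the right summand: on leaves tagged by \<open>inr\<close> the
  relations of the sum are those of t, so the tag can be removed.\<close>

lemma leaf_map_strip_right:
  assumes "s \<in> pruned_trees" "t \<in> pruned_trees" "leaf_map u (tree_sum s t) f"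
    "\<And>x. x \<in> nodes2 u \<Longrightarrow> f x \<notin> range inl"
  shows "leaf_map u t (strip \<circ> f)" "\<And>x. x \<in> nodes2 u \<Longrightarrow> f x = inr (strip (f x))"
proof -
  show eq: "f x = inr (strip (f x))" if "x \<in> nodes2 u" for x
    using assms(4)[OF that] by (cases "f x" rule: inl_inr_cases) auto
  have "(strip (f x), strip (f y)) \<in> before t" if "(x, y) \<in> before u" for x y
  proof -
    have "x \<in> nodes2 u" "y \<in> nodes2 u" using that by (auto simp: before_def)
    then show ?thesis using that assms(3) eq[of x] eq[of y] before_tree_sum(2)
      unfolding leaf_map_def by metis
  qed
  moreover have "(strip (f x), strip (f y)) \<in> within t" if "(x, y) \<in> within u" for x y
  proof -
    have "x \<in> nodes2 u" "y \<in> nodes2 u" using that by (auto simp: within_def FieldI1 FieldI2)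
    then show ?thesis using that assms(3) eq[of x] eq[of y] within_tree_sum(2)
      unfolding leaf_map_def by metis
  qed
  moreover have "strip (f x) \<in> nodes2 t" if "x \<in> nodes2 u" for x
  proof -
    have "inr (strip (f x)) \<in> nodes2 (tree_sum s t)"
      using leaf_map_nodes[OF assms(3) that] eq[OF that] by simp
    then show ?thesis by auto
  qed
  ultimately show "leaf_map u t (strip \<circ> f)" by (simp add: leaf_map_def)
qed

text \<open>An arrow that misses the first target corolla is, up to the left unitor of its source,
  the sum of the unit of that corolla and an arrow into the rest.\<close>

lemma generated_skip:
  assumes s: "s \<in> pruned_trees" and t: "t \<in> pruned_trees" and m: "m \<ge> 1"
    and F: "F \<in> hom Omega2 s (tree_sum (corolla m) t)"
    and avoid: "\<And>x. x \<in> nodes2 s \<Longrightarrow> leaf F x \<notin> range inl"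
    and gen: "\<And>G. G \<in> hom Omega2 s t \<Longrightarrow> generated G"
  shows "generated F"
proof -
  note strip = leaf_map_strip_right[OF corolla_pruned[OF m] t leaf_map_hom[OF F] avoid]
  let ?G = "leaf_arrow s t (strip \<circ> leaf F)"
  have G: "?G \<in> hom Omega2 s t" by (rule leaf_arrow_hom[OF s t strip(1)])
  note u = unit_Smon[OF m] and l = tree_lunit_hom[OF s]
  note uG = tensor_tree_hom[OF u G]
  have eq: "F \<cdot>\<^bsub>Omega2\<^esub> LUnit Omega2 s = unit (Smon m) \<boxtimes>\<^bsub>Omega2\<^esub> ?G"
    by (rule tree_arrow_eqI[OF Omega2.comp_hom[OF l F] uG])
      (auto simp: leaf_comp[OF l] leaf_tensor[OF u G] strip(2)[symmetric])
  have r: "rigid s (tree_sum empty_tree s) (Omega2.LInv s)"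
    by (rule rigid_inverse_arr[OF rigid_unit(1)[OF s]])
  have "F = (F \<cdot>\<^bsub>Omega2\<^esub> LUnit Omega2 s) \<cdot>\<^bsub>Omega2\<^esub> Omega2.LInv s"
    using s F by simp
  also have "generated \<dots>"
    unfolding eq
    by (rule generated_comp[OF rigid_hom[OF r] uG generated_rigid[OF r]
          generated_tensor[OF u G generated_unit[OF m] gen[OF G]]])
  finally show ?thesis .
qed

text \<open>The free module structure on the sum of a corolla and t, seen on leaves: the extra
  corolla is merged into the one already there. It is the counterpart among trees of
  \<open>action\<close> below.\<close>

lemma corolla_action:
  assumes m: "m \<ge> 1" and t: "t \<in> pruned_trees"
  obtains A where "A \<in> hom Omega2 (tree_sum (corolla m) (tree_sum (corolla m) t)) (tree_sum (corolla m) t)"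
    "generated A" "\<And>x. x \<in> {1..m} \<Longrightarrow> leaf A (inl x) = inl x"
    "\<And>x. x \<in> nodes2 (tree_sum (corolla m) t) \<Longrightarrow> leaf A (inr x) = x"
proof
  note M = mult_Smon[OF m] and P = corolla_pruned[OF m]
  note a = tree_assoc_hom[OF P P t] and i = ident_tree_hom[OF t]
  have r: "rigid (tree_sum (corolla m) (tree_sum (corolla m) t)) (tree_sum (tree_sum (corolla m) (corolla m)) t)
      (Omega2.AInv (corolla m) (corolla m) t)"
    by (rule rigid_inverse_arr[OF rigid_assoc[OF P P t]])
  let ?A = "(mult (Smon m) \<boxtimes>\<^bsub>Omega2\<^esub> Ident Omega2 t) \<cdot>\<^bsub>Omega2\<^esub> Omega2.AInv (corolla m) (corolla m) t"
  note Mi = tensor_tree_hom[OF M(1) i]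
  show A: "?A \<in> hom Omega2 (tree_sum (corolla m) (tree_sum (corolla m) t)) (tree_sum (corolla m) t)"
    by (rule Omega2.comp_hom[OF rigid_hom[OF r] Mi])
  show "generated ?A"
    by (rule generated_comp[OF rigid_hom[OF r] Mi generated_rigid[OF r]
          generated_tensor[OF M(1) i generated_mult[OF m] generated_rigid[OF rigid_ident[OF t]]]])
  \<comment> \<open>The inverse associator comes without a formula on leaves; precomposing with the
    associator removes it.\<close>
  have "?A \<cdot>\<^bsub>Omega2\<^esub> Assoc Omega2 (corolla m) (corolla m) t = mult (Smon m) \<boxtimes>\<^bsub>Omega2\<^esub> Ident Omega2 t"
    using P t Mi by simp
  then have leafA: "leaf ?A (leaf (Assoc Omega2 (corolla m) (corolla m) t) z) =
      leaf (mult (Smon m) \<boxtimes>\<^bsub>Omega2\<^esub> Ident Omega2 t) z"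
    if "z \<in> nodes2 (tree_sum (tree_sum (corolla m) (corolla m)) t)" for z
    using leaf_comp[OF a that, of ?A] by simp
  show "leaf ?A (inl x) = inl x" if "x \<in> {1..m}" for x
    using leafA[of "inl (inl x)"] that by (simp add: leaf_tensor[OF M(1) i] M(2))
  show "leaf ?A (inr x) = x" if "x \<in> nodes2 (tree_sum (corolla m) t)" for x
    using leafA[of "inl (inr (strip x))"] leafA[of "inr (strip x)"] that
    by (auto simp: leaf_tensor[OF M(1) i] M(3) leaf_ident)
qed

text \<open>The first source corolla lands in the first target corolla and gives an order-preserving
  map d. The arrow G is the restriction of F to the other source fibres and may itself still reach
  that target corolla; merging S(d) with G through the module structure gives back F.\<close>

lemma generated_use:
  assumes s: "s \<in> pruned_trees" and t: "t \<in> pruned_trees" and n: "n \<ge> 1" and m: "m \<ge> 1"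
    and F: "F \<in> hom Omega2 (tree_sum (corolla n) s) (tree_sum (corolla m) t)"
    and hit: "leaf F (inl 1) \<in> range inl"
    and gen: "\<And>G. G \<in> hom Omega2 s (tree_sum (corolla m) t) \<Longrightarrow> generated G"
  shows "generated F"
proof -
  note f = leaf_map_hom[OF F]
  define d where "d = Arrow n m (\<lambda>i\<in>{1..n}. strip (leaf F (inl i)))"
  have dsimps: "source d = n" "target d = m" by (simp_all add: d_def)
  have inl: "leaf F (inl i) = inl (strip (leaf F (inl i))) \<and> strip (leaf F (inl i)) \<in> {1..m}"
    if i: "i \<in> {1..n}" for i
  proof -
    obtain y where y: "leaf F (inl 1) = inl y" using hit by auto
    \<comment> \<open>A corolla is a single fibre, so each of its leaves is before leaf 1; and no
      leaf of the right summand is before a leaf of the left one.\<close>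
    have "(inl i, inl 1) \<in> before (tree_sum (corolla n) s)" using i by simp
    then have "(leaf F (inl i), inl y) \<in> before (tree_sum (corolla m) t)"
      using f y unfolding leaf_map_def by metis
    moreover have "leaf F (inl i) \<in> nodes2 (tree_sum (corolla m) t)"
      using leaf_map_nodes[OF f, of "inl i"] i by simp
    ultimately show ?thesis by (cases "leaf F (inl i)" rule: inl_inr_cases) auto
  qed
  have "strip (leaf F (inl i)) \<le> strip (leaf F (inl j))" if ij: "i \<in> {1..n}" "j \<in> {1..n}" "i \<le> j" for i j
  proof -
    have "(inl i, inl j) \<in> within (tree_sum (corolla n) s)" using ij by simp
    then have "(leaf F (inl i), leaf F (inl j)) \<in> within (tree_sum (corolla m) t)"
      using f unfolding leaf_map_def by blast
    then have "(inl (strip (leaf F (inl i))), inl (strip (leaf F (inl j)))) \<in> within (tree_sum (corolla m) t)"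
      using inl[OF ij(1)] inl[OF ij(2)] by simp
    then show ?thesis by simp
  qed
  then have d: "d \<in> Arr Delta"
    using n m inl by (auto simp: Delta_arr mono_on_def d_def)
  note S = Smap[OF d, unfolded dsimps]
  have S2: "leaf (Smap d) i = strip (leaf F (inl i))" if "i \<in> {1..n}" for i
    using S(2)[OF that] that by (simp add: d_def)
  define G where "G = leaf_arrow s (tree_sum (corolla m) t) (leaf F \<circ> inr)"
  have tm: "tree_sum (corolla m) t \<in> pruned_trees" using m t by simp
  have G: "G \<in> hom Omega2 s (tree_sum (corolla m) t)"
    unfolding G_def using leaf_map_precomp[OF f] s n by (intro leaf_arrow_hom[OF s tm]) simp
  have G2: "leaf G x = leaf F (inr x)" if "x \<in> nodes2 s" for x using that by (simp add: G_def)
  obtain A where A: "A \<in> hom Omega2 (tree_sum (corolla m) (tree_sum (corolla m) t)) (tree_sum (corolla m) t)"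
    "generated A" "\<And>x. x \<in> {1..m} \<Longrightarrow> leaf A (inl x) = inl x"
    "\<And>x. x \<in> nodes2 (tree_sum (corolla m) t) \<Longrightarrow> leaf A (inr x) = x"
    using corolla_action[OF m t] by blast
  have SG: "Smap d \<boxtimes>\<^bsub>Omega2\<^esub> G \<in> hom Omega2 (tree_sum (corolla n) s)
      (tree_sum (corolla m) (tree_sum (corolla m) t))"
    by (rule tensor_tree_hom[OF S(1) G])
  have "F = A \<cdot>\<^bsub>Omega2\<^esub> (Smap d \<boxtimes>\<^bsub>Omega2\<^esub> G)"
  proof (rule tree_sum_eqI[OF F Omega2.comp_hom[OF SG A(1)]])
    show "leaf F (inl x) = leaf (A \<cdot>\<^bsub>Omega2\<^esub> (Smap d \<boxtimes>\<^bsub>Omega2\<^esub> G)) (inl x)" if "x \<in> nodes2 (corolla n)" for x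
      using that inl[of x] A(3)[of "strip (leaf F (inl x))"] S2[of x]
      by (simp add: leaf_comp[OF SG] leaf_tensor[OF S(1) G])
    show "leaf F (inr x) = leaf (A \<cdot>\<^bsub>Omega2\<^esub> (Smap d \<boxtimes>\<^bsub>Omega2\<^esub> G)) (inr x)" if x: "x \<in> nodes2 s" for x
    proof -
      have "leaf F (inr x) \<in> nodes2 (tree_sum (corolla m) t)"
        using leaf_map_nodes[OF f, of "inr x"] x by simp
      from A(4)[OF this] show ?thesis
        using x by (simp add: leaf_comp[OF SG] leaf_tensor[OF S(1) G] G2)
    qed
  qed
  also have "generated \<dots>"
    by (rule generated_comp[OF SG A(1) generated_tensor[OF S(1) G generated_Smap[OF d] gen[OF G]] A(2)])
  finally show ?thesis .
qed

text \<open>Using the first target corolla shortens the source and keeps the target, skipping it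
  shortens the target and keeps the source: hence an induction on the target with one on the source
  inside.\<close>

lemma generated_forest:
  "\<lbrakk>\<forall>n \<in> set ns. n \<ge> 1; \<forall>m \<in> set ms. m \<ge> 1; F \<in> hom Omega2 (forest ns) (forest ms)\<rbrakk> \<Longrightarrow> generated F"
proof (induction ms arbitrary: ns F)
  case Nil
  \<comment> \<open>Without leaves in the target there are none in the source, so the source forest
    is empty as well.\<close>
  have "nodes2 (forest ns) = {}" using leaf_hom[OF Nil.prems(3)] by auto
  then have "rigid (forest ns) empty_tree F"
    using Nil.prems wf_blocks_fibs[of "forest ns"]
    by (cases ns) (auto simp: rigid_def)
  then show ?case by (rule generated_rigid)
next
  case (Cons m ms)
  then have t: "forest ms \<in> pruned_trees" and m: "m \<ge> 1" by simp_all
  show ?case using Cons.prems(1,3)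
  proof (induction ns arbitrary: F)
    case Nil
    show ?case
      by (rule generated_skip[OF _ t m]) (use Nil Cons.IH[of "[]"] Cons.prems(2) in auto)
  next
    case (Cons n ns)
    then have s: "forest ns \<in> pruned_trees" and n: "n \<ge> 1" by simp_all
    have F: "F \<in> hom Omega2 (tree_sum (corolla n) (forest ns)) (tree_sum (corolla m) (forest ms))"
      using Cons.prems by simp
    show ?case
    proof (cases "leaf F (inl 1) \<in> range inl")
      case True
      show ?thesis
        by (rule generated_use[OF s t n m F True]) (use Cons.IH Cons.prems in simp)
    next
      case False
      then obtain y where y: "leaf F (inl 1) = inr y" by (cases "leaf F (inl 1)" rule: inl_inr_cases) auto
      \<comment> \<open>The first source leaf has gone beyond the first target corolla. It is before
        every other leaf, and this relation is preserved, so no leaf can return there.\<close>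
      have "leaf F z \<notin> range inl" if z: "z \<in> nodes2 (tree_sum (corolla n) (forest ns))" for z
      proof
        assume "leaf F z \<in> range inl"
        then obtain x where x: "leaf F z = inl x" by auto
        have "(inl 1, z) \<in> before (tree_sum (corolla n) (forest ns))" using z n s by auto
        then have "(inr y, inl x) \<in> before (tree_sum (corolla m) (forest ms))"
          using leaf_map_hom[OF F] x y unfolding leaf_map_def by metis
        then show False by simp
      qed
      then show ?thesis
        using generated_skip[OF _ t m F] s n Cons.prems(1) \<open>\<forall>m\<in>set (m # ms). m \<ge> 1\<close>
          \<open>\<And>F ns. \<lbrakk>\<forall>n\<in>set ns. 1 \<le> n; \<forall>m\<in>set ms. 1 \<le> m; F \<in> hom Omega2 (forest ns) (forest ms)\<rbrakk> \<Longrightarrow> generated F\<close>[of "n # ns"]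
        by simp
    qed
  qed
qed

definition straighten :: "tree \<Rightarrow> tree_arrow" where
  "straighten t = (SOME F. rigid (forest (shape t)) t F)"

lemma rigid_straighten:
  assumes "t \<in> pruned_trees"
  shows "rigid (forest (shape t)) t (straighten t)"
  unfolding straighten_def
  using rigid_exists[OF forest_pruned assms] shape_forest shape_positive[OF assms] someI_ex by metis

text \<open>Conjugation with \<open>straighten\<close> reduces the claim to forests, and the
  conjugating arrows are rigid, hence generators themselves.\<close>

lemma generated_arr:
  assumes F: "F \<in> hom Omega2 s t"
  shows "generated F"
proof -
  note P = hom_pruned[OF F]
  note rs = rigid_straighten[OF P(1)] and rt = rigid_straighten[OF P(2)]
  note rs' = rigid_inverse_arr[OF rs] and rt' = rigid_inverse_arr[OF rt]
  note S = rigid_iso[OF rs] and T = rigid_iso[OF rt]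
  let ?S = "straighten s" and ?T = "straighten t"
  let ?G = "inverse_arr Omega2 ?T \<cdot>\<^bsub>Omega2\<^esub> (F \<cdot>\<^bsub>Omega2\<^esub> ?S)"
  note G1 = Omega2.comp_hom[OF rigid_hom[OF rs] F]
  have G: "?G \<in> hom Omega2 (forest (shape s)) (forest (shape t))"
    by (rule Omega2.comp_hom[OF G1 rigid_hom[OF rt']])
  have "generated ?G" by (rule generated_forest[OF shape_positive shape_positive G]) (use P in auto)
  note gen1 = generated_comp[OF G rigid_hom[OF rt] this generated_rigid[OF rt]]
  have gen2: "generated ((?T \<cdot>\<^bsub>Omega2\<^esub> ?G) \<cdot>\<^bsub>Omega2\<^esub> inverse_arr Omega2 ?S)"
    by (rule generated_comp[OF rigid_hom[OF rs'] Omega2.comp_hom[OF G rigid_hom[OF rt]]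
          generated_rigid[OF rs'] gen1])
  have "(?T \<cdot>\<^bsub>Omega2\<^esub> ?G) \<cdot>\<^bsub>Omega2\<^esub> inverse_arr Omega2 ?S = F"
    using S T F by simp
  then show ?thesis using gen2 by simp
qed

section \<open>Modules over a monoid\<close>

text \<open>Two building blocks for the value of the functor on an arrow: \<open>skip\<close> introduces a tensor factor
  through a unit, and \<open>action\<close> is the free left module structure on \<open>carr M \<otimes> x\<close>.\<close>

definition skip :: "('o, 'a) moncat \<Rightarrow> 'a \<Rightarrow> 'a \<Rightarrow> 'a" where
  "skip C u f = (u \<boxtimes>\<^bsub>C\<^esub> f) \<cdot>\<^bsub>C\<^esub> inverse_arr C (LUnit C (Dom C f))"

definition action :: "('o, 'a) moncat \<Rightarrow> ('o, 'a) mon \<Rightarrow> 'o \<Rightarrow> 'a" where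
  "action C M x = (mult M \<boxtimes>\<^bsub>C\<^esub> Ident C x) \<cdot>\<^bsub>C\<^esub> inverse_arr C (Assoc C (carr M) (carr M) x)"

context monoidal_category
begin

text \<open>The definition of \<open>action\<close> contains an inverse associator. This form of the
  pentagon is the one that occurs in the associativity of the action; \<open>pentagon_mixed\<close>
  is the one that occurs when a further product is appended on the right.\<close>

lemma pentagon_inverse:
  assumes [simp]: "w \<in> Obj C" "x \<in> Obj C" "y \<in> Obj C" "z \<in> Obj C"
  shows "(Assoc C w x y \<boxtimes> Ident C z) \<cdot> (AInv (w \<otimes> x) y z \<cdot> AInv w x (y \<otimes> z)) =
    AInv w (x \<otimes> y) z \<cdot> (Ident C w \<boxtimes> AInv x y z)"
proof -
  let ?L = "(Assoc C w x y \<boxtimes> Ident C z) \<cdot> (AInv (w \<otimes> x) y z \<cdot> AInv w x (y \<otimes> z))"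
  have "?L = AInv w (x \<otimes> y) z \<cdot> ((Ident C w \<boxtimes> AInv x y z) \<cdot>
      (((Ident C w \<boxtimes> Assoc C x y z) \<cdot> Assoc C w (x \<otimes> y) z \<cdot> (Assoc C w x y \<boxtimes> Ident C z)) \<cdot>
        (AInv (w \<otimes> x) y z \<cdot> AInv w x (y \<otimes> z))))"
    by simp
  also have "\<dots> = AInv w (x \<otimes> y) z \<cdot> (Ident C w \<boxtimes> AInv x y z)"
    unfolding pentagon[OF assms, symmetric] by simp
  finally show ?thesis .
qed

lemma pentagon_mixed:
  assumes [simp]: "w \<in> Obj C" "x \<in> Obj C" "y \<in> Obj C" "z \<in> Obj C"
  shows "Assoc C (w \<otimes> x) y z \<cdot> (AInv w x y \<boxtimes> Ident C z) =
    AInv w x (y \<otimes> z) \<cdot> ((Ident C w \<boxtimes> Assoc C x y z) \<cdot> Assoc C w (x \<otimes> y) z)"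
proof -
  have "AInv w x (y \<otimes> z) \<cdot> ((Ident C w \<boxtimes> Assoc C x y z) \<cdot> Assoc C w (x \<otimes> y) z) =
      AInv w x (y \<otimes> z) \<cdot> (((Ident C w \<boxtimes> Assoc C x y z) \<cdot> Assoc C w (x \<otimes> y) z \<cdot>
        (Assoc C w x y \<boxtimes> Ident C z)) \<cdot> (AInv w x y \<boxtimes> Ident C z))"
    by simp
  also have "\<dots> = Assoc C (w \<otimes> x) y z \<cdot> (AInv w x y \<boxtimes> Ident C z)"
    unfolding pentagon[OF assms, symmetric] by simp
  finally show ?thesis by simp
qed

lemma triangle_inverse:
  assumes [simp]: "x \<in> Obj C" "y \<in> Obj C"
  shows "(RUnit C x \<boxtimes> Ident C y) \<cdot> (AInv x (Unit C) y \<cdot> (Ident C x \<boxtimes> LInv y)) = Ident C (x \<otimes> y)"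
  unfolding triangle[OF assms, symmetric] by simp

lemma skip_arr [simp]:
  assumes "u \<in> Arr C" "Dom C u = Unit C" "f \<in> Arr C"
  shows "skip C u f \<in> Arr C" "Dom C (skip C u f) = Dom C f" "Cod C (skip C u f) = Cod C u \<otimes> Cod C f"
  using assms by (auto simp: skip_def)

lemma skip_comp:
  assumes "u \<in> Arr C" "Dom C u = Unit C" "f \<in> Arr C" "h \<in> Arr C" "Dom C f = Cod C h"
  shows "skip C u f \<cdot> h = skip C u (f \<cdot> h)"
  using assms by (simp add: skip_def inverse_lunit_natural)

text \<open>The arrow composed on the left is the recursion step of \<open>tensor_mult\<close>: a
  factor introduced by a unit stays in front when another product is appended on the right. The
  coherence behind it is \<open>inverse_lunit_tensor\<close>.\<close>

lemma skip_tensor: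
  assumes "u \<in> Arr C" "Dom C u = Unit C" "Cod C u = a" "f \<in> Arr C" "g \<in> Arr C" "\<phi> \<in> Arr C"
    "Dom C \<phi> = Cod C f \<otimes> Cod C g" "Cod C f = p" "Cod C g = q"
  shows "((Ident C a \<boxtimes> \<phi>) \<cdot> Assoc C a p q) \<cdot> (skip C u f \<boxtimes> g) = skip C u (\<phi> \<cdot> (f \<boxtimes> g))"
proof -
  have [simp]: "a \<in> Obj C" using assms(1,3) by auto
  have "((Ident C a \<boxtimes> \<phi>) \<cdot> Assoc C a p q) \<cdot> (skip C u f \<boxtimes> g) =
      (Ident C a \<boxtimes> \<phi>) \<cdot> (Assoc C a p q \<cdot> (((u \<boxtimes> f) \<boxtimes> g) \<cdot> (LInv (Dom C f) \<boxtimes> Ident C (Dom C g))))"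
    using assms by (auto simp: skip_def)
  also have "\<dots> = (Ident C a \<boxtimes> \<phi>) \<cdot> ((u \<boxtimes> (f \<boxtimes> g)) \<cdot>
      (Assoc C (Unit C) (Dom C f) (Dom C g) \<cdot> (LInv (Dom C f) \<boxtimes> Ident C (Dom C g))))"
    using assms by (subst assoc_natural_arr2) auto
  also have "\<dots> = skip C u (\<phi> \<cdot> (f \<boxtimes> g))"
    unfolding inverse_lunit_tensor[OF dom_cod_obj(1)[OF assms(4)] dom_cod_obj(1)[OF assms(5)]]
    using assms by (auto simp: skip_def)
  finally show ?thesis .
qed

end

context monoid_in
begin

lemma action_arr [simp]:
  assumes "x \<in> Obj C"
  shows "action C M x \<in> Arr C" "Dom C (action C M x) = carr M \<otimes> (carr M \<otimes> x)"
    "Cod C (action C M x) = carr M \<otimes> x"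
  using assms by (auto simp: action_def)

text \<open>The left unit law of M. In composites it removes a factor that one arrow introduces
  through a unit and the next one multiplies into the first factor of the remaining value.\<close>

lemma action_skip_unit:
  assumes "f \<in> Arr C" "Cod C f = carr M \<otimes> x" and x [simp]: "x \<in> Obj C"
  shows "action C M x \<cdot> skip C (unit M) f = f"
proof -
  let ?c = "carr M"
  have "skip C (unit M) f = (unit M \<boxtimes> Ident C (?c \<otimes> x)) \<cdot> ((Ident C (Unit C) \<boxtimes> f) \<cdot> LInv (Dom C f))"
    using assms by (simp add: skip_def del: tensor_ident)
  also have "\<dots> = (unit M \<boxtimes> (Ident C ?c \<boxtimes> Ident C x)) \<cdot> (LInv (?c \<otimes> x) \<cdot> f)"
    using assms by (simp add: inverse_lunit_natural)
  finally have "action C M x \<cdot> skip C (unit M) f = (mult M \<boxtimes> Ident C x) \<cdot>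
      (AInv ?c ?c x \<cdot> ((unit M \<boxtimes> (Ident C ?c \<boxtimes> Ident C x)) \<cdot> (LInv (?c \<otimes> x) \<cdot> f)))"
    using assms by (simp add: action_def)
  also have "\<dots> = (mult M \<boxtimes> Ident C x) \<cdot> (((unit M \<boxtimes> Ident C ?c) \<boxtimes> Ident C x) \<cdot>
      (AInv (Unit C) ?c x \<cdot> (LInv (?c \<otimes> x) \<cdot> f)))"
    using assms by (subst inverse_assoc_natural2) auto
  also have "\<dots> = (LUnit C ?c \<boxtimes> Ident C x) \<cdot> (AInv (Unit C) ?c x \<cdot> (LInv (?c \<otimes> x) \<cdot> f))"
    using assms by (simp add: mult_lunit)
  also have "\<dots> = f"
    unfolding lunit_tensor[OF carr_obj x, symmetric] using assms by simp
  finally show ?thesis .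
qed

text \<open>The right unit law of M. Multiplying one value into a factor just created by a unit
  leaves that value, so a target fibre that receives exactly one source fibre is evaluated without
  any multiplication.\<close>

lemma action_tensor_skip:
  assumes "f \<in> Arr C" "g \<in> Arr C" "Cod C g = carr M" "Cod C f = x"
  shows "action C M x \<cdot> (g \<boxtimes> skip C (unit M) f) = g \<boxtimes> f"
proof -
  let ?c = "carr M"
  have x: "x \<in> Obj C" using assms by auto
  have "action C M x \<cdot> (g \<boxtimes> skip C (unit M) f) = (mult M \<boxtimes> Ident C x) \<cdot> (AInv ?c ?c x \<cdot>
      ((Ident C ?c \<boxtimes> (unit M \<boxtimes> Ident C x)) \<cdot> ((Ident C ?c \<boxtimes> LInv x) \<cdot> (g \<boxtimes> f))))"
    using assms by (auto simp: action_def skip_def inverse_lunit_natural)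
  also have "\<dots> = (mult M \<boxtimes> Ident C x) \<cdot> (((Ident C ?c \<boxtimes> unit M) \<boxtimes> Ident C x) \<cdot>
      (AInv ?c (Unit C) x \<cdot> ((Ident C ?c \<boxtimes> LInv x) \<cdot> (g \<boxtimes> f))))"
    using assms by (subst inverse_assoc_natural2) auto
  also have "\<dots> = ((RUnit C ?c \<boxtimes> Ident C x) \<cdot> (AInv ?c (Unit C) x \<cdot> (Ident C ?c \<boxtimes> LInv x))) \<cdot> (g \<boxtimes> f)"
    using assms x by (simp add: mult_runit)
  also have "\<dots> = g \<boxtimes> f"
    unfolding triangle_inverse[OF carr_obj x] using assms by auto
  finally show ?thesis .
qed

text \<open>Associativity of M; \<open>pentagon_inverse\<close> rearranges the inverse associators
  of the two nested actions.\<close>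

lemma action_assoc:
  assumes x [simp]: "x \<in> Obj C"
  shows "action C M x \<cdot> action C M (carr M \<otimes> x) = action C M x \<cdot> (Ident C (carr M) \<boxtimes> action C M x)"
proof -
  let ?c = "carr M" and ?one = "Ident C (carr M)" and ?m = "mult M"
  have "action C M x \<cdot> action C M (?c \<otimes> x) =
      (?m \<boxtimes> Ident C x) \<cdot> (AInv ?c ?c x \<cdot> ((?m \<boxtimes> (?one \<boxtimes> Ident C x)) \<cdot> AInv ?c ?c (?c \<otimes> x)))"
    by (simp add: action_def)
  also have "\<dots> = (?m \<boxtimes> Ident C x) \<cdot> (((?m \<boxtimes> ?one) \<boxtimes> Ident C x) \<cdot>
      (AInv (?c \<otimes> ?c) ?c x \<cdot> AInv ?c ?c (?c \<otimes> x)))"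
    by (subst inverse_assoc_natural2) auto
  also have "\<dots> = ((?m \<cdot> (?m \<boxtimes> ?one)) \<boxtimes> Ident C x) \<cdot> (AInv (?c \<otimes> ?c) ?c x \<cdot> AInv ?c ?c (?c \<otimes> x))"
    by simp
  also have "\<dots> = (?m \<boxtimes> Ident C x) \<cdot> (((?one \<boxtimes> ?m) \<boxtimes> Ident C x) \<cdot> ((Assoc C ?c ?c ?c \<boxtimes> Ident C x) \<cdot>
      (AInv (?c \<otimes> ?c) ?c x \<cdot> AInv ?c ?c (?c \<otimes> x))))"
    unfolding mult_assoc by simp
  also have "\<dots> = (?m \<boxtimes> Ident C x) \<cdot> (((?one \<boxtimes> ?m) \<boxtimes> Ident C x) \<cdot> (AInv ?c (?c \<otimes> ?c) x \<cdot> (?one \<boxtimes> AInv ?c ?c x)))"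
    by (subst pentagon_inverse) auto
  also have "\<dots> = (?m \<boxtimes> Ident C x) \<cdot> (AInv ?c ?c x \<cdot> ((?one \<boxtimes> (?m \<boxtimes> Ident C x)) \<cdot> (?one \<boxtimes> AInv ?c ?c x)))"
    by (subst inverse_assoc_natural2) auto
  also have "\<dots> = action C M x \<cdot> (?one \<boxtimes> action C M x)"
    by (simp add: action_def)
  finally show ?thesis .
qed

text \<open>Multiplying into the first factor commutes with appending a product on the right, again
  for the recursion step of \<open>tensor_mult\<close>. The coherence behind it is
  \<open>pentagon_mixed\<close>.\<close>

lemma action_tensor:
  assumes "f \<in> Arr C" "Cod C f = carr M \<otimes> p" "k \<in> Arr C" "Cod C k = carr M" "g \<in> Arr C" "Cod C g = q"
    "\<phi> \<in> Arr C" "Dom C \<phi> = p \<otimes> q" "Cod C \<phi> = r" and p: "p \<in> Obj C"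
  shows "((Ident C (carr M) \<boxtimes> \<phi>) \<cdot> Assoc C (carr M) p q) \<cdot> ((action C M p \<cdot> (k \<boxtimes> f)) \<boxtimes> g) =
    action C M r \<cdot> (k \<boxtimes> (((Ident C (carr M) \<boxtimes> \<phi>) \<cdot> Assoc C (carr M) p q) \<cdot> (f \<boxtimes> g))) \<cdot>
      Assoc C (Dom C k) (Dom C f) (Dom C g)"
proof -
  let ?c = "carr M" and ?one = "Ident C (carr M)" and ?m = "mult M"
  have [simp]: "q \<in> Obj C" "r \<in> Obj C" "p \<in> Obj C" using assms by auto
  have "((?one \<boxtimes> \<phi>) \<cdot> Assoc C ?c p q) \<cdot> ((action C M p \<cdot> (k \<boxtimes> f)) \<boxtimes> g) =
      (?one \<boxtimes> \<phi>) \<cdot> (Assoc C ?c p q \<cdot> (((?m \<boxtimes> Ident C p) \<boxtimes> Ident C q) \<cdot>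
        ((AInv ?c ?c p \<boxtimes> Ident C q) \<cdot> ((k \<boxtimes> f) \<boxtimes> g))))"
    using assms by (simp add: action_def del: tensor_ident)
  also have "\<dots> = (?one \<boxtimes> \<phi>) \<cdot> ((?m \<boxtimes> (Ident C p \<boxtimes> Ident C q)) \<cdot> (Assoc C (?c \<otimes> ?c) p q \<cdot>
        ((AInv ?c ?c p \<boxtimes> Ident C q) \<cdot> ((k \<boxtimes> f) \<boxtimes> g))))"
    using assms by (subst assoc_natural_arr2) auto
  also have "\<dots> = (?m \<boxtimes> \<phi>) \<cdot> ((Assoc C (?c \<otimes> ?c) p q \<cdot> (AInv ?c ?c p \<boxtimes> Ident C q)) \<cdot> ((k \<boxtimes> f) \<boxtimes> g))"
    using assms by simp
  also have "\<dots> = (?m \<boxtimes> Ident C r) \<cdot> (((?one \<boxtimes> ?one) \<boxtimes> \<phi>) \<cdot> (AInv ?c ?c (p \<otimes> q) \<cdot>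
      ((?one \<boxtimes> Assoc C ?c p q) \<cdot> (Assoc C ?c (?c \<otimes> p) q \<cdot> ((k \<boxtimes> f) \<boxtimes> g)))))"
    using assms by (subst pentagon_mixed) auto
  also have "\<dots> = (?m \<boxtimes> Ident C r) \<cdot> (((?one \<boxtimes> ?one) \<boxtimes> \<phi>) \<cdot> (AInv ?c ?c (p \<otimes> q) \<cdot>
      ((?one \<boxtimes> Assoc C ?c p q) \<cdot> ((k \<boxtimes> (f \<boxtimes> g)) \<cdot> Assoc C (Dom C k) (Dom C f) (Dom C g)))))"
    using assms by (subst assoc_natural_arr) auto
  also have "\<dots> = (?m \<boxtimes> Ident C r) \<cdot> (AInv ?c ?c r \<cdot> ((?one \<boxtimes> (?one \<boxtimes> \<phi>)) \<cdot>
      ((?one \<boxtimes> Assoc C ?c p q) \<cdot> ((k \<boxtimes> (f \<boxtimes> g)) \<cdot> Assoc C (Dom C k) (Dom C f) (Dom C g)))))"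
    using assms by (subst inverse_assoc_natural2) auto
  also have "\<dots> = action C M r \<cdot> (k \<boxtimes> (((?one \<boxtimes> \<phi>) \<cdot> Assoc C ?c p q) \<cdot> (f \<boxtimes> g))) \<cdot>
      Assoc C (Dom C k) (Dom C f) (Dom C g)"
    using assms by (simp add: action_def)
  finally show ?thesis .
qed

end

text \<open>The map that \<open>k\<close> induces on the free module is \<open>g\<close>-linear; functoriality of the tensor functor
  rests on this.\<close>

lemma action_linear:
  assumes "monoid_in C M" "monoid_in C N" and g: "g \<in> monoid_homs C M N"
    and k: "k \<in> Arr C" "Cod C k = carr N \<otimes>\<^bsub>C\<^esub> z" "Dom C k = y" and z: "z \<in> Obj C"
  shows "(action C N z \<cdot>\<^bsub>C\<^esub> (g \<boxtimes>\<^bsub>C\<^esub> k)) \<cdot>\<^bsub>C\<^esub> action C M y =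
    action C N z \<cdot>\<^bsub>C\<^esub> (g \<boxtimes>\<^bsub>C\<^esub> (action C N z \<cdot>\<^bsub>C\<^esub> (g \<boxtimes>\<^bsub>C\<^esub> k)))"
proof -
  interpret M: monoid_in C M by fact
  interpret N: monoid_in C N by fact
  let ?c = "carr M" and ?d = "carr N" and ?a = "action C N z"
  have g': "g \<in> hom C ?c ?d" "g \<cdot>\<^bsub>C\<^esub> mult M = mult N \<cdot>\<^bsub>C\<^esub> (g \<boxtimes>\<^bsub>C\<^esub> g)"
    using g by (auto simp: monoid_homs_def)
  have y: "y \<in> Obj C" using k by auto
  note [simp] = z y
  have "(?a \<cdot>\<^bsub>C\<^esub> (g \<boxtimes>\<^bsub>C\<^esub> k)) \<cdot>\<^bsub>C\<^esub> action C M y =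
      ?a \<cdot>\<^bsub>C\<^esub> (((g \<cdot>\<^bsub>C\<^esub> mult M) \<boxtimes>\<^bsub>C\<^esub> k) \<cdot>\<^bsub>C\<^esub> M.AInv ?c ?c y)"
    using g'(1) k by (simp add: action_def)
  also have "\<dots> = ?a \<cdot>\<^bsub>C\<^esub> ((mult N \<boxtimes>\<^bsub>C\<^esub> Ident C (?d \<otimes>\<^bsub>C\<^esub> z)) \<cdot>\<^bsub>C\<^esub> (((g \<boxtimes>\<^bsub>C\<^esub> g) \<boxtimes>\<^bsub>C\<^esub> k) \<cdot>\<^bsub>C\<^esub> M.AInv ?c ?c y))"
    unfolding g'(2) using g'(1) k by simp
  also have "((g \<boxtimes>\<^bsub>C\<^esub> g) \<boxtimes>\<^bsub>C\<^esub> k) \<cdot>\<^bsub>C\<^esub> M.AInv ?c ?c y = M.AInv ?d ?d (?d \<otimes>\<^bsub>C\<^esub> z) \<cdot>\<^bsub>C\<^esub> (g \<boxtimes>\<^bsub>C\<^esub> (g \<boxtimes>\<^bsub>C\<^esub> k))"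
    using g'(1) k by (subst M.inverse_assoc_natural) auto
  also have "?a \<cdot>\<^bsub>C\<^esub> ((mult N \<boxtimes>\<^bsub>C\<^esub> Ident C (?d \<otimes>\<^bsub>C\<^esub> z)) \<cdot>\<^bsub>C\<^esub> (M.AInv ?d ?d (?d \<otimes>\<^bsub>C\<^esub> z) \<cdot>\<^bsub>C\<^esub> (g \<boxtimes>\<^bsub>C\<^esub> (g \<boxtimes>\<^bsub>C\<^esub> k)))) =
      (?a \<cdot>\<^bsub>C\<^esub> action C N (?d \<otimes>\<^bsub>C\<^esub> z)) \<cdot>\<^bsub>C\<^esub> (g \<boxtimes>\<^bsub>C\<^esub> (g \<boxtimes>\<^bsub>C\<^esub> k))"
    using g'(1) k by (simp add: action_def)
  also have "\<dots> = ?a \<cdot>\<^bsub>C\<^esub> (g \<boxtimes>\<^bsub>C\<^esub> (?a \<cdot>\<^bsub>C\<^esub> (g \<boxtimes>\<^bsub>C\<^esub> k)))"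
    unfolding N.action_assoc[OF z] using g'(1) k by simp
  finally show ?thesis .
qed

section \<open>Maps of lists of blocks\<close>

primrec pos :: "nat list \<Rightarrow> nat \<Rightarrow> nat" where
  "pos [] x = 0"
| "pos (y # ys) x = (if x = y then 0 else Suc (pos ys x))"

lemma pos_less: "x \<in> set ys \<Longrightarrow> pos ys x < length ys"
  by (induction ys) auto

lemma nth_pos: "x \<in> set ys \<Longrightarrow> ys ! pos ys x = x"
  by (induction ys) auto

lemma pos_nth: "\<lbrakk>distinct ys; i < length ys\<rbrakk> \<Longrightarrow> pos ys (ys ! i) = i"
  using nth_eq_iff_index_eq[of ys "pos ys (ys ! i)" i] pos_less[of "ys ! i" ys] nth_pos[of "ys ! i" ys]
  by simp

lemma pos_map: "inj h \<Longrightarrow> pos (map h ys) (h x) = pos ys x"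
  by (induction ys) (auto dest: injD)

text \<open>Order is measured by positions in the lists, so that no reference is left to the trees
  from which the blocks come.\<close>

definition mono_block :: "(nat \<Rightarrow> nat) \<Rightarrow> nat list \<Rightarrow> nat list \<Rightarrow> bool" where
  "mono_block f xs ys \<longleftrightarrow> f ` set xs \<subseteq> set ys \<and>
     (\<forall>i j. i \<le> j \<longrightarrow> j < length xs \<longrightarrow> pos ys (f (xs ! i)) \<le> pos ys (f (xs ! j)))"

text \<open>Positions in a list start at 0 and the elements of [n] at 1, hence \<open>Suc\<close> on
  values and \<open>i - 1\<close> on arguments.\<close>

definition index_map :: "(nat \<Rightarrow> nat) \<Rightarrow> nat list \<Rightarrow> nat list \<Rightarrow> (nat, nat \<Rightarrow> nat) arrow" where
  "index_map f xs ys = Arrow (length xs) (length ys)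
     (\<lambda>i \<in> {1..length xs}. Suc (pos ys (f (xs ! (i - 1)))))"

lemma index_map_hom:
  assumes "mono_block f xs ys" "xs \<noteq> []"
  shows "index_map f xs ys \<in> hom Delta (length xs) (length ys)"
proof -
  have "ys \<noteq> []" using assms by (auto simp: mono_block_def)
  have less: "pos ys (f (xs ! i)) < length ys" if "i < length xs" for i
    using assms(1) that by (auto simp: mono_block_def intro!: pos_less)
  have "Suc (pos ys (f (xs ! (i - 1)))) \<in> {1..length ys}" if "i \<in> {1..length xs}" for i
    using less[of "i - 1"] that by (cases i) auto
  moreover have "pos ys (f (xs ! (i - 1))) \<le> pos ys (f (xs ! (j - 1)))"
    if "i \<in> {1..length xs}" "j \<in> {1..length xs}" "i \<le> j" for i j
    using assms(1) that by (simp add: mono_block_def)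
  moreover have "length xs \<ge> 1" "length ys \<ge> 1"
    using assms(2) \<open>ys \<noteq> []\<close> by (simp_all add: Suc_le_eq)
  ultimately have "index_map f xs ys \<in> Arr Delta"
    by (simp add: Delta_arr index_map_def mono_on_def)
  then show ?thesis by (intro Delta.homI) (simp_all add: index_map_def)
qed

lemma index_map_comp:
  assumes f: "mono_block f xs ys" and g: "mono_block g ys zs"
  shows "index_map g ys zs \<cdot>\<^bsub>Delta\<^esub> index_map f xs ys = index_map (g \<circ> f) xs zs"
proof -
  have "f (xs ! (i - 1)) \<in> set ys" if "i \<in> {1..length xs}" for i
    using f that by (auto simp: mono_block_def)
  then show ?thesis
    by (auto simp: index_map_def compose_def fun_eq_iff nth_pos Suc_le_eq pos_less)
qed

lemma index_map_bij:
  assumes "distinct (map f xs)"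
  shows "mono_block f xs (map f xs)" "index_map f xs (map f xs) = Ident Delta (length xs)"
proof -
  have pos: "pos (map f xs) (f (xs ! i)) = i" if "i < length xs" for i
    using pos_nth[OF assms, of i] that by simp
  then show "mono_block f xs (map f xs)" by (auto simp: mono_block_def)
  have "Suc (pos (map f xs) (f (xs ! (i - 1)))) = i" if "i \<in> {1..length xs}" for i
    using pos[of "i - 1"] that by auto
  then show "index_map f xs (map f xs) = Ident Delta (length xs)"
    by (auto simp: index_map_def fun_eq_iff)
qed

text \<open>The block of a corolla lists the numbers from 1 to n in order, so passing to indices
  returns the given arrow of Delta. This evaluates the tensor functor on
  \<open>Smap d\<close>.\<close>

lemma index_map_upt:
  assumes "d \<in> hom Delta n m" "\<And>i. i \<in> {1..n} \<Longrightarrow> f i = underlying d i"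
  shows "index_map f [1..<Suc n] [1..<Suc m] = d"
proof -
  note d = Delta_homD[OF assms(1)]
  have nth: "[1..<Suc k] ! i = Suc i" if "i < k" for i k using that by (simp del: upt_Suc)
  have "Suc (pos [1..<Suc m] (f ([1..<Suc n] ! (i - 1)))) = underlying d i" if i: "i \<in> {1..n}" for i
  proof -
    have di: "underlying d i \<in> {1..m}" using d i by (auto simp: Delta_arr)
    have "[1..<Suc n] ! (i - 1) = i" using i nth[of "i - 1" n] by auto
    moreover have "[1..<Suc m] ! (underlying d i - 1) = underlying d i"
      using di nth[of "underlying d i - 1" m] by auto
    moreover have "underlying d i - 1 < m" "Suc (underlying d i - 1) = underlying d i" using di by auto
    ultimately show ?thesis
      using pos_nth[of "[1..<Suc m]" "underlying d i - 1"] assms(2)[OF i] by (simp del: upt_Suc)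
  qed
  moreover have "underlying d \<in> extensional {1..n}" using d by (auto simp: Delta_arr PiE_def)
  ultimately have "underlying (index_map f [1..<Suc n] [1..<Suc m]) = underlying d"
    by (auto simp: index_map_def fun_eq_iff extensional_def simp del: upt_Suc)
  then show ?thesis using d by (cases d) (simp add: index_map_def del: upt_Suc)
qed

lemma mono_block_upt:
  assumes "d \<in> hom Delta n m" "\<And>i. i \<in> {1..n} \<Longrightarrow> f i = underlying d i"
  shows "mono_block f [1..<Suc n] [1..<Suc m]"
proof -
  note d = Delta_homD[OF assms(1)]
  have di: "underlying d i \<in> {1..m}" if "i \<in> {1..n}" for i using d that by (auto simp: Delta_arr)
  have pos: "pos [1..<Suc m] (f i) = underlying d i - 1" if i: "i \<in> {1..n}" for i
    using pos_nth[of "[1..<Suc m]" "underlying d i - 1"] di[OF i] assms(2)[OF i]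
      nth_upt[of 1 "underlying d i - 1" "Suc m"] by (auto simp del: upt_Suc)
  have mono: "underlying d i \<le> underlying d j" if "i \<in> {1..n}" "j \<in> {1..n}" "i \<le> j" for i j
    using d that by (auto simp: Delta_arr mono_on_def)
  have "pos [1..<Suc m] (f ([1..<Suc n] ! i)) \<le> pos [1..<Suc m] (f ([1..<Suc n] ! j))"
    if ij: "i \<le> j" "j < n" for i j
  proof -
    have "[1..<Suc n] ! i = Suc i" "[1..<Suc n] ! j = Suc j" using ij by (simp_all del: upt_Suc)
    moreover have "underlying d (Suc i) \<le> underlying d (Suc j)" by (rule mono) (use ij in auto)
    ultimately show ?thesis using pos[of "Suc i"] pos[of "Suc j"] ij by (simp del: upt_Suc)
  qed
  then show ?thesis
    using di assms(2) by (auto simp: mono_block_def less_Suc_eq_le simp del: upt_Suc)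
qed

lemma index_map_map: "index_map f (map k xs) ys = index_map (f \<circ> k) xs ys"
  by (auto simp: index_map_def fun_eq_iff)

lemma index_map_inj: "inj h \<Longrightarrow> index_map (h \<circ> f) xs (map h ys) = index_map f xs ys"
  by (auto simp: index_map_def fun_eq_iff pos_map)

lemma index_map_cong: "\<lbrakk>\<And>x. x \<in> set xs \<Longrightarrow> f x = g x\<rbrakk> \<Longrightarrow> index_map f xs ys = index_map g xs ys"
  by (auto simp: index_map_def fun_eq_iff)

lemma mono_block_cong: "\<lbrakk>\<And>x. x \<in> set xs \<Longrightarrow> f x = g x\<rbrakk> \<Longrightarrow> mono_block f xs ys = mono_block g xs ys"
  by (auto simp: mono_block_def)

text \<open>The recursion follows the target: a target block either receives the first remaining source
  block, or receives nothing more.\<close>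

fun block_map :: "(nat \<Rightarrow> nat) \<Rightarrow> nat list list \<Rightarrow> nat list list \<Rightarrow> bool" where
  "block_map f xss [] \<longleftrightarrow> xss = []"
| "block_map f [] (ys # yss) \<longleftrightarrow> block_map f [] yss"
| "block_map f (xs # xss) (ys # yss) \<longleftrightarrow>
    (if f (hd xs) \<in> set ys then mono_block f xs ys \<and> block_map f xss (ys # yss)
     else block_map f (xs # xss) yss)"

lemma block_map_nodes: "block_map f xss yss \<Longrightarrow> f ` set (concat xss) \<subseteq> set (concat yss)"
  by (induction f xss yss rule: block_map.induct)
    (auto simp: mono_block_def split: if_splits)

lemma block_map_cong:
  "\<lbrakk>\<And>x. x \<in> set (concat xss) \<Longrightarrow> f x = g x; [] \<notin> set xss\<rbrakk> \<Longrightarrow> block_map f xss yss = block_map g xss yss"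
proof (induction f xss yss rule: block_map.induct)
  case (3 f xs xss ys yss)
  have "hd xs \<in> set xs" using 3(4) by (cases xs) auto
  then have "f (hd xs) = g (hd xs)" using 3(3) by simp
  moreover have "mono_block f xs ys = mono_block g xs ys"
    by (rule mono_block_cong) (use 3(3) in simp)
  ultimately show ?case using 3 by simp
qed auto

text \<open>The left-to-right recursion never has to go back because the level 1 map is
  order-preserving: once a fibre goes beyond the first remaining target fibre, so do all later ones.
  Preservation of \<open>within\<close> gives monotonicity on each single fibre.\<close>

lemma block_map_fibs:
  assumes F: "F \<in> hom Omega2 s t"
  shows "block_map (leaf F) (fibs s) (fibs t)"
proof -
  note P = hom_pruned[OF F]
  note f = leaf_map_hom[OF F]
  obtain f2 f1 where F': "F = Arrow s t (f2, f1)" and m: "(f2, f1) \<in> tree_maps s t"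
    using F by (auto simp: hom_Omega2)
  have proj: "proj t (leaf F z) = f1 (proj s z)" if "z \<in> nodes2 s" for z
    using m F' that by (auto simp: tree_maps_def)
  have f1_mono: "(f1 x, f1 y) \<in> lev1 t" if "(x, y) \<in> lev1 s" for x y
    using m that by (auto simp: tree_maps_def)
  have mono: "mono_block (leaf F) (fibre s a) (fibre t b)" if "f1 a = b" for a b
  proof -
    have sub: "leaf F ` set (fibre s a) \<subseteq> set (fibre t b)"
      using fibre_props(2)[OF P(1)] fibre_props(2)[OF P(2)] leaf_hom[OF F] proj that by auto
    have "pos (fibre t b) (leaf F (fibre s a ! i)) \<le> pos (fibre t b) (leaf F (fibre s a ! j))"
      if ij: "i \<le> j" "j < length (fibre s a)" for i j
    proof -
      let ?x = "fibre s a ! i" and ?y = "fibre s a ! j"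
      have xy: "?x \<in> set (fibre s a)" "?y \<in> set (fibre s a)" using ij by auto
      have "set (fibre s a) \<subseteq> nodes2 s" using fibre_props(2)[OF P(1)] by auto
      from sorted_wrt_nth_iff[OF pruned_treeD(2)[OF P(1)] fibre_props(1)[OF P(1)] this fibre_props(3)[OF P(1)]]
      have "(?x, ?y) \<in> lev2 s" using ij by simp
      then have "(?x, ?y) \<in> within s" using xy fibre_props(2)[OF P(1)] by (auto simp: within_def)
      then have "(leaf F ?x, leaf F ?y) \<in> lev2 t" using f by (auto simp: leaf_map_def within_def)
      moreover have in_t: "leaf F ?x \<in> set (fibre t b)" "leaf F ?y \<in> set (fibre t b)" using sub xy by auto
      moreover have "set (fibre t b) \<subseteq> nodes2 t" using fibre_props(2)[OF P(2)] by auto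
      note sorted_wrt_nth_iff[OF pruned_treeD(2)[OF P(2)] fibre_props(1)[OF P(2)] this fibre_props(3)[OF P(2)],
          OF pos_less[OF in_t(1)] pos_less[OF in_t(2)]]
      ultimately show ?thesis using nth_pos by simp
    qed
    then show ?thesis using sub by (auto simp: mono_block_def)
  qed
  have hd: "leaf F (hd (fibre s a)) \<in> set (fibre t b) \<longleftrightarrow> f1 a = b" if "a \<in> nodes1 s" for a b
  proof -
    have "hd (fibre s a) \<in> set (fibre s a)" using fibre_nonempty[OF P(1) that] by simp
    then show ?thesis
      using fibre_props(2)[OF P(1)] fibre_props(2)[OF P(2)] leaf_hom[OF F] proj by auto
  qed
  \<comment> \<open>Arbitrary sorted lists of nodes replace the two base lists, since the recursion
    removes entries on either side.\<close>
  have "block_map (leaf F) (map (fibre s) L) (map (fibre t) K)"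
    if "set L \<subseteq> nodes1 s" "sorted_wrt (\<lambda>x y. (x, y) \<in> lev1 s) L"
      "sorted_wrt (\<lambda>x y. (x, y) \<in> lev1 t) K" "distinct K" "f1 ` set L \<subseteq> set K" for L K
    using that
  proof (induction K arbitrary: L)
    case (Cons b K)
    note outer = Cons.IH and K = Cons.prems(3,4)
    show ?case using Cons.prems(1,2,5)
    proof (induction L)
      case Nil
      then show ?case using outer[of "[]"] K by simp
    next
      case (Cons a L)
      show ?case
      proof (cases "f1 a = b")
        case True
        then show ?thesis using Cons hd[of a b] mono[OF True] by simp
      next
        case False
        \<comment> \<open>Otherwise f1 a would precede b by monotonicity, and follow b because it
          occurs later in the sorted target list; antisymmetry excludes both at once.\<close>
        have "f1 c \<noteq> b" if c: "c \<in> set L" for c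
        proof
          assume "f1 c = b"
          then have "(f1 a, b) \<in> lev1 t" using f1_mono Cons.prems(2) c by force
          moreover have "(b, f1 a) \<in> lev1 t" using False Cons.prems(3) K(1) by auto
          ultimately show False using linear_orderD(3)[OF pruned_treeD(4)[OF P(2)]] False by blast
        qed
        then have "f1 ` set (a # L) \<subseteq> set K" using False Cons.prems(3) by auto
        then show ?thesis using outer[of "a # L"] K Cons.prems False hd[of a b] by simp
      qed
    qed
  qed auto
  moreover have "f1 ` set (base_list s) \<subseteq> set (base_list t)"
    using m base_list_props(2)[OF P(1)] base_list_props(2)[OF P(2)] by (auto simp: tree_maps_def)
  ultimately show ?thesis
    using base_list_props[OF P(1)] base_list_props[OF P(2)] by (simp add: fibs_def)
qed

section \<open>The tensor functor of a cosimplicial monoid\<close>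

type_synonym ('o, 'a) cosimplicial =
  "(nat, (nat, nat \<Rightarrow> nat) arrow, ('o, 'a) mon, (('o, 'a) mon, 'a) arrow) fctr"

text \<open>With the final I, the last factor is no exception: the value of every nonempty list is a
  free module over its first monoid, which is the form that \<open>action\<close> expects.\<close>

fun tensor_obj :: "('o, 'a) moncat \<Rightarrow> ('o, 'a) cosimplicial \<Rightarrow> nat list \<Rightarrow> 'o" where
  "tensor_obj C M [] = Unit C"
| "tensor_obj C M (n # ns) = carr (omap M n) \<otimes>\<^bsub>C\<^esub> tensor_obj C M ns"

text \<open>When a block is used, ys stays in the target of the recursive call: the later source
  blocks are evaluated first, in the free module over the monoid of ys, and the value of xs is then
  multiplied in from the left. The first clause ignores its source; \<open>block_map\<close> holds
  for an empty target only if the source is empty too.\<close>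

fun tensor_arr :: "('o, 'a) moncat \<Rightarrow> ('o, 'a) cosimplicial \<Rightarrow> (nat \<Rightarrow> nat)
    \<Rightarrow> nat list list \<Rightarrow> nat list list \<Rightarrow> 'a" where
  "tensor_arr C M f xss [] = Ident C (Unit C)"
| "tensor_arr C M f [] (ys # yss) = skip C (unit (omap M (length ys))) (tensor_arr C M f [] yss)"
| "tensor_arr C M f (xs # xss) (ys # yss) =
    (if f (hd xs) \<in> set ys
     then action C (omap M (length ys)) (tensor_obj C M (map length yss)) \<cdot>\<^bsub>C\<^esub>
       (underlying (amap M (index_map f xs ys)) \<boxtimes>\<^bsub>C\<^esub> tensor_arr C M f xss (ys # yss))
     else skip C (unit (omap M (length ys))) (tensor_arr C M f (xs # xss) yss))"

fun tensor_mult :: "('o, 'a) moncat \<Rightarrow> ('o, 'a) cosimplicial \<Rightarrow> nat list \<Rightarrow> nat list \<Rightarrow> 'a" where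
  "tensor_mult C M [] ms = LUnit C (tensor_obj C M ms)"
| "tensor_mult C M (n # ns) ms = (Ident C (carr (omap M n)) \<boxtimes>\<^bsub>C\<^esub> tensor_mult C M ns ms) \<cdot>\<^bsub>C\<^esub>
    Assoc C (carr (omap M n)) (tensor_obj C M ns) (tensor_obj C M ms)"

locale cosimplicial_monoid = monoidal_category C + M: category_functor Delta "Mon C" M
  for C :: "('o, 'a) moncat" (structure) and M :: "('o, 'a) cosimplicial"
begin

abbreviation "T \<equiv> tensor_obj C M"
abbreviation "T_arr \<equiv> tensor_arr C M"
abbreviation "T_mult \<equiv> tensor_mult C M"
abbreviation "M_arr d \<equiv> underlying (amap M d)"

lemma monoid_M: "n \<ge> 1 \<Longrightarrow> monoid_in C (omap M n)"
  using M.omap_obj[of n] by simp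

lemma carr_M [simp]: "n \<ge> 1 \<Longrightarrow> carr (omap M n) \<in> Obj C"
  using monoid_M monoid_in.carr_obj by blast

lemma unit_M [simp]:
  assumes "n \<ge> 1"
  shows "unit (omap M n) \<in> Arr C" "Dom C (unit (omap M n)) = Unit C"
    "Cod C (unit (omap M n)) = carr (omap M n)"
  using monoid_in.unit_arr[OF monoid_M[OF assms]] by auto

lemma action_M [simp]:
  assumes "n \<ge> 1" "x \<in> Obj C"
  shows "action C (omap M n) x \<in> Arr C"
    "Dom C (action C (omap M n) x) = carr (omap M n) \<otimes> (carr (omap M n) \<otimes> x)"
    "Cod C (action C (omap M n) x) = carr (omap M n) \<otimes> x"
  using monoid_in.action_arr[OF monoid_M[OF assms(1)] assms(2)] by auto

lemma amap_M:
  assumes "d \<in> hom Delta m n"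
  shows "amap M d = Arrow (omap M m) (omap M n) (M_arr d)" "M_arr d \<in> monoid_homs C (omap M m) (omap M n)"
  using M.amap_hom[OF assms] by (auto simp: hom_Mon)

lemma M_arr_hom: "d \<in> hom Delta m n \<Longrightarrow> M_arr d \<in> hom C (carr (omap M m)) (carr (omap M n))"
  by (rule monoid_homs_hom[OF amap_M(2)])

lemma M_arr_unit: "d \<in> hom Delta m n \<Longrightarrow> M_arr d \<cdot> unit (omap M m) = unit (omap M n)"
  using amap_M(2) by (auto simp: monoid_homs_def)

lemma M_arr_comp:
  assumes "d \<in> hom Delta l m" "e \<in> hom Delta m n"
  shows "M_arr (e \<cdot>\<^bsub>Delta\<^esub> d) = M_arr e \<cdot> M_arr d"
  using M.amap_comp[OF assms] by (simp add: Mon_simps(5))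

lemma M_arr_ident: "n \<ge> 1 \<Longrightarrow> M_arr (Ident Delta n) = Ident C (carr (omap M n))"
  using M.amap_ident[of n] by simp

lemma T_obj [simp]: "\<forall>n \<in> set ns. n \<ge> 1 \<Longrightarrow> T ns \<in> Obj C"
  by (induction ns) auto

lemma T_blocks_obj [simp]: "[] \<notin> set xss \<Longrightarrow> T (map length xss) \<in> Obj C"
  by (rule T_obj) (auto simp: Suc_le_eq)

lemma M_arr_index [simp]:
  assumes "mono_block f xs ys" "xs \<noteq> []"
  shows "M_arr (index_map f xs ys) \<in> Arr C"
    "Dom C (M_arr (index_map f xs ys)) = carr (omap M (length xs))"
    "Cod C (M_arr (index_map f xs ys)) = carr (omap M (length ys))"
  using M_arr_hom[OF index_map_hom[OF assms]] by auto

lemma T_arr [simp]: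
  "\<lbrakk>block_map f xss yss; [] \<notin> set xss; [] \<notin> set yss\<rbrakk> \<Longrightarrow> T_arr f xss yss \<in> Arr C \<and>
    Dom C (T_arr f xss yss) = T (map length xss) \<and> Cod C (T_arr f xss yss) = T (map length yss)"
proof (induction f xss yss rule: block_map.induct)
  case (3 f xs xss ys yss)
  then have "length xs \<ge> 1" "length ys \<ge> 1" by (auto simp: Suc_le_eq)
  then show ?case using 3 by auto
next
  case (2 f ys yss)
  then have "length ys \<ge> 1" by (auto simp: Suc_le_eq)
  then show ?case using 2 by auto
qed auto

lemma T_arr_skip:
  assumes "\<forall>x \<in> set (concat xss). f x \<notin> set ys" "[] \<notin> set xss"
  shows "T_arr f xss (ys # yss) = skip C (unit (omap M (length ys))) (T_arr f xss yss)"
  using assms by (cases xss) auto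

lemma block_map_skip:
  assumes "\<forall>x \<in> set (concat xss). f x \<notin> set ys" "[] \<notin> set xss"
  shows "block_map f xss (ys # yss) \<longleftrightarrow> block_map f xss yss"
  using assms by (cases xss) auto

lemma T_arr_cong:
  "\<lbrakk>\<And>x. x \<in> set (concat xss) \<Longrightarrow> f x = g x; [] \<notin> set xss\<rbrakk> \<Longrightarrow> T_arr f xss yss = T_arr g xss yss"
proof (induction f xss yss rule: block_map.induct)
  case (3 f xs xss ys yss)
  have "hd xs \<in> set xs" using 3(4) by (cases xs) auto
  then have "f (hd xs) = g (hd xs)" using 3(3) by simp
  moreover have "index_map f xs ys = index_map g xs ys"
    by (rule index_map_cong) (use 3(3) in simp)
  ultimately show ?case using 3 by simp
qed auto

lemma T_arr_map: "[] \<notin> set xss \<Longrightarrow> T_arr f (map (map k) xss) yss = T_arr (f \<circ> k) xss yss"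
proof (induction "f \<circ> k" xss yss rule: block_map.induct)
  case (3 xs xss ys yss)
  then show ?case by (auto simp: hd_map index_map_map)
qed auto

lemma T_arr_inj: "inj h \<Longrightarrow> T_arr (h \<circ> f) xss (map (map h) yss) = T_arr f xss yss"
proof (induction f xss yss rule: block_map.induct)
  case (3 f xs xss ys yss)
  then show ?case by (auto simp: comp_def index_map_inj[unfolded comp_def] inj_image_mem_iff)
qed auto

text \<open>Functoriality of the evaluation. The outer induction follows g; where g uses the block
  ys, an inner one follows the source blocks that f sends into ys. If f has none left for ys, the
  unit that it inserts is absorbed by \<open>action_skip_unit\<close>. If it has one, the map
  induced by g is linear (\<open>action_linear\<close>), so the multiplication performed for f
  passes through it.\<close>

lemma T_arr_comp:
  "\<lbrakk>block_map f xss yss; block_map g yss zss; wf_blocks xss; wf_blocks yss; wf_blocks zss\<rbrakk>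
    \<Longrightarrow> T_arr g yss zss \<cdot> T_arr f xss yss = T_arr (g \<circ> f) xss zss"
proof (induction g yss zss arbitrary: xss rule: block_map.induct)
  case (1 g yss)
  then show ?case by simp
next
  case (2 g zs zss)
  then have "xss = []" "length zs \<ge> 1" by (auto simp: wf_blocks_Cons Suc_le_eq)
  then show ?case using 2 T_arr[of g "[]" zss] by (auto simp: wf_blocks_def)
next
  case (3 g ys yss zs zss)
  have ne: "length ys \<ge> 1" "length zs \<ge> 1" "ys \<noteq> []" "[] \<notin> set yss" "[] \<notin> set zss" "[] \<notin> set xss" "[] \<noteq> zs" "[] \<noteq> ys"
    using 3(4-) by (auto simp: wf_blocks_def Suc_le_eq)
  show ?case
  proof (cases "g (hd ys) \<in> set zs")
    case False
    have g: "block_map g (ys # yss) zss" using 3(4) False "3.prems"(2) by simp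
    \<comment> \<open>Everything in the image of f is a leaf of the source of g, and g sends these
      into the blocks of zss, which are disjoint from zs.\<close>
    have avoid: "\<forall>x \<in> set (concat xss). (g \<circ> f) x \<notin> set zs"
    proof
      fix x assume "x \<in> set (concat xss)"
      then have "f x \<in> set (concat (ys # yss))" using block_map_nodes[OF "3.prems"(1)] by blast
      then have "g (f x) \<in> set (concat zss)" using block_map_nodes[OF g] by blast
      then show "(g \<circ> f) x \<notin> set zs" using "3.prems"(5) by (auto simp: wf_blocks_Cons)
    qed
    have "T_arr g (ys # yss) zss \<cdot> T_arr f xss (ys # yss) = T_arr (g \<circ> f) xss zss"
      using 3(2)[OF False "3.prems"(1) g "3.prems"(3,4)] "3.prems"(5) by (simp add: wf_blocks_Cons comp_def)
    then show ?thesis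
      using False g ne "3.prems"(1) T_arr[OF g] T_arr[OF "3.prems"(1)]
      by (simp add: comp_def skip_comp T_arr_skip[OF avoid[unfolded comp_def]])
  next
    case True
    have g: "mono_block g ys zs" "block_map g yss (zs # zss)" using True "3.prems"(2) by auto
    note zss = "3.prems"(5)
    have yss: "wf_blocks yss" using "3.prems"(4) by (simp add: wf_blocks_Cons)
    \<comment> \<open>Here ys has been dropped from the middle list; this instance is the one used
      when f has nothing left for ys.\<close>
    note IH = 3(1)[OF True _ g(2) _ yss zss]
    let ?Z = "T (map length zss)" and ?Y = "T (map length yss)"
    let ?N = "omap M (length zs)" and ?L = "omap M (length ys)"
    let ?k = "T_arr g yss (zs # zss)" and ?g = "M_arr (index_map g ys zs)"
    note gh = index_map_hom[OF g(1) ne(3)]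
    have k [simp]: "?k \<in> Arr C" "Cod C ?k = carr ?N \<otimes> ?Z" "Dom C ?k = ?Y"
      using T_arr[OF g(2)] ne by auto
    note g_simps [simp] = M_arr_index[OF g(1) ne(3)]
    note Z [simp] = T_blocks_obj[OF ne(5)] T_blocks_obj[OF ne(4)]
    have G: "T_arr g (ys # yss) (zs # zss) = action C ?N ?Z \<cdot> (?g \<boxtimes> ?k)" using True by simp
    \<comment> \<open>Only the source of f varies from here on: ys remains the first middle block
      for as long as f uses it.\<close>
    show ?thesis using "3.prems"(1,3)
    proof (induction xss)
      case Nil
      have f: "block_map f [] yss" using Nil by simp
      have h: "T_arr f [] yss \<in> Arr C" "Cod C (T_arr f [] yss) = ?Y" "Dom C (T_arr f [] yss) = Unit C"
        using T_arr[OF f] ne by auto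
      have "T_arr g (ys # yss) (zs # zss) \<cdot> T_arr f [] (ys # yss) =
          action C ?N ?Z \<cdot> ((?g \<boxtimes> ?k) \<cdot> skip C (unit ?L) (T_arr f [] yss))"
        unfolding G using ne h by simp
      \<comment> \<open>A homomorphism of monoids preserves units, so the unit inserted for ys
        becomes the unit of the monoid of zs.\<close>
      also have "(?g \<boxtimes> ?k) \<cdot> skip C (unit ?L) (T_arr f [] yss) = skip C (unit ?N) (?k \<cdot> T_arr f [] yss)"
        using ne h M_arr_unit[OF gh] by (simp add: skip_def)
      also have "action C ?N ?Z \<cdot> \<dots> = ?k \<cdot> T_arr f [] yss"
        by (rule monoid_in.action_skip_unit[OF monoid_M[OF ne(2)]]) (use h in auto)
      also have "\<dots> = T_arr (g \<circ> f) [] (zs # zss)" by (rule IH[OF f]) simp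
      finally show ?case .
    next
      case (Cons xs xss)
      note inner = Cons.IH
      have xs: "xs \<noteq> []" "length xs \<ge> 1" "wf_blocks xss" "[] \<notin> set xss"
        using Cons.prems(2) by (auto simp: wf_blocks_def Suc_le_eq)
      show ?case
      proof (cases "f (hd xs) \<in> set ys")
        case False
        then have f: "block_map f (xs # xss) yss" using Cons.prems by simp
        let ?h = "T_arr f (xs # xss) yss"
        have h: "?h \<in> Arr C" "Cod C ?h = ?Y" "Dom C ?h = T (map length (xs # xss))"
          using T_arr[OF f] ne xs by auto
        have "T_arr g (ys # yss) (zs # zss) \<cdot> T_arr f (xs # xss) (ys # yss) =
            action C ?N ?Z \<cdot> ((?g \<boxtimes> ?k) \<cdot> skip C (unit ?L) ?h)"
          unfolding G using ne h False by simp
        also have "(?g \<boxtimes> ?k) \<cdot> skip C (unit ?L) ?h = skip C (unit ?N) (?k \<cdot> ?h)"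
          using ne h xs M_arr_unit[OF gh] by (simp add: skip_def)
        also have "action C ?N ?Z \<cdot> \<dots> = ?k \<cdot> ?h"
          by (rule monoid_in.action_skip_unit[OF monoid_M[OF ne(2)]]) (use h in auto)
        also have "\<dots> = T_arr (g \<circ> f) (xs # xss) (zs # zss)" by (rule IH[OF f Cons.prems(2)])
        finally show ?thesis .
      next
        case True
        then have f: "mono_block f xs ys" "block_map f xss (ys # yss)" using Cons.prems(1) by auto
        let ?h = "T_arr f xss (ys # yss)" and ?f = "M_arr (index_map f xs ys)"
        let ?X = "T (map length xss)"
        have h: "?h \<in> Arr C" "Cod C ?h = carr ?L \<otimes> ?Y" "Dom C ?h = ?X"
          using T_arr[OF f(2)] ne xs by auto
        note fa = M_arr_index[OF f(1) xs(1)]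
        have gf: "(g \<circ> f) (hd xs) \<in> set zs"
          using True g(1) by (auto simp: mono_block_def)
        have "T_arr g (ys # yss) (zs # zss) \<cdot> T_arr f (xs # xss) (ys # yss) =
            ((action C ?N ?Z \<cdot> (?g \<boxtimes> ?k)) \<cdot> action C ?L ?Y) \<cdot> (?f \<boxtimes> ?h)"
          unfolding G using True ne h fa by simp
        also have "(action C ?N ?Z \<cdot> (?g \<boxtimes> ?k)) \<cdot> action C ?L ?Y =
            action C ?N ?Z \<cdot> (?g \<boxtimes> (action C ?N ?Z \<cdot> (?g \<boxtimes> ?k)))"
          by (rule action_linear[OF monoid_M[OF ne(1)] monoid_M[OF ne(2)] amap_M(2)[OF gh]]) auto
        also have "\<dots> \<cdot> (?f \<boxtimes> ?h) = action C ?N ?Z \<cdot> ((?g \<cdot> ?f) \<boxtimes> (T_arr g (ys # yss) (zs # zss) \<cdot> ?h))"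
          unfolding G using ne h fa by simp
        also have "?g \<cdot> ?f = M_arr (index_map (g \<circ> f) xs zs)"
          by (simp only: index_map_comp[OF f(1) g(1), symmetric]
              M_arr_comp[OF index_map_hom[OF f(1) xs(1)] gh])
        also have "T_arr g (ys # yss) (zs # zss) \<cdot> ?h = T_arr (g \<circ> f) xss (zs # zss)"
          by (rule inner[OF f(2) xs(3)])
        finally show ?thesis using gf by (simp add: comp_def)
      qed
    qed
  qed
qed

text \<open>If the other source blocks avoid ys, the recursion inserts a unit for ys and multiplies
  one value into it; by \<open>action_tensor_skip\<close> only that value remains.\<close>

lemma T_arr_Cons:
  assumes f: "mono_block f xs ys" "block_map f xss yss" and "xs \<noteq> []" "[] \<notin> set xss" "[] \<notin> set yss"
    and avoid: "\<forall>x \<in> set (concat xss). f x \<notin> set ys"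
  shows "T_arr f (xs # xss) (ys # yss) = M_arr (index_map f xs ys) \<boxtimes> T_arr f xss yss"
proof -
  have ys: "f (hd xs) \<in> set ys" "length ys \<ge> 1"
    using assms(1,3) by (auto simp: mono_block_def Suc_le_eq)
  have "T_arr f (xs # xss) (ys # yss) = action C (omap M (length ys)) (T (map length yss)) \<cdot>
      (M_arr (index_map f xs ys) \<boxtimes> skip C (unit (omap M (length ys))) (T_arr f xss yss))"
    using ys by (simp add: T_arr_skip[OF avoid assms(4)])
  also have "\<dots> = M_arr (index_map f xs ys) \<boxtimes> T_arr f xss yss"
    by (rule monoid_in.action_tensor_skip[OF monoid_M[OF ys(2)]])
      (use M_arr_index[OF f(1) assms(3)] T_arr[OF f(2)] assms(4,5) in auto)
  finally show ?thesis .
qed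

text \<open>Renaming leaves is invisible to the evaluation. In particular rigid arrows, among them
  the constraints of the category of trees, are sent to identities.\<close>

lemma T_arr_bij:
  "wf_blocks (map (map f) xss) \<Longrightarrow> block_map f xss (map (map f) xss) \<and>
    T_arr f xss (map (map f) xss) = Ident C (T (map length xss))"
proof (induction xss)
  case (Cons xs xss)
  have xs: "distinct (map f xs)" "xs \<noteq> []" "[] \<notin> set xss" "wf_blocks (map (map f) xss)" "length xs \<ge> 1"
    and avoid: "\<forall>x \<in> set (concat xss). f x \<notin> set (map f xs)"
    using Cons.prems by (auto simp: wf_blocks_def Suc_le_eq)
  note IH = Cons.IH[OF xs(4)]
  have "block_map f (xs # xss) (map (map f) (xs # xss))"
    using xs index_map_bij(1)[OF xs(1)] IH block_map_skip[OF avoid xs(3)] by simp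
  moreover have "T_arr f (xs # xss) (map (map f) (xs # xss)) = Ident C (T (map length (xs # xss)))"
    using T_arr_Cons[OF index_map_bij(1)[OF xs(1)] conjunct1[OF IH] xs(2,3) _ avoid] xs IH
      index_map_bij(2)[OF xs(1)] M_arr_ident[OF xs(5)] by (auto simp del: Delta_simps)
  ultimately show ?case ..
qed simp

section \<open>Structure maps of the tensor functor\<close>

lemma T_mult_iso:
  "\<lbrakk>\<forall>n \<in> set ns. n \<ge> 1; \<forall>m \<in> set ms. m \<ge> 1\<rbrakk> \<Longrightarrow> T_mult ns ms \<in> isos C (T ns \<otimes> T ms) (T (ns @ ms))"
proof (induction ns)
  case (Cons n ns)
  then show ?case by (auto intro!: comp_iso[OF assoc_iso] tensor_ident_iso)
qed (auto intro: lunit_iso)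

lemma T_mult_arr [simp]:
  assumes "\<forall>n \<in> set ns. n \<ge> 1" "\<forall>m \<in> set ms. m \<ge> 1"
  shows "T_mult ns ms \<in> Arr C" "Dom C (T_mult ns ms) = T ns \<otimes> T ms" "Cod C (T_mult ns ms) = T (ns @ ms)"
  using T_mult_iso[OF assms] by auto

text \<open>Concatenation of lists is strictly associative, so the only associator is that of C.
  Each factor of the first list costs one pentagon; the empty list is
  \<open>lunit_tensor\<close>.\<close>

lemma T_mult_assoc:
  "\<lbrakk>\<forall>n \<in> set ns. n \<ge> 1; \<forall>m \<in> set ms. m \<ge> 1; \<forall>l \<in> set ls. l \<ge> 1\<rbrakk>
    \<Longrightarrow> T_mult (ns @ ms) ls \<cdot> (T_mult ns ms \<boxtimes> Ident C (T ls)) =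
      T_mult ns (ms @ ls) \<cdot> (Ident C (T ns) \<boxtimes> T_mult ms ls) \<cdot> Assoc C (T ns) (T ms) (T ls)"
proof (induction ns)
  case Nil
  then have [simp]: "T ms \<in> Obj C" "T ls \<in> Obj C" by simp_all
  have "T_mult ms ls \<cdot> (LUnit C (T ms) \<boxtimes> Ident C (T ls)) =
      (T_mult ms ls \<cdot> LUnit C (T ms \<otimes> T ls)) \<cdot> Assoc C (Unit C) (T ms) (T ls)"
    using Nil by (simp flip: lunit_tensor)
  also have "T_mult ms ls \<cdot> LUnit C (T ms \<otimes> T ls) =
      LUnit C (T (ms @ ls)) \<cdot> (Ident C (Unit C) \<boxtimes> T_mult ms ls)"
    using Nil by (subst lunit_natural_arr) auto
  finally show ?case by simp
next
  case (Cons n ns)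
  let ?a = "carr (omap M n)"
  let ?one = "Ident C ?a"
  have pos: "\<forall>n \<in> set ns. n \<ge> 1" "\<forall>m \<in> set ms. m \<ge> 1" "\<forall>l \<in> set ls. l \<ge> 1"
    "\<forall>m \<in> set (ns @ ms). m \<ge> 1" "\<forall>m \<in> set (ms @ ls). m \<ge> 1" using Cons.prems by auto
  have [simp]: "?a \<in> Obj C" "T ns \<in> Obj C" "T ms \<in> Obj C" "T ls \<in> Obj C" "T (ns @ ms) \<in> Obj C" "T (ms @ ls) \<in> Obj C"
    using pos Cons.prems by auto
  note [simp] = T_mult_arr[OF pos(1,2)] T_mult_arr[OF pos(2,3)] T_mult_arr[OF pos(4,3)] T_mult_arr[OF pos(1,5)]
  have "T_mult ((n # ns) @ ms) ls \<cdot> (T_mult (n # ns) ms \<boxtimes> Ident C (T ls)) =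
      (?one \<boxtimes> T_mult (ns @ ms) ls) \<cdot> (Assoc C ?a (T (ns @ ms)) (T ls) \<cdot>
        (((?one \<boxtimes> T_mult ns ms) \<boxtimes> Ident C (T ls)) \<cdot> (Assoc C ?a (T ns) (T ms) \<boxtimes> Ident C (T ls))))"
    by simp
  also have "\<dots> = (?one \<boxtimes> T_mult (ns @ ms) ls) \<cdot> ((?one \<boxtimes> (T_mult ns ms \<boxtimes> Ident C (T ls))) \<cdot>
        (Assoc C ?a (T ns \<otimes> T ms) (T ls) \<cdot> (Assoc C ?a (T ns) (T ms) \<boxtimes> Ident C (T ls))))"
    by (subst assoc_natural_arr2) auto
  also have "\<dots> = (?one \<boxtimes> (T_mult (ns @ ms) ls \<cdot> (T_mult ns ms \<boxtimes> Ident C (T ls)))) \<cdot>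
        (Assoc C ?a (T ns \<otimes> T ms) (T ls) \<cdot> (Assoc C ?a (T ns) (T ms) \<boxtimes> Ident C (T ls)))"
    by simp
  also have "\<dots> = (?one \<boxtimes> (T_mult ns (ms @ ls) \<cdot> (Ident C (T ns) \<boxtimes> T_mult ms ls))) \<cdot>
      ((?one \<boxtimes> Assoc C (T ns) (T ms) (T ls)) \<cdot> Assoc C ?a (T ns \<otimes> T ms) (T ls) \<cdot>
        (Assoc C ?a (T ns) (T ms) \<boxtimes> Ident C (T ls)))"
    using Cons.IH pos by simp
  also have "\<dots> = (?one \<boxtimes> T_mult ns (ms @ ls)) \<cdot> ((?one \<boxtimes> (Ident C (T ns) \<boxtimes> T_mult ms ls)) \<cdot>
      (Assoc C ?a (T ns) (T ms \<otimes> T ls) \<cdot> Assoc C (?a \<otimes> T ns) (T ms) (T ls)))"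
    by (subst pentagon[symmetric]) auto
  also have "\<dots> = (?one \<boxtimes> T_mult ns (ms @ ls)) \<cdot> (Assoc C ?a (T ns) (T (ms @ ls)) \<cdot>
      (((?one \<boxtimes> Ident C (T ns)) \<boxtimes> T_mult ms ls) \<cdot> Assoc C (?a \<otimes> T ns) (T ms) (T ls)))"
    by (subst assoc_natural_arr2) auto
  also have "\<dots> = T_mult (n # ns) (ms @ ls) \<cdot> (Ident C (T (n # ns)) \<boxtimes> T_mult ms ls) \<cdot>
      Assoc C (T (n # ns)) (T ms) (T ls)"
    by simp
  finally show ?case .
qed

text \<open>The empty list is the coincidence of the two unitors at I, each further factor is
  \<open>runit_tensor\<close>.\<close>

lemma T_mult_runit: "\<forall>n \<in> set ns. n \<ge> 1 \<Longrightarrow> T_mult ns [] = RUnit C (T ns)"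
  by (induction ns) (auto simp: lunit_unit_eq_runit_unit runit_tensor)

text \<open>Naturality of \<open>T_mult\<close>. One function h serves both parts; as the target
  blocks are disjoint, the blocks of zss never reach yss, so the recursion works through xss and yss
  as if zss were absent, and each of its steps commutes with a step of \<open>T_mult\<close> by
  \<open>skip_tensor\<close> or \<open>action_tensor\<close>. That h is a block map of the
  concatenations is carried along because the typing of the middle arrows depends on it.\<close>

lemma T_arr_tensor:
  "\<lbrakk>block_map h xss yss; block_map h zss wss; wf_blocks xss; wf_blocks zss; wf_blocks (yss @ wss)\<rbrakk>
    \<Longrightarrow> block_map h (xss @ zss) (yss @ wss) \<and>
      T_arr h (xss @ zss) (yss @ wss) \<cdot> T_mult (map length xss) (map length zss) =
      T_mult (map length yss) (map length wss) \<cdot> (T_arr h xss yss \<boxtimes> T_arr h zss wss)"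
proof (induction h xss yss rule: block_map.induct)
  case (1 h xss)
  then show ?case using T_arr[of h zss wss] by (auto simp: wf_blocks_def lunit_natural_arr)
next
  case (2 h ys yss)
  have wf: "wf_blocks (yss @ wss)" "ys \<noteq> []" "length ys \<ge> 1" "set ys \<inter> set (concat wss) = {}"
    "[] \<notin> set zss" "[] \<notin> set yss" "[] \<notin> set wss"
    using 2(4-) by (auto simp: wf_blocks_def Suc_le_eq)
  \<comment> \<open>The blocks of zss go into wss, which is disjoint from ys; so the unit for ys is
    inserted in front of all of them.\<close>
  have avoid: "\<forall>x \<in> set (concat zss). h x \<notin> set ys"
    using block_map_nodes[OF 2(3)] wf(4) by blast
  have b: "block_map h [] yss" using 2(2) by simp
  have pos: "\<forall>n \<in> set (map length zss). n \<ge> 1" "\<forall>n \<in> set (map length yss). n \<ge> 1"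
    "\<forall>n \<in> set (map length wss). n \<ge> 1" using wf by (auto simp: Suc_le_eq)
  note IH = 2(1)[OF b 2(3,4,5) wf(1)]
  have bm: "block_map h zss (yss @ wss)" using IH by simp
  have t [simp]: "T_arr h zss (yss @ wss) \<in> Arr C" "Dom C (T_arr h zss (yss @ wss)) = T (map length zss)"
    "Cod C (T_arr h zss (yss @ wss)) = T (map length yss @ map length wss)"
    using T_arr[OF bm] wf by auto
  have t2 [simp]: "T_arr h [] yss \<in> Arr C" "Dom C (T_arr h [] yss) = Unit C"
    "Cod C (T_arr h [] yss) = T (map length yss)" using T_arr[OF b] wf by auto
  have t3 [simp]: "T_arr h zss wss \<in> Arr C" "Dom C (T_arr h zss wss) = T (map length zss)"
    "Cod C (T_arr h zss wss) = T (map length wss)" using T_arr[OF 2(3)] wf by auto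
  note [simp] = T_obj[OF pos(1)] T_obj[OF pos(2)] T_obj[OF pos(3)] T_mult_arr[OF pos(2,3)]
  have "T_arr h ([] @ zss) ((ys # yss) @ wss) \<cdot> T_mult (map length []) (map length zss) =
      skip C (unit (omap M (length ys))) (T_arr h zss (yss @ wss) \<cdot> LUnit C (T (map length zss)))"
    using wf by (simp add: T_arr_skip[OF avoid] skip_comp)
  also have "T_arr h zss (yss @ wss) \<cdot> LUnit C (T (map length zss)) =
      T_mult (map length yss) (map length wss) \<cdot> (T_arr h [] yss \<boxtimes> T_arr h zss wss)"
    using IH by simp
  also have "skip C (unit (omap M (length ys))) \<dots> =
      ((Ident C (carr (omap M (length ys))) \<boxtimes> T_mult (map length yss) (map length wss)) \<cdot>
        Assoc C (carr (omap M (length ys))) (T (map length yss)) (T (map length wss))) \<cdot>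
      (skip C (unit (omap M (length ys))) (T_arr h [] yss) \<boxtimes> T_arr h zss wss)"
    by (rule skip_tensor[symmetric]) (use wf in auto)
  finally show ?case using bm block_map_skip[OF avoid wf(5)] by simp
next
  case (3 h xs xss ys yss)
  have wf: "wf_blocks (yss @ wss)" "ys \<noteq> []" "length ys \<ge> 1" "set ys \<inter> set (concat wss) = {}"
    "[] \<notin> set zss" "[] \<notin> set yss" "[] \<notin> set wss" "[] \<notin> set xss" "xs \<noteq> []" "length xs \<ge> 1" "wf_blocks xss"
    using 3(4-) by (auto simp: wf_blocks_def Suc_le_eq)
  have pos: "\<forall>n \<in> set (map length zss). n \<ge> 1" "\<forall>n \<in> set (map length yss). n \<ge> 1"
    "\<forall>n \<in> set (map length wss). n \<ge> 1" "\<forall>n \<in> set (map length xss). n \<ge> 1"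
    using wf by (auto simp: Suc_le_eq)
  have t3 [simp]: "T_arr h zss wss \<in> Arr C" "Dom C (T_arr h zss wss) = T (map length zss)"
    "Cod C (T_arr h zss wss) = T (map length wss)" using T_arr[OF 3(4)] wf by auto
  have carr [simp]: "carr (omap M (length ys)) \<in> Obj C" "carr (omap M (length xs)) \<in> Obj C" using wf by auto
  note [simp] = T_obj[OF pos(1)] T_obj[OF pos(2)] T_obj[OF pos(3)] T_obj[OF pos(4)]
    T_mult_arr[OF pos(2,3)] T_mult_arr[OF pos(4,1)]
  let ?u = "unit (omap M (length ys))"
  let ?\<Phi> = "T_mult (map length yss) (map length wss)"
  let ?\<Phi>' = "(Ident C (carr (omap M (length ys))) \<boxtimes> ?\<Phi>) \<cdot>
        Assoc C (carr (omap M (length ys))) (T (map length yss)) (T (map length wss))"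
  have app: "T (map length yss @ map length wss) \<in> Obj C" using pos by (intro T_obj) auto
  show ?case
  proof (cases "h (hd xs) \<in> set ys")
    case False
    have b: "block_map h (xs # xss) yss" using 3(3) False by simp
    note IH = 3(2)[OF False b 3(4-6) wf(1)]
    have bm: "block_map h (xs # xss @ zss) (yss @ wss)" using IH by simp
    have t [simp]: "T_arr h (xs # xss @ zss) (yss @ wss) \<in> Arr C"
      "Dom C (T_arr h (xs # xss @ zss) (yss @ wss)) =
        carr (omap M (length xs)) \<otimes> T (map length xss @ map length zss)"
      using T_arr[OF bm] wf by auto
    have t2 [simp]: "T_arr h (xs # xss) yss \<in> Arr C" "Cod C (T_arr h (xs # xss) yss) = T (map length yss)"
      using T_arr[OF b] wf by auto
    have "T_arr h ((xs # xss) @ zss) ((ys # yss) @ wss) \<cdot> T_mult (map length (xs # xss)) (map length zss) =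
        skip C ?u (T_arr h ((xs # xss) @ zss) (yss @ wss) \<cdot> T_mult (map length (xs # xss)) (map length zss))"
      using False wf by (simp add: skip_comp)
    also have "T_arr h ((xs # xss) @ zss) (yss @ wss) \<cdot> T_mult (map length (xs # xss)) (map length zss) =
        ?\<Phi> \<cdot> (T_arr h (xs # xss) yss \<boxtimes> T_arr h zss wss)" using IH by simp
    also have "skip C ?u \<dots> = ?\<Phi>' \<cdot> (skip C ?u (T_arr h (xs # xss) yss) \<boxtimes> T_arr h zss wss)"
      by (rule skip_tensor[symmetric]) (use wf in auto)
    finally show ?thesis using bm False by simp
  next
    case True
    have b: "mono_block h xs ys" "block_map h xss (ys # yss)" using 3(3) True by auto
    note IH = 3(1)[OF True b(2) 3(4) wf(11) 3(6,7)]
    have bm: "block_map h (xss @ zss) (ys # yss @ wss)" using IH by simp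
    let ?k = "M_arr (index_map h xs ys)" and ?N = "omap M (length ys)"
    let ?c = "carr (omap M (length xs))"
    note [simp] = M_arr_index[OF b(1) wf(9)]
    have t [simp]: "T_arr h (xss @ zss) (ys # yss @ wss) \<in> Arr C"
      "Dom C (T_arr h (xss @ zss) (ys # yss @ wss)) = T (map length xss @ map length zss)"
      "Cod C (T_arr h (xss @ zss) (ys # yss @ wss)) = carr ?N \<otimes> T (map length yss @ map length wss)"
      using T_arr[OF bm] wf by auto
    have t2 [simp]: "T_arr h xss (ys # yss) \<in> Arr C" "Dom C (T_arr h xss (ys # yss)) = T (map length xss)"
      "Cod C (T_arr h xss (ys # yss)) = carr ?N \<otimes> T (map length yss)"
      using T_arr[OF b(2)] wf by auto
    have "T_arr h ((xs # xss) @ zss) ((ys # yss) @ wss) \<cdot> T_mult (map length (xs # xss)) (map length zss) =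
        action C ?N (T (map length yss @ map length wss)) \<cdot>
          (?k \<boxtimes> (T_arr h (xss @ zss) (ys # yss @ wss) \<cdot> T_mult (map length xss) (map length zss))) \<cdot>
          Assoc C ?c (T (map length xss)) (T (map length zss))"
      using True wf app by simp
    also have "T_arr h (xss @ zss) (ys # yss @ wss) \<cdot> T_mult (map length xss) (map length zss) =
        ?\<Phi>' \<cdot> (T_arr h xss (ys # yss) \<boxtimes> T_arr h zss wss)" using IH by simp
    also have "action C ?N (T (map length yss @ map length wss)) \<cdot> (?k \<boxtimes> \<dots>) \<cdot>
        Assoc C ?c (T (map length xss)) (T (map length zss)) =
      ?\<Phi>' \<cdot> ((action C ?N (T (map length yss)) \<cdot> (?k \<boxtimes> T_arr h xss (ys # yss))) \<boxtimes> T_arr h zss wss)"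
      using monoid_in.action_tensor[OF monoid_M[OF wf(3)], of "T_arr h xss (ys # yss)" "T (map length yss)"
          ?k "T_arr h zss wss" "T (map length wss)" ?\<Phi> "T (map length yss @ map length wss)"] by simp
    finally show ?thesis using bm b True by simp
  qed
qed

end

section \<open>Removal of tags, and the tensor functor as a monoidal functor\<close>

lemma mono_block_map: "mono_block f (map k xs) ys = mono_block (f \<circ> k) xs ys"
  by (auto simp: mono_block_def)

lemma mono_block_inj: "inj h \<Longrightarrow> mono_block (h \<circ> f) xs (map h ys) = mono_block f xs ys"
  by (simp add: mono_block_def pos_map image_subset_iff inj_image_mem_iff)

lemma block_map_map: "[] \<notin> set xss \<Longrightarrow> block_map f (map (map k) xss) yss = block_map (f \<circ> k) xss yss"
proof (induction "f \<circ> k" xss yss rule: block_map.induct)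
  case (3 xs xss ys yss)
  then show ?case by (auto simp: hd_map mono_block_map)
qed auto

lemma block_map_inj: "inj h \<Longrightarrow> block_map (h \<circ> f) xss (map (map h) yss) = block_map f xss yss"
proof (induction f xss yss rule: block_map.induct)
  case (3 f xs xss ys yss)
  then show ?case by (auto simp: comp_def mono_block_inj[unfolded comp_def] inj_image_mem_iff)
qed auto

lemma inj_inl_inr: "inj inl" "inj inr"
  by (auto simp: inj_def)

definition tensor_functor ::
  "('o, 'a) moncat \<Rightarrow> ('o, 'a) cosimplicial \<Rightarrow> (tree, tree_arrow, 'o, 'a) monfctr" where
  "tensor_functor C M =
    \<lparr>omap = (\<lambda>t \<in> pruned_trees. tensor_obj C M (shape t)),
     amap = (\<lambda>F \<in> Arr Omega2. tensor_arr C M (leaf F) (fibs (source F)) (fibs (target F))),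
     Fmult = (\<lambda>(s, t) \<in> pruned_trees \<times> pruned_trees. tensor_mult C M (shape s) (shape t)),
     Funit = Ident C (Unit C)\<rparr>"

lemma Omega2_homD:
  "F \<in> hom Omega2 s t \<Longrightarrow> F \<in> Arr Omega2 \<and> source F = s \<and> target F = t"
  by (cases F) (auto simp: hom_Omega2 Omega2_hom_cat_simps(6))

lemma tensor_functor_simps:
  "t \<in> pruned_trees \<Longrightarrow> omap (tensor_functor C M) t = tensor_obj C M (shape t)"
  "F \<in> hom Omega2 s t \<Longrightarrow> amap (tensor_functor C M) F = tensor_arr C M (leaf F) (fibs s) (fibs t)"
  "\<lbrakk>s \<in> pruned_trees; t \<in> pruned_trees\<rbrakk> \<Longrightarrow>
    Fmult (tensor_functor C M) (s, t) = tensor_mult C M (shape s) (shape t)"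
  "Funit (tensor_functor C M) = Ident C (Unit C)"
proof -
  show "F \<in> hom Omega2 s t \<Longrightarrow> amap (tensor_functor C M) F = tensor_arr C M (leaf F) (fibs s) (fibs t)"
    by (drule Omega2_homD) (simp add: tensor_functor_def)
qed (simp_all add: tensor_functor_def)

context cosimplicial_monoid
begin

lemma T_arr_fibs:
  assumes "F \<in> hom Omega2 s t"
  shows "T_arr (leaf F) (fibs s) (fibs t) \<in> hom C (T (shape s)) (T (shape t))"
  using T_arr[OF block_map_fibs[OF assms]] wf_blocks_fibs(1)[OF hom_pruned(1)[OF assms]]
    wf_blocks_fibs(1)[OF hom_pruned(2)[OF assms]]
  by (intro homI) (auto simp: wf_blocks_def)

lemma T_shape [simp]: "t \<in> pruned_trees \<Longrightarrow> T (shape t) \<in> Obj C"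
  using shape_positive T_obj by blast

lemma T_arr_rigid:
  assumes "rigid s t F"
  shows "T_arr (leaf F) (fibs s) (fibs t) = Ident C (T (shape s))"
proof -
  have F: "map (map (leaf F)) (fibs s) = fibs t" using assms by (simp add: rigid_def)
  have "wf_blocks (fibs t)" by (rule wf_blocks_fibs(1)[OF hom_pruned(2)[OF rigid_hom[OF assms]]])
  then show ?thesis using T_arr_bij[of "leaf F" "fibs s"] by (simp only: F)
qed

lemma T_arr_fibs_cong:
  assumes "s \<in> pruned_trees" "\<And>x. x \<in> nodes2 s \<Longrightarrow> f x = g x"
  shows "T_arr f (fibs s) yss = T_arr g (fibs s) yss" "block_map f (fibs s) yss = block_map g (fibs s) yss"
proof -
  have fib: "f x = g x" if "x \<in> set (concat (fibs s))" for x
    using that assms(2) by (simp only: wf_blocks_fibs(2)[OF assms(1)])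
  have ne: "[] \<notin> set (fibs s)" using wf_blocks_fibs(1)[OF assms(1)] by (simp add: wf_blocks_def)
  show "T_arr f (fibs s) yss = T_arr g (fibs s) yss" using fib ne by (rule T_arr_cong)
  show "block_map f (fibs s) yss = block_map g (fibs s) yss" using fib ne by (rule block_map_cong)
qed

text \<open>\<open>T_arr_tensor\<close> speaks of one function on tagged blocks. On each half the
  tensored arrow is the original one followed by a tag: \<open>T_arr_map\<close> removes the tag
  from the source blocks and \<open>T_arr_inj\<close> from the target blocks.\<close>

lemma T_arr_fibs_tensor:
  assumes F: "F \<in> hom Omega2 s s'" and G: "G \<in> hom Omega2 t t'"
  shows "T_arr (leaf (F \<boxtimes>\<^bsub>Omega2\<^esub> G)) (fibs (tree_sum s t)) (fibs (tree_sum s' t')) \<cdot> T_mult (shape s) (shape t) =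
    T_mult (shape s') (shape t') \<cdot> (T_arr (leaf F) (fibs s) (fibs s') \<boxtimes> T_arr (leaf G) (fibs t) (fibs t'))"
proof -
  note P = hom_pruned[OF F] hom_pruned[OF G]
  note wf = wf_blocks_fibs(1)[OF P(1)] wf_blocks_fibs(1)[OF P(2)] wf_blocks_fibs(1)[OF P(3)]
    wf_blocks_fibs(1)[OF P(4)] wf_blocks_fibs(1)[OF tree_sum_pruned[OF P(2,4)]]
    wf_blocks_fibs(1)[OF tree_sum_pruned[OF P(1,3)]]
  have ne: "[] \<notin> set (fibs s)" "[] \<notin> set (fibs t)" using wf by (auto simp: wf_blocks_def)
  let ?h = "leaf (F \<boxtimes>\<^bsub>Omega2\<^esub> G)"
  let ?X = "map (map inl) (fibs s)" and ?Y = "map (map inl) (fibs s')"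
    and ?Z = "map (map inr) (fibs t)" and ?W = "map (map inr) (fibs t')"
  have hl: "(?h \<circ> inl) x = (inl \<circ> leaf F) x" if "x \<in> nodes2 s" for x
    using leaf_tensor(1)[OF F G that] by simp
  have hr: "(?h \<circ> inr) x = (inr \<circ> leaf G) x" if "x \<in> nodes2 t" for x
    using leaf_tensor(2)[OF F G that] by simp
  have b: "block_map ?h ?X ?Y" "block_map ?h ?Z ?W"
    using T_arr_fibs_cong(2)[where f = "?h \<circ> inl" and g = "inl \<circ> leaf F", OF P(1) hl, where yss = ?Y] T_arr_fibs_cong(2)[where f = "?h \<circ> inr" and g = "inr \<circ> leaf G", OF P(3) hr, where yss = ?W]
      block_map_fibs[OF F] block_map_fibs[OF G]
    by (simp_all only: block_map_map[OF ne(1)] block_map_map[OF ne(2)] block_map_inj[OF inj_inl_inr(1)]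
        block_map_inj[OF inj_inl_inr(2)])
  have t: "T_arr ?h ?X ?Y = T_arr (leaf F) (fibs s) (fibs s')" "T_arr ?h ?Z ?W = T_arr (leaf G) (fibs t) (fibs t')"
    using T_arr_fibs_cong(1)[where f = "?h \<circ> inl" and g = "inl \<circ> leaf F", OF P(1) hl, where yss = ?Y] T_arr_fibs_cong(1)[where f = "?h \<circ> inr" and g = "inr \<circ> leaf G", OF P(3) hr, where yss = ?W]
    by (simp_all only: T_arr_map[OF ne(1)] T_arr_map[OF ne(2)] T_arr_inj[OF inj_inl_inr(1)]
        T_arr_inj[OF inj_inl_inr(2)])
  have lens: "map length ?X = shape s" "map length ?Y = shape s'" "map length ?Z = shape t" "map length ?W = shape t'"
    by (simp_all add: comp_def)
  have "wf_blocks ?X" "wf_blocks ?Z" "wf_blocks (?Y @ ?W)"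
    using wf(5,6) unfolding fibs_tree_sum[OF P(1,3)] fibs_tree_sum[OF P(2,4)]
    by (auto simp: wf_blocks_def)
  from T_arr_tensor[OF b this] show ?thesis
    unfolding fibs_tree_sum[OF P(1,3)] fibs_tree_sum[OF P(2,4)] lens t by simp
qed

lemma tensor_functor_monoidal: "monoidal_functor Omega2 C (tensor_functor C M)"
proof -
  let ?K = "tensor_functor C M"
  note ts = tensor_functor_simps[where C = C and M = M]
  interpret K: category_functor Omega2 C ?K
  proof
    show "omap ?K \<in> extensional (Obj Omega2)" "amap ?K \<in> extensional (Arr Omega2)"
      by (simp_all add: tensor_functor_def)
    show "omap ?K t \<in> Obj C" if "t \<in> Obj Omega2" for t using that by (simp add: ts(1))
    show "amap ?K (Ident Omega2 t) = Ident C (omap ?K t)" if "t \<in> Obj Omega2" for t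
    proof -
      have t: "t \<in> pruned_trees" using that by simp
      show ?thesis
        unfolding ts(1)[OF t] ts(2)[OF ident_tree_hom[OF t]] by (rule T_arr_rigid[OF rigid_ident[OF t]])
    qed
    fix F G s t u
    assume F: "F \<in> hom Omega2 s t"
    note P = hom_pruned[OF F]
    show "amap ?K F \<in> hom C (omap ?K s) (omap ?K t)"
      unfolding ts(1)[OF P(1)] ts(1)[OF P(2)] ts(2)[OF F] by (rule T_arr_fibs[OF F])
    assume G: "G \<in> hom Omega2 t u"
    note GF = Omega2.comp_hom[OF F G]
    have "T_arr (leaf G) (fibs t) (fibs u) \<cdot> T_arr (leaf F) (fibs s) (fibs t) =
        T_arr (leaf G \<circ> leaf F) (fibs s) (fibs u)"
      by (rule T_arr_comp[OF block_map_fibs[OF F] block_map_fibs[OF G]])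
        (rule wf_blocks_fibs(1) P hom_pruned[OF G])+
    also have "\<dots> = T_arr (leaf (G \<cdot>\<^bsub>Omega2\<^esub> F)) (fibs s) (fibs u)"
      by (rule T_arr_fibs_cong(1)[OF P(1)]) (simp add: leaf_comp[OF F])
    finally show "amap ?K (G \<cdot>\<^bsub>Omega2\<^esub> F) = amap ?K G \<cdot> amap ?K F"
      unfolding ts(2)[OF F] ts(2)[OF G] ts(2)[OF GF] by simp
  qed
  show ?thesis
  proof (unfold_locales, unfold Omega2_hom_cat_simps(1) Omega2_tensor_simps(1,2))
    show "Fmult ?K \<in> extensional (pruned_trees \<times> pruned_trees)" by (simp add: tensor_functor_def)
    show "Funit ?K \<in> isos C (Unit C) (omap ?K empty_tree)"
      by (simp add: ts ident_iso)
  next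
    fix s t u
    assume s [simp]: "s \<in> pruned_trees"
    note pos = shape_positive[OF s]
    \<comment> \<open>The unitors of trees are rigid, so their images are identities and the unit
      laws become statements about \<open>T_mult\<close>; the same happens with the associator
      further down.\<close>
    have "amap ?K (LUnit Omega2 s) = Ident C (T (shape s))" "amap ?K (RUnit Omega2 s) = Ident C (T (shape s))"
      using T_arr_rigid[OF rigid_unit(1)[OF s]] T_arr_rigid[OF rigid_unit(2)[OF s]]
      unfolding ts(2)[OF tree_lunit_hom[OF s]] ts(2)[OF tree_runit_hom[OF s]]
      by (simp_all add: shape_tree_sum)
    then show "amap ?K (LUnit Omega2 s) \<cdot> Fmult ?K (empty_tree, s) \<cdot> (Funit ?K \<boxtimes> Ident C (omap ?K s)) =
        LUnit C (omap ?K s)"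
      "amap ?K (RUnit Omega2 s) \<cdot> Fmult ?K (s, empty_tree) \<cdot> (Ident C (omap ?K s) \<boxtimes> Funit ?K) =
        RUnit C (omap ?K s)"
      using T_mult_runit[OF pos] by (simp_all add: ts)
    assume t [simp]: "t \<in> pruned_trees"
    show "Fmult ?K (s, t) \<in> isos C (omap ?K s \<otimes> omap ?K t) (omap ?K (tree_sum s t))"
      using T_mult_iso[OF pos shape_positive[OF t]] by (simp add: ts shape_tree_sum)
    assume u [simp]: "u \<in> pruned_trees"
    have pos': "\<forall>n \<in> set (shape s @ shape t). n \<ge> 1"
      using pos shape_positive[OF t] by auto
    have "amap ?K (Assoc Omega2 s t u) = Ident C (T (shape s @ shape t @ shape u))"
      using T_arr_rigid[OF rigid_assoc[OF s t u]]
      unfolding ts(2)[OF tree_assoc_hom[OF s t u]]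
      by (simp add: shape_tree_sum)
    then have "amap ?K (Assoc Omega2 s t u) \<cdot> Fmult ?K (tree_sum s t, u) \<cdot> (Fmult ?K (s, t) \<boxtimes> Ident C (omap ?K u)) =
      T_mult (shape s @ shape t) (shape u) \<cdot> (T_mult (shape s) (shape t) \<boxtimes> Ident C (T (shape u)))"
      using pos' shape_positive[OF u] by (simp add: ts shape_tree_sum)
    also have "\<dots> = Fmult ?K (s, tree_sum t u) \<cdot> (Ident C (omap ?K s) \<boxtimes> Fmult ?K (t, u)) \<cdot>
            Assoc C (omap ?K s) (omap ?K t) (omap ?K u)"
      using T_mult_assoc[OF pos shape_positive[OF t] shape_positive[OF u]]
      by (simp add: ts shape_tree_sum)
    finally show "amap ?K (Assoc Omega2 s t u) \<cdot> Fmult ?K (tree_sum s t, u) \<cdot> (Fmult ?K (s, t) \<boxtimes> Ident C (omap ?K u)) =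
      Fmult ?K (s, tree_sum t u) \<cdot> (Ident C (omap ?K s) \<boxtimes> Fmult ?K (t, u)) \<cdot>
            Assoc C (omap ?K s) (omap ?K t) (omap ?K u)" .
  next
    fix F G s s' t t'
    assume F: "F \<in> hom Omega2 s s'" and G: "G \<in> hom Omega2 t t'"
    show "Fmult ?K (s', t') \<cdot> (amap ?K F \<boxtimes> amap ?K G) = amap ?K (F \<boxtimes>\<^bsub>Omega2\<^esub> G) \<cdot> Fmult ?K (s, t)"
      using T_arr_fibs_tensor[OF F G] hom_pruned[OF F] hom_pruned[OF G]
      unfolding ts(2)[OF F] ts(2)[OF G] ts(2)[OF tensor_tree_hom[OF F G]] by (simp add: ts)
  qed
qed

end

section \<open>Monoidal transformations induced by maps of cosimplicial monoids\<close>

fun tensor_nat :: "('o, 'a) moncat \<Rightarrow> (nat \<Rightarrow> (('o, 'a) mon, 'a) arrow) \<Rightarrow> nat list \<Rightarrow> 'a" where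
  "tensor_nat C \<alpha> [] = Ident C (Unit C)"
| "tensor_nat C \<alpha> (n # ns) = underlying (\<alpha> n) \<boxtimes>\<^bsub>C\<^esub> tensor_nat C \<alpha> ns"

text \<open>Free modules are functorial in the monoid and in the generating object at once. In
  contrast to \<open>action_linear\<close>, k sends generators to generators and not into the
  module.\<close>

lemma action_hom:
  assumes "monoid_in C M" "monoid_in C N" and g: "g \<in> monoid_homs C M N"
    and k: "k \<in> Arr C" "Cod C k = z" "Dom C k = y"
  shows "(g \<boxtimes>\<^bsub>C\<^esub> k) \<cdot>\<^bsub>C\<^esub> action C M y = action C N z \<cdot>\<^bsub>C\<^esub> (g \<boxtimes>\<^bsub>C\<^esub> (g \<boxtimes>\<^bsub>C\<^esub> k))"
proof -
  interpret M: monoid_in C M by fact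
  interpret N: monoid_in C N by fact
  have g': "g \<in> hom C (carr M) (carr N)" "g \<cdot>\<^bsub>C\<^esub> mult M = mult N \<cdot>\<^bsub>C\<^esub> (g \<boxtimes>\<^bsub>C\<^esub> g)"
    using g by (auto simp: monoid_homs_def)
  have [simp]: "y \<in> Obj C" "z \<in> Obj C" using k by auto
  have "(g \<boxtimes>\<^bsub>C\<^esub> k) \<cdot>\<^bsub>C\<^esub> action C M y = ((g \<cdot>\<^bsub>C\<^esub> mult M) \<boxtimes>\<^bsub>C\<^esub> k) \<cdot>\<^bsub>C\<^esub> M.AInv (carr M) (carr M) y"
    using g'(1) k by (simp add: action_def)
  also have "\<dots> = (mult N \<boxtimes>\<^bsub>C\<^esub> Ident C z) \<cdot>\<^bsub>C\<^esub> (((g \<boxtimes>\<^bsub>C\<^esub> g) \<boxtimes>\<^bsub>C\<^esub> k) \<cdot>\<^bsub>C\<^esub> M.AInv (carr M) (carr M) y)"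
    unfolding g'(2) using g'(1) k by simp
  also have "((g \<boxtimes>\<^bsub>C\<^esub> g) \<boxtimes>\<^bsub>C\<^esub> k) \<cdot>\<^bsub>C\<^esub> M.AInv (carr M) (carr M) y =
      M.AInv (carr N) (carr N) z \<cdot>\<^bsub>C\<^esub> (g \<boxtimes>\<^bsub>C\<^esub> (g \<boxtimes>\<^bsub>C\<^esub> k))"
    using g'(1) k by (subst M.inverse_assoc_natural) auto
  finally show ?thesis using g'(1) k by (simp add: action_def)
qed

locale cosimplicial_monoid_map =
  M: cosimplicial_monoid C M + N: cosimplicial_monoid C N + natural_transformation Delta "Mon C" M N \<alpha>
  for C :: "('o, 'a) moncat" (structure) and M N :: "('o, 'a) cosimplicial"
    and \<alpha> :: "nat \<Rightarrow> (('o, 'a) mon, 'a) arrow"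
begin

abbreviation "a n \<equiv> underlying (\<alpha> n)"
abbreviation "T_nat \<equiv> tensor_nat C \<alpha>"

lemma component:
  assumes "n \<ge> 1"
  shows "\<alpha> n = Arrow (omap M n) (omap N n) (a n)" "a n \<in> monoid_homs C (omap M n) (omap N n)"
  using component_hom[of n] assms by (auto simp: hom_Mon)

lemma component_arr_a [simp]:
  assumes "n \<ge> 1"
  shows "a n \<in> Arr C" "Dom C (a n) = carr (omap M n)" "Cod C (a n) = carr (omap N n)"
  using monoid_homs_hom[OF component(2)[OF assms]] by auto

lemma component_unit: "n \<ge> 1 \<Longrightarrow> a n \<cdot> unit (omap M n) = unit (omap N n)"
  using component(2)[of n] by (simp add: monoid_homs_def)

lemma component_natural:
  assumes "d \<in> hom Delta m n"
  shows "a n \<cdot> M.M_arr d = N.M_arr d \<cdot> a m"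
  using arg_cong[OF natural[OF assms], of underlying] by (simp add: Mon_simps(5))

lemma T_nat_arr [simp]:
  "\<forall>n \<in> set ns. n \<ge> 1 \<Longrightarrow> T_nat ns \<in> Arr C \<and> Dom C (T_nat ns) = M.T ns \<and> Cod C (T_nat ns) = N.T ns"
  by (induction ns) auto

text \<open>The induction follows the evaluation of the arrow. At a skipped block the components
  preserve units; at a used block \<open>action_hom\<close> takes them through the action and
  naturality in Delta takes them through the induced map of the block.\<close>

lemma T_nat_natural:
  "\<lbrakk>block_map f xss yss; [] \<notin> set xss; [] \<notin> set yss\<rbrakk> \<Longrightarrow>
    T_nat (map length yss) \<cdot> M.T_arr f xss yss = N.T_arr f xss yss \<cdot> T_nat (map length xss)"
proof (induction f xss yss rule: block_map.induct)
  case (2 f ys yss)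
  then have ys: "length ys \<ge> 1" "[] \<notin> set yss" "block_map f [] yss" by (auto simp: Suc_le_eq)
  have pos: "\<forall>n \<in> set (map length yss). n \<ge> 1" using ys by (auto simp: Suc_le_eq)
  note t = M.T_arr[OF ys(3) _ ys(2)] N.T_arr[OF ys(3) _ ys(2)] T_nat_arr[OF pos]
  have "T_nat (map length (ys # yss)) \<cdot> M.T_arr f [] (ys # yss) =
      skip C (unit (omap N (length ys))) (T_nat (map length yss) \<cdot> M.T_arr f [] yss)"
    using ys(1) t by (simp add: skip_def component_unit)
  also have "\<dots> = N.T_arr f [] (ys # yss) \<cdot> T_nat (map length [])"
    using 2(1)[OF ys(3) _ ys(2)] ys(1) t by (simp add: M.skip_comp)
  finally show ?case .
next
  case (3 f xs xss ys yss)
  then have ne: "length ys \<ge> 1" "[] \<notin> set yss" "length xs \<ge> 1" "[] \<notin> set xss" "xs \<noteq> []" "[] \<notin> set (xs # xss)"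
    "[] \<notin> set (ys # yss)"
    by (auto simp: Suc_le_eq)
  have pos: "\<forall>n \<in> set (map length yss). n \<ge> 1" "\<forall>n \<in> set (map length xss). n \<ge> 1"
    "\<forall>n \<in> set (map length (xs # xss)). n \<ge> 1" "\<forall>n \<in> set (map length (ys # yss)). n \<ge> 1"
    using ne by (auto simp: Suc_le_eq)
  show ?case
  proof (cases "f (hd xs) \<in> set ys")
    case False
    then have b: "block_map f (xs # xss) yss" using 3(3) by simp
    note t = M.T_arr[OF b ne(6,2)] N.T_arr[OF b ne(6,2)] T_nat_arr[OF pos(1)] T_nat_arr[OF pos(3)]
    have "T_nat (map length (ys # yss)) \<cdot> M.T_arr f (xs # xss) (ys # yss) =
        skip C (unit (omap N (length ys))) (T_nat (map length yss) \<cdot> M.T_arr f (xs # xss) yss)"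
      using ne t False M.T_blocks_obj[OF ne(4)] by (simp add: skip_def component_unit)
    also have "\<dots> = N.T_arr f (xs # xss) (ys # yss) \<cdot> T_nat (map length (xs # xss))"
      unfolding 3(2)[OF False b ne(6,2)] using ne t False by (simp add: M.skip_comp del: list.map tensor_nat.simps)
    finally show ?thesis .
  next
    case True
    then have b: "mono_block f xs ys" "block_map f xss (ys # yss)" using 3(3) by auto
    note t = M.T_arr[OF b(2) ne(4,7)] N.T_arr[OF b(2) ne(4,7)] T_nat_arr[OF pos(1)] T_nat_arr[OF pos(2)]
      M.M_arr_index[OF b(1) ne(5)] N.M_arr_index[OF b(1) ne(5)] M.T_blocks_obj[OF ne(2)] N.T_blocks_obj[OF ne(2)]
    let ?a = "a (length ys)" and ?x = "M.T_arr f xss (ys # yss)" and ?x' = "N.T_arr f xss (ys # yss)"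
    let ?g = "M.M_arr (index_map f xs ys)" and ?g' = "N.M_arr (index_map f xs ys)"
    let ?N = "action C (omap N (length ys)) (N.T (map length yss))"
    have "T_nat (map length (ys # yss)) \<cdot> M.T_arr f (xs # xss) (ys # yss) =
        ((?a \<boxtimes> T_nat (map length yss)) \<cdot> action C (omap M (length ys)) (M.T (map length yss))) \<cdot> (?g \<boxtimes> ?x)"
      using ne t True by simp
    also have "\<dots> = (?N \<cdot> (?a \<boxtimes> (?a \<boxtimes> T_nat (map length yss)))) \<cdot> (?g \<boxtimes> ?x)"
      by (subst action_hom[OF M.monoid_M[OF ne(1)] N.monoid_M[OF ne(1)] component(2)[OF ne(1)]])
        (use t in auto)
    also have "\<dots> = ?N \<cdot> ((?a \<cdot> ?g) \<boxtimes> (T_nat (map length (ys # yss)) \<cdot> ?x))"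
      using ne t by simp
    also have "\<dots> = ?N \<cdot> ((?g' \<cdot> a (length xs)) \<boxtimes> (?x' \<cdot> T_nat (map length xss)))"
      unfolding 3(1)[OF True b(2) ne(4,7)] component_natural[OF index_map_hom[OF b(1) ne(5)]] ..
    also have "\<dots> = N.T_arr f (xs # xss) (ys # yss) \<cdot> T_nat (map length (xs # xss))"
      using ne t True by simp
    finally show ?thesis .
  qed
qed auto

lemma T_nat_mult:
  "\<lbrakk>\<forall>n \<in> set ns. n \<ge> 1; \<forall>m \<in> set ms. m \<ge> 1\<rbrakk> \<Longrightarrow>
    T_nat (ns @ ms) \<cdot> M.T_mult ns ms = N.T_mult ns ms \<cdot> (T_nat ns \<boxtimes> T_nat ms)"
proof (induction ns)
  case (Cons n ns)
  have pos: "n \<ge> 1" "\<forall>n \<in> set ns. n \<ge> 1" "\<forall>m \<in> set (ns @ ms). m \<ge> 1" using Cons.prems by auto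
  note t = T_nat_arr[OF pos(2)] T_nat_arr[OF Cons.prems(2)] T_nat_arr[OF pos(3)]
    M.T_mult_arr[OF pos(2) Cons.prems(2)] N.T_mult_arr[OF pos(2) Cons.prems(2)]
    M.T_obj[OF pos(2)] M.T_obj[OF Cons.prems(2)] N.T_obj[OF pos(2)] N.T_obj[OF Cons.prems(2)]
  have "T_nat ((n # ns) @ ms) \<cdot> M.T_mult (n # ns) ms =
      (a n \<boxtimes> (T_nat (ns @ ms) \<cdot> M.T_mult ns ms)) \<cdot> Assoc C (carr (omap M n)) (M.T ns) (M.T ms)"
    using pos t by simp
  also have "\<dots> = (Ident C (carr (omap N n)) \<boxtimes> N.T_mult ns ms) \<cdot>
      ((a n \<boxtimes> (T_nat ns \<boxtimes> T_nat ms)) \<cdot> Assoc C (carr (omap M n)) (M.T ns) (M.T ms))"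
    using Cons.IH pos Cons.prems(2) t by simp
  also have "\<dots> = N.T_mult (n # ns) ms \<cdot> (T_nat (n # ns) \<boxtimes> T_nat ms)"
    using pos t by (simp add: M.assoc_natural_arr)
  finally show ?case .
qed (auto simp: M.lunit_natural_arr)

lemma tensor_nat_monoidal:
  "monoidal_transformation Omega2 C (tensor_functor C M) (tensor_functor C N)
    (\<lambda>t \<in> Obj Omega2. T_nat (shape t))"
proof -
  interpret KM: monoidal_functor Omega2 C "tensor_functor C M" by (rule M.tensor_functor_monoidal)
  interpret KN: monoidal_functor Omega2 C "tensor_functor C N" by (rule N.tensor_functor_monoidal)
  note ts = tensor_functor_simps[where C = C]
  show ?thesis
  proof
    fix s t F
    show "(\<lambda>t\<in>Obj Omega2. T_nat (shape t)) \<in> extensional (Obj Omega2)" by simp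
    { assume "s \<in> Obj Omega2"
      then have s: "s \<in> pruned_trees" by simp
      show "(\<lambda>t\<in>Obj Omega2. T_nat (shape t)) s \<in> hom C (omap (tensor_functor C M) s) (omap (tensor_functor C N) s)"
        using T_nat_arr[OF shape_positive[OF s]] s by (auto simp: ts intro: M.homI)
      assume "t \<in> Obj Omega2"
      then have t: "t \<in> pruned_trees" by simp
      show "(\<lambda>t\<in>Obj Omega2. T_nat (shape t)) (s \<otimes>\<^bsub>Omega2\<^esub> t) \<cdot> Fmult (tensor_functor C M) (s, t) =
        Fmult (tensor_functor C N) (s, t) \<cdot>
          ((\<lambda>t\<in>Obj Omega2. T_nat (shape t)) s \<boxtimes> (\<lambda>t\<in>Obj Omega2. T_nat (shape t)) t)"
        using s t T_nat_mult[OF shape_positive[OF s] shape_positive[OF t]]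
        by (simp add: ts shape_tree_sum) }
    { assume F: "F \<in> hom Omega2 s t"
      note P = hom_pruned[OF F]
      have "[] \<notin> set (fibs s)" "[] \<notin> set (fibs t)"
        using wf_blocks_fibs(1)[OF P(1)] wf_blocks_fibs(1)[OF P(2)] by (auto simp: wf_blocks_def)
      from T_nat_natural[OF block_map_fibs[OF F] this]
      show "(\<lambda>t\<in>Obj Omega2. T_nat (shape t)) t \<cdot> amap (tensor_functor C M) F =
          amap (tensor_functor C N) F \<cdot> (\<lambda>t\<in>Obj Omega2. T_nat (shape t)) s"
        unfolding ts(2)[OF F] using P by simp }
    show "(\<lambda>t\<in>Obj Omega2. T_nat (shape t)) (Unit Omega2) \<cdot> Funit (tensor_functor C M) = Funit (tensor_functor C N)"
      by (simp add: ts)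
  qed
qed

end

lemma cosimplicial_monoidI: "\<lbrakk>monoidal_category C; category_functor Delta (Mon C) M\<rbrakk> \<Longrightarrow> cosimplicial_monoid C M"
  by (simp add: cosimplicial_monoid_def)

lemma cosimplicial_monoid_mapI:
  "\<lbrakk>monoidal_category C; natural_transformation Delta (Mon C) M N \<alpha>\<rbrakk> \<Longrightarrow> cosimplicial_monoid_map C M N \<alpha>"
  by (simp add: cosimplicial_monoid_map_def cosimplicial_monoid_def natural_transformation_def)

definition tensor_functor_functor where
  "tensor_functor_functor C =
    \<lparr>omap = (\<lambda>M \<in> Obj (cosimplicial_monoids C). tensor_functor C M),
     amap = (\<lambda>\<alpha> \<in> Arr (cosimplicial_monoids C).
       Arrow (tensor_functor C (source \<alpha>)) (tensor_functor C (target \<alpha>))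
         (\<lambda>t \<in> Obj Omega2. tensor_nat C (underlying \<alpha>) (shape t)))\<rparr>"

lemma cosimplicial_monoids_simps [simp]:
  "Obj (cosimplicial_monoids C) = {M. category_functor Delta (Mon C) M}"
  "Ident (cosimplicial_monoids C) M = Arrow M M (\<lambda>n \<in> Obj Delta. Ident (Mon C) (omap M n))"
  "Comp (cosimplicial_monoids C) \<beta> \<alpha> = Arrow (source \<alpha>) (target \<beta>)
    (\<lambda>n \<in> Obj Delta. underlying \<beta> n \<cdot>\<^bsub>Mon C\<^esub> underlying \<alpha> n)"
  by (simp_all add: cosimplicial_monoids_def functor_category_def)

lemma hom_cosimplicial_monoids:
  "\<alpha> \<in> hom (cosimplicial_monoids C) M N \<longleftrightarrow>
    (\<exists>\<eta>. \<alpha> = Arrow M N \<eta> \<and> natural_transformation Delta (Mon C) M N \<eta>)"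
  unfolding cosimplicial_monoids_def by (rule hom_functor_category)

lemma monoidal_functor_category_simps [simp]:
  "Obj (monoidal_functor_category C D) = {F. monoidal_functor C D F}"
  "Ident (monoidal_functor_category C D) F = Arrow F F (\<lambda>x \<in> Obj C. Ident D (omap F x))"
  "Comp (monoidal_functor_category C D) \<beta> \<alpha> = Arrow (source \<alpha>) (target \<beta>)
    (\<lambda>x \<in> Obj C. underlying \<beta> x \<cdot>\<^bsub>D\<^esub> underlying \<alpha> x)"
  by (simp_all add: monoidal_functor_category_def)

lemma cosimplicial_monoids_category:
  "monoidal_category C \<Longrightarrow> category (cosimplicial_monoids C)"
  unfolding cosimplicial_monoids_def
  by (rule functor_category_category[OF Delta_category Mon_category])

lemma tensor_functor_functor:
  assumes C: "monoidal_category C"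
  shows "category_functor (cosimplicial_monoids C) (monoidal_functor_category Omega2 C) (tensor_functor_functor C)"
proof -
  interpret C: monoidal_category C by fact
  interpret A: category "cosimplicial_monoids C" by (rule cosimplicial_monoids_category[OF C])
  interpret B: category "monoidal_functor_category Omega2 C" by (rule monoidal_functor_category_category)
  let ?K = "tensor_functor_functor C"
  have amap: "amap ?K (Arrow M N \<eta>) = Arrow (tensor_functor C M) (tensor_functor C N)
      (\<lambda>t \<in> Obj Omega2. tensor_nat C \<eta> (shape t))"
    if "Arrow M N \<eta> \<in> hom (cosimplicial_monoids C) M N" for M N \<eta>
    using A.hom_arr(1)[OF that] by (simp add: tensor_functor_functor_def)
  show ?thesis
  proof
    show "omap ?K \<in> extensional (Obj (cosimplicial_monoids C))"
      "amap ?K \<in> extensional (Arr (cosimplicial_monoids C))"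
      by (simp_all add: tensor_functor_functor_def)
    fix M N L \<alpha> \<beta>
    { assume M: "M \<in> Obj (cosimplicial_monoids C)"
      then interpret M: cosimplicial_monoid C M by (simp add: cosimplicial_monoidI[OF C])
      show "omap ?K M \<in> Obj (monoidal_functor_category Omega2 C)"
        using M M.tensor_functor_monoidal by (simp add: tensor_functor_functor_def)
      have nat: "tensor_nat C (\<lambda>n \<in> Obj Delta. Ident (Mon C) (omap M n)) ns = Ident C (M.T ns)"
        if "\<forall>n \<in> set ns. n \<ge> 1" for ns
        using that by (induction ns) (auto simp: Mon_simps(4))
      have nat': "tensor_nat C (\<lambda>n \<in> Obj Delta. Ident (Mon C) (omap M n)) (shape t) = Ident C (M.T (shape t))"
        if "t \<in> pruned_trees" for t by (rule nat[OF shape_positive[OF that]])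
      have "amap ?K (Ident (cosimplicial_monoids C) M) = Arrow (tensor_functor C M) (tensor_functor C M)
          (\<lambda>t \<in> Obj Omega2. tensor_nat C (\<lambda>n \<in> Obj Delta. Ident (Mon C) (omap M n)) (shape t))"
        using A.ident_hom[OF M] unfolding cosimplicial_monoids_simps(2) by (rule amap)
      also have "\<dots> = Ident (monoidal_functor_category Omega2 C) (omap ?K M)"
        using M by (auto simp: tensor_functor_functor_def tensor_functor_simps nat' fun_eq_iff
            simp del: Delta_simps Mon_simps)
      finally show "amap ?K (Ident (cosimplicial_monoids C) M) =
        Ident (monoidal_functor_category Omega2 C) (omap ?K M)" . }
    { assume \<alpha>: "\<alpha> \<in> hom (cosimplicial_monoids C) M N"
      then obtain \<eta> where \<eta>: "\<alpha> = Arrow M N \<eta>" "natural_transformation Delta (Mon C) M N \<eta>"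
        by (auto simp: hom_cosimplicial_monoids)
      interpret eta: cosimplicial_monoid_map C M N \<eta> by (rule cosimplicial_monoid_mapI[OF C \<eta>(2)])
      have MN: "omap ?K M = tensor_functor C M" "omap ?K N = tensor_functor C N"
        using A.hom_obj[OF \<alpha>] by (auto simp: tensor_functor_functor_def)
      show "amap ?K \<alpha> \<in> hom (monoidal_functor_category Omega2 C) (omap ?K M) (omap ?K N)"
        unfolding \<eta>(1) amap[OF \<alpha>[unfolded \<eta>(1)]] MN
        using eta.tensor_nat_monoidal by (simp add: hom_monoidal_functor_category)
      assume \<beta>: "\<beta> \<in> hom (cosimplicial_monoids C) N L"
      then obtain \<theta> where \<theta>: "\<beta> = Arrow N L \<theta>" "natural_transformation Delta (Mon C) N L \<theta>"
        by (auto simp: hom_cosimplicial_monoids)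
      interpret theta: cosimplicial_monoid_map C N L \<theta> by (rule cosimplicial_monoid_mapI[OF C \<theta>(2)])
      let ?c = "\<lambda>n \<in> Obj Delta. \<theta> n \<cdot>\<^bsub>Mon C\<^esub> \<eta> n"
      have nat: "tensor_nat C ?c ns = tensor_nat C \<theta> ns \<cdot>\<^bsub>C\<^esub> tensor_nat C \<eta> ns"
        if "\<forall>n \<in> set ns. n \<ge> 1" for ns
        using that
      proof (induction ns)
        case (Cons n ns)
        then show ?case
          using eta.T_nat_arr[of ns] theta.T_nat_arr[of ns] by (simp add: Mon_simps(5))
      qed simp
      have nat': "tensor_nat C ?c (shape t) = tensor_nat C \<theta> (shape t) \<cdot>\<^bsub>C\<^esub> tensor_nat C \<eta> (shape t)"
        if "t \<in> pruned_trees" for t by (rule nat[OF shape_positive[OF that]])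
      have "\<beta> \<cdot>\<^bsub>cosimplicial_monoids C\<^esub> \<alpha> = Arrow M L ?c"
        using \<eta>(1) \<theta>(1) by simp
      then have "amap ?K (\<beta> \<cdot>\<^bsub>cosimplicial_monoids C\<^esub> \<alpha>) = Arrow (tensor_functor C M) (tensor_functor C L)
          (\<lambda>t \<in> Obj Omega2. tensor_nat C ?c (shape t))"
        using amap[of M L ?c] A.comp_hom[OF \<alpha> \<beta>] by simp
      also have "\<dots> = amap ?K \<beta> \<cdot>\<^bsub>monoidal_functor_category Omega2 C\<^esub> amap ?K \<alpha>"
        unfolding \<eta>(1) \<theta>(1) amap[OF \<alpha>[unfolded \<eta>(1)]] amap[OF \<beta>[unfolded \<theta>(1)]]
        by (auto simp: fun_eq_iff nat' simp del: Delta_simps Mon_simps)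
      finally show "amap ?K (\<beta> \<cdot>\<^bsub>cosimplicial_monoids C\<^esub> \<alpha>) =
        amap ?K \<beta> \<cdot>\<^bsub>monoidal_functor_category Omega2 C\<^esub> amap ?K \<alpha>" . }
  qed
qed

section \<open>Evaluation\<close>

lemma eval_obj_simps:
  "n \<ge> 1 \<Longrightarrow> omap (eval_obj C F) n = image_monoid C F (Smon n)"
  "d \<in> Arr Delta \<Longrightarrow> amap (eval_obj C F) d =
    Arrow (image_monoid C F (Smon (source d))) (image_monoid C F (Smon (target d))) (amap F (Smap d))"
proof -
  show "omap (eval_obj C F) n = image_monoid C F (Smon n)" if n: "n \<ge> 1"
    using n by (simp add: eval_obj_def comp_functor_def compose_def S_star_simps Mon_functor_simps monoid_Smon)
  show "amap (eval_obj C F) d =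
    Arrow (image_monoid C F (Smon (source d))) (image_monoid C F (Smon (target d))) (amap F (Smap d))"
    if d: "d \<in> Arr Delta"
  proof -
    have "Arrow (Smon (source d)) (Smon (target d)) (Smap d) \<in> Arr (Mon Omega2)"
      using d Smap_monoid_hom[OF d] by (simp add: Delta_arr monoid_Smon)
    from Mon_functor_simps(2)[OF this] show ?thesis
      using d by (simp add: eval_obj_def comp_functor_def compose_def S_star_simps)
  qed
qed

lemma eval_obj_functor:
  "monoidal_functor Omega2 C F \<Longrightarrow> category_functor Delta (Mon C) (eval_obj C F)"
  unfolding eval_obj_def
  by (rule comp_functor_functor[OF S_star_functor monoidal_functor.Mon_functor_functor])

definition eval_arr where
  "eval_arr C F G \<theta> = (\<lambda>n \<in> Obj Delta.
    Arrow (omap (eval_obj C F) n) (omap (eval_obj C G) n) (\<theta> (corolla n)))"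

lemma (in monoidal_transformation) image_monoid_component:
  assumes "monoid_in C M"
  shows "\<eta> (carr M) \<in> monoid_homs D (image_monoid D F M) (image_monoid D G M)"
proof -
  interpret M: monoid_in C M by fact
  let ?c = "carr M"
  have "\<eta> ?c \<cdot> (amap F (mult M) \<cdot> Fmult F (?c, ?c)) = (\<eta> ?c \<cdot> amap F (mult M)) \<cdot> Fmult F (?c, ?c)"
    by simp
  also have "\<dots> = amap G (mult M) \<cdot> (\<eta> (?c \<otimes>\<^bsub>C\<^esub> ?c) \<cdot> Fmult F (?c, ?c))"
    unfolding natural[OF M.mult_hom] by simp
  also have "\<dots> = (amap G (mult M) \<cdot> Fmult G (?c, ?c)) \<cdot> (\<eta> ?c \<boxtimes> \<eta> ?c)"
    unfolding component_mult[OF M.carr_obj M.carr_obj] by simp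
  finally have mult: "\<eta> ?c \<cdot> (amap F (mult M) \<cdot> Fmult F (?c, ?c)) =
    (amap G (mult M) \<cdot> Fmult G (?c, ?c)) \<cdot> (\<eta> ?c \<boxtimes> \<eta> ?c)" .
  have "\<eta> ?c \<cdot> (amap F (unit M) \<cdot> Funit F) = (\<eta> ?c \<cdot> amap F (unit M)) \<cdot> Funit F" by simp
  also have "\<dots> = amap G (unit M) \<cdot> (\<eta> (Unit C) \<cdot> Funit F)"
    unfolding natural[OF M.unit_hom] by simp
  also have "\<dots> = amap G (unit M) \<cdot> Funit G" by (simp only: component_unit)
  finally show ?thesis
    using mult component_hom[OF M.carr_obj] by (simp add: monoid_homs_def)
qed

lemma eval_arr_natural:
  assumes "monoidal_transformation Omega2 C F G \<theta>"
  shows "natural_transformation Delta (Mon C) (eval_obj C F) (eval_obj C G) (eval_arr C F G \<theta>)"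
proof -
  interpret theta: monoidal_transformation Omega2 C F G \<theta> by fact
  interpret EF: category_functor Delta "Mon C" "eval_obj C F"
    by (rule eval_obj_functor) unfold_locales
  interpret EG: category_functor Delta "Mon C" "eval_obj C G"
    by (rule eval_obj_functor) unfold_locales
  show ?thesis
  proof
    show "eval_arr C F G \<theta> \<in> extensional (Obj Delta)" by (simp add: eval_arr_def)
    show "eval_arr C F G \<theta> n \<in> hom (Mon C) (omap (eval_obj C F) n) (omap (eval_obj C G) n)"
      if "n \<in> Obj Delta" for n
    proof -
      have n: "n \<ge> 1" using that by simp
      have "\<theta> (corolla n) \<in> monoid_homs C (image_monoid C F (Smon n)) (image_monoid C G (Smon n))"
        using theta.image_monoid_component[OF monoid_Smon[OF n]] by simp
      then show ?thesis
        using n theta.F.image_monoid[OF monoid_Smon[OF n]] theta.G.image_monoid[OF monoid_Smon[OF n]]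
        by (simp add: eval_arr_def eval_obj_simps hom_Mon)
    qed
    fix d m n assume "d \<in> hom Delta m n"
    note d = Delta_homD[OF this]
    have "\<theta> (corolla n) \<cdot>\<^bsub>C\<^esub> amap F (Smap d) = amap G (Smap d) \<cdot>\<^bsub>C\<^esub> \<theta> (corolla m)"
      by (rule theta.natural) (use Smap(1)[OF d(1)] d in simp)
    then show "eval_arr C F G \<theta> n \<cdot>\<^bsub>Mon C\<^esub> amap (eval_obj C F) d =
      amap (eval_obj C G) d \<cdot>\<^bsub>Mon C\<^esub> eval_arr C F G \<theta> m"
      using d by (simp add: eval_arr_def eval_obj_simps)
  qed
qed

lemma evaluation_simps:
  "monoidal_functor Omega2 C F \<Longrightarrow> omap (evaluation C) F = eval_obj C F"
  "Arrow F G \<theta> \<in> Arr (monoidal_functor_category Omega2 C) \<Longrightarrow>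
    amap (evaluation C) (Arrow F G \<theta>) = Arrow (eval_obj C F) (eval_obj C G) (eval_arr C F G \<theta>)"
  "omap (evaluation C) \<in> extensional (Obj (monoidal_functor_category Omega2 C))"
  "amap (evaluation C) \<in> extensional (Arr (monoidal_functor_category Omega2 C))"
  by (simp_all add: evaluation_def eval_arr_def)

lemma evaluation_functor:
  assumes C: "monoidal_category C"
  shows "category_functor (monoidal_functor_category Omega2 C) (cosimplicial_monoids C) (evaluation C)"
proof -
  interpret C: monoidal_category C by fact
  interpret A: category "monoidal_functor_category Omega2 C" by (rule monoidal_functor_category_category)
  interpret B: category "cosimplicial_monoids C" by (rule cosimplicial_monoids_category[OF C])
  show ?thesis
  proof
    fix F G H \<alpha> \<beta>
    { assume "F \<in> Obj (monoidal_functor_category Omega2 C)"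
      then have F: "monoidal_functor Omega2 C F" by simp
      then interpret F: monoidal_functor Omega2 C F .
      show "omap (evaluation C) F \<in> Obj (cosimplicial_monoids C)"
        using F eval_obj_functor[OF F] by (simp add: evaluation_simps)
      have "Ident (monoidal_functor_category Omega2 C) F \<in> Arr (monoidal_functor_category Omega2 C)"
        by (rule A.ident_arr(1)) (simp add: F)
      then show "amap (evaluation C) (Ident (monoidal_functor_category Omega2 C) F) =
        Ident (cosimplicial_monoids C) (omap (evaluation C) F)"
        using F by (auto simp: evaluation_simps eval_arr_def fun_eq_iff eval_obj_simps) }
    { assume \<alpha>: "\<alpha> \<in> hom (monoidal_functor_category Omega2 C) F G"
      then obtain \<eta> where \<eta>: "\<alpha> = Arrow F G \<eta>" "monoidal_transformation Omega2 C F G \<eta>"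
        by (auto simp: hom_monoidal_functor_category)
      interpret eta: monoidal_transformation Omega2 C F G \<eta> by fact
      note aa = A.hom_arr(1)[OF \<alpha>]
      have FG: "monoidal_functor Omega2 C F" "monoidal_functor Omega2 C G" by unfold_locales
      show "amap (evaluation C) \<alpha> \<in> hom (cosimplicial_monoids C) (omap (evaluation C) F) (omap (evaluation C) G)"
        using aa FG eval_arr_natural[OF \<eta>(2)] unfolding \<eta>(1)
        by (simp add: evaluation_simps hom_cosimplicial_monoids)
      assume \<beta>: "\<beta> \<in> hom (monoidal_functor_category Omega2 C) G H"
      then obtain \<theta> where \<theta>: "\<beta> = Arrow G H \<theta>" by (auto simp: hom_monoidal_functor_category)
      note ba = A.hom_arr(1)[OF \<beta>]
      have "\<beta> \<cdot>\<^bsub>monoidal_functor_category Omega2 C\<^esub> \<alpha> \<in> Arr (monoidal_functor_category Omega2 C)"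
        using A.comp_hom[OF \<alpha> \<beta>] by (rule A.hom_arr)
      then show "amap (evaluation C) (\<beta> \<cdot>\<^bsub>monoidal_functor_category Omega2 C\<^esub> \<alpha>) =
        amap (evaluation C) \<beta> \<cdot>\<^bsub>cosimplicial_monoids C\<^esub> amap (evaluation C) \<alpha>"
        using aa ba unfolding \<eta>(1) \<theta>
        by (auto simp: evaluation_simps eval_arr_def fun_eq_iff) }
  qed (rule evaluation_simps)+
qed

section \<open>Evaluating the tensor functor\<close>

context cosimplicial_monoid
begin

abbreviation "K \<equiv> tensor_functor C M"

lemma omap_K_corolla: "n \<ge> 1 \<Longrightarrow> omap K (corolla n) = carr (omap M n) \<otimes> Unit C"
  by (simp add: tensor_functor_simps del: upt_Suc)

lemma amap_K_Smap:
  assumes d: "d \<in> hom Delta m n"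
  shows "amap K (Smap d) = M_arr d \<boxtimes> Ident C (Unit C)"
proof -
  note d' = Delta_homD[OF d]
  have S: "Smap d \<in> hom Omega2 (corolla m) (corolla n)" using Smap(1)[OF d'(1)] d' by simp
  have leaf: "leaf (Smap d) i = underlying d i" if "i \<in> {1..m}" for i
    using Smap(2)[OF d'(1)] d' that by simp
  have "amap K (Smap d) = T_arr (leaf (Smap d)) [[1..<Suc m]] [[1..<Suc n]]"
    using d' by (simp add: tensor_functor_simps(2)[OF S] del: upt_Suc)
  \<comment> \<open>One block goes to one block, so no multiplication is left over.\<close>
  also have "\<dots> = M_arr (index_map (leaf (Smap d)) [1..<Suc m] [1..<Suc n]) \<boxtimes> T_arr (leaf (Smap d)) [] []"
    by (rule T_arr_Cons[OF mono_block_upt[OF d leaf]]) (use d' in auto)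
  also have "index_map (leaf (Smap d)) [1..<Suc m] [1..<Suc n] = d" by (rule index_map_upt[OF d leaf])
  finally show ?thesis by simp
qed

text \<open>Evaluation inserts the unit through the inverse left unitor of I. The right unitor can
  undo this because the two unitors agree at I.\<close>

lemma runit_K_unit:
  assumes n: "n \<ge> 1"
  shows "RUnit C (carr (omap M n)) \<cdot> amap K (unit (Smon n)) = unit (omap M n)"
proof -
  have "amap K (unit (Smon n)) = skip C (unit (omap M n)) (Ident C (Unit C))"
    using n by (simp add: tensor_functor_simps(2)[OF unit_Smon[OF n]] del: upt_Suc)
  then have "RUnit C (carr (omap M n)) \<cdot> amap K (unit (Smon n)) =
      RUnit C (carr (omap M n)) \<cdot> ((unit (omap M n) \<boxtimes> Ident C (Unit C)) \<cdot> LInv (Unit C))"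
    by (simp add: skip_def)
  also have "\<dots> = (RUnit C (carr (omap M n)) \<cdot> (unit (omap M n) \<boxtimes> Ident C (Unit C))) \<cdot> LInv (Unit C)"
    using n by simp
  also have "\<dots> = unit (omap M n) \<cdot> (RUnit C (Unit C) \<cdot> LInv (Unit C))"
    using n by (simp add: runit_natural_arr)
  also have "\<dots> = unit (omap M n)"
    using n by (simp flip: lunit_unit_eq_runit_unit)
  finally show ?thesis .
qed

text \<open>Both source blocks fall into the single target block, with identity index maps. The
  second alone evaluates to an identity by \<open>T_arr_Cons\<close>, and the first is then
  multiplied into it, which leaves the bare action.\<close>

lemma amap_K_mult:
  assumes n: "n \<ge> 1"
  shows "amap K (mult (Smon n)) = action C (omap M n) (Unit C)"
proof -
  let ?L = "[1..<Suc n]" and ?h = "leaf (mult (Smon n))"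
  note m = mult_Smon[OF n]
  have L: "set ?L = {1..n}" "?L \<noteq> []" "length ?L = n" "hd ?L = 1" "distinct ?L"
    using n by (auto simp: hd_upt simp del: upt_Suc)
  have h: "(?h \<circ> inl) x = id x" "(?h \<circ> inr) x = id x" if "x \<in> set ?L" for x
    using m(2,3)[of x] that by (auto simp del: upt_Suc)
  have bij: "mono_block id ?L ?L" "index_map id ?L ?L = Ident Delta n"
    using index_map_bij[of id ?L] L by simp_all
  have "index_map (?h \<circ> inl) ?L ?L = index_map id ?L ?L" by (rule index_map_cong[OF h(1)])
  moreover have "index_map (?h \<circ> inr) ?L ?L = index_map id ?L ?L" by (rule index_map_cong[OF h(2)])
  ultimately have idx: "index_map ?h (map inl ?L) ?L = Ident Delta n" "index_map ?h (map inr ?L) ?L = Ident Delta n"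
    by (simp_all only: index_map_map bij(2))
  have "mono_block (?h \<circ> inr) ?L ?L = mono_block id ?L ?L" by (rule mono_block_cong[OF h(2)])
  then have mono: "mono_block ?h (map inr ?L) ?L"
    using bij(1) by (simp only: mono_block_map)
  have "fibs (tree_sum (corolla n) (corolla n)) = [map inl ?L, map inr ?L]"
    using n by (simp add: fibs_tree_sum del: upt_Suc)
  then have "amap K (mult (Smon n)) = T_arr ?h [map inl ?L, map inr ?L] [?L]"
    using n by (simp add: tensor_functor_simps(2)[OF m(1)] del: upt_Suc)
  also have "\<dots> = action C (omap M n) (Unit C) \<cdot> (M_arr (Ident Delta n) \<boxtimes> T_arr ?h [map inr ?L] [?L])"
  proof -
    have "?h (hd (map inl ?L)) \<in> set ?L" using L n m(2)[of 1] by (simp add: hd_map del: upt_Suc)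
    then show ?thesis using idx(1) L(3) by (simp del: upt_Suc Delta_simps)
  qed
  also have "T_arr ?h [map inr ?L] [?L] = M_arr (Ident Delta n) \<boxtimes> T_arr ?h [] []"
    unfolding idx(2)[symmetric] by (rule T_arr_Cons[OF mono]) (use L in \<open>auto simp del: upt_Suc\<close>)
  finally show ?thesis using n by (simp add: M_arr_ident del: Delta_simps)
qed

text \<open>The triangle reduces the structure map of K to a right unitor on the first factor, and
  \<open>runit_tensor\<close> lets the outer right unitor pass the associator contained in the
  action.\<close>

lemma runit_K_mult:
  assumes n: "n \<ge> 1"
  shows "RUnit C (carr (omap M n)) \<cdot> (amap K (mult (Smon n)) \<cdot> Fmult K (corolla n, corolla n)) =
    mult (omap M n) \<cdot> (RUnit C (carr (omap M n)) \<boxtimes> RUnit C (carr (omap M n)))"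
proof -
  interpret m: monoid_in C "omap M n" by (rule monoid_M[OF n])
  let ?c = "carr (omap M n)" and ?I = "Unit C" and ?m = "mult (omap M n)"
  have "Fmult K (corolla n, corolla n) = (Ident C ?c \<boxtimes> LUnit C (?c \<otimes> ?I)) \<cdot> Assoc C ?c ?I (?c \<otimes> ?I)"
    using n by (simp add: tensor_functor_simps(3) del: upt_Suc)
  also have "\<dots> = RUnit C ?c \<boxtimes> Ident C (?c \<otimes> ?I)" by (rule triangle) auto
  finally have "RUnit C ?c \<cdot> (amap K (mult (Smon n)) \<cdot> Fmult K (corolla n, corolla n)) =
      (RUnit C ?c \<cdot> (?m \<boxtimes> Ident C ?I)) \<cdot> (AInv ?c ?c ?I \<cdot> (RUnit C ?c \<boxtimes> Ident C (?c \<otimes> ?I)))"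
    unfolding amap_K_mult[OF n] by (simp add: action_def)
  also have "\<dots> = ?m \<cdot> (RUnit C (?c \<otimes> ?c) \<cdot> (AInv ?c ?c ?I \<cdot> (RUnit C ?c \<boxtimes> Ident C (?c \<otimes> ?I))))"
    by (subst runit_natural_arr) auto
  also have "\<dots> = ?m \<cdot> (((Ident C ?c \<boxtimes> RUnit C ?c) \<cdot> Assoc C ?c ?c ?I) \<cdot>
      (AInv ?c ?c ?I \<cdot> (RUnit C ?c \<boxtimes> Ident C (?c \<otimes> ?I))))"
    by (subst runit_tensor) auto
  also have "\<dots> = ?m \<cdot> (RUnit C ?c \<boxtimes> RUnit C ?c)" by simp
  finally show ?thesis .
qed

text \<open>A corolla is sent to its monoid tensored with the final I, which the right unitor
  removes. By \<open>runit_K_mult\<close> and \<open>runit_K_unit\<close> this is a homomorphism of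
  monoids, by \<open>amap_K_Smap\<close> it is natural in Delta.\<close>

definition counit :: "nat \<Rightarrow> (('o, 'a) mon, 'a) arrow" where
  "counit = (\<lambda>n \<in> Obj Delta. Arrow (omap (eval_obj C K) n) (omap M n) (RUnit C (carr (omap M n))))"

lemma counit_natural: "natural_transformation Delta (Mon C) (eval_obj C K) M counit"
proof -
  interpret K: monoidal_functor Omega2 C K by (rule tensor_functor_monoidal)
  interpret EK: category_functor Delta "Mon C" "eval_obj C K"
    by (rule eval_obj_functor[OF tensor_functor_monoidal])
  show ?thesis
  proof
    show "counit \<in> extensional (Obj Delta)" by (simp add: counit_def)
    show "counit n \<in> hom (Mon C) (omap (eval_obj C K) n) (omap M n)" if "n \<in> Obj Delta" for n
    proof -
      have n: "n \<ge> 1" using that by simp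
      interpret m: monoid_in C "omap M n" by (rule monoid_M[OF n])
      have KS: "amap K (unit (Smon n)) \<in> hom C (Unit C) (carr (omap M n) \<otimes> Unit C)"
        using K.amap_hom[OF unit_Smon[OF n]] n by (simp add: omap_K_corolla) (simp add: tensor_functor_simps)
      have "RUnit C (carr (omap M n)) \<in> monoid_homs C (image_monoid C K (Smon n)) (omap M n)"
        using runit_K_mult[OF n] runit_K_unit[OF n] n KS
        by (simp add: monoid_homs_def tensor_functor_simps(4) omap_K_corolla) (auto intro: homI)
      then show ?thesis
        using n K.image_monoid[OF monoid_Smon[OF n]] monoid_M[OF n]
        by (simp add: counit_def eval_obj_simps hom_Mon)
    qed
    fix d m n assume d: "d \<in> hom Delta m n"
    note d' = Delta_homD[OF d]
    have "RUnit C (carr (omap M n)) \<cdot> (M_arr d \<boxtimes> Ident C (Unit C)) = M_arr d \<cdot> RUnit C (carr (omap M m))"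
      using M_arr_hom[OF d] runit_natural_arr[of "M_arr d" "carr (omap M n)"] by simp
    then show "counit n \<cdot>\<^bsub>Mon C\<^esub> amap (eval_obj C K) d = amap M d \<cdot>\<^bsub>Mon C\<^esub> counit m"
      using d' amap_M(1)[OF d] by (simp add: counit_def eval_obj_simps amap_K_Smap[OF d]) (metis arrow.sel)
  qed
qed

end

section \<open>Monoidal functors are determined by their evaluation\<close>

locale tree_functor = monoidal_functor Omega2 C F
  for C :: "('o, 'a) moncat" (structure) and F :: "(tree, tree_arrow, 'o, 'a) monfctr"
begin

sublocale E: cosimplicial_monoid C "eval_obj C F"
  by (intro cosimplicial_monoidI eval_obj_functor) unfold_locales

lemma carr_E [simp]: "n \<ge> 1 \<Longrightarrow> carr (omap (eval_obj C F) n) = omap F (corolla n)"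
  by (simp add: eval_obj_simps)

text \<open>The comparison on forests: it iterates the structure maps of F along the nesting of the
  forest, the final I being taken to the empty tree by \<open>Funit\<close>.\<close>

fun kap :: "nat list \<Rightarrow> 'a" where
  "kap [] = Funit F"
| "kap (n # ns) = Fmult F (corolla n, forest ns) \<cdot> (Ident C (omap F (corolla n)) \<boxtimes> kap ns)"

lemma kap_iso: "\<forall>n \<in> set ns. n \<ge> 1 \<Longrightarrow> kap ns \<in> isos C (E.T ns) (omap F (forest ns))"
proof (induction ns)
  case Nil
  then show ?case using Funit_iso by simp
next
  case (Cons n ns)
  then have n: "n \<ge> 1" "\<forall>n \<in> set ns. n \<ge> 1" by auto
  have "Fmult F (corolla n, forest ns) \<in> isos C (omap F (corolla n) \<otimes> omap F (forest ns)) (omap F (forest (n # ns)))"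
    using Fmult_iso[of "corolla n" "forest ns"] n by simp
  moreover have "Ident C (omap F (corolla n)) \<boxtimes> kap ns \<in>
      isos C (omap F (corolla n) \<otimes> E.T ns) (omap F (corolla n) \<otimes> omap F (forest ns))"
    using D.tensor_ident_iso(2)[OF Cons.IH[OF n(2)]] n by simp
  ultimately show ?case using D.comp_iso n by (auto simp: eval_obj_simps)
qed

lemma kap_arr [simp]:
  assumes "\<forall>n \<in> set ns. n \<ge> 1"
  shows "kap ns \<in> Arr C" "Dom C (kap ns) = E.T ns" "Cod C (kap ns) = omap F (forest ns)"
  using kap_iso[OF assms] by auto

text \<open>The recursion of \<open>tensor_mult\<close> carried out in the category of trees. It is
  needed because the sum of two forests is a forest only up to isomorphism.\<close>

fun join :: "nat list \<Rightarrow> nat list \<Rightarrow> tree_arrow" where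
  "join [] ms = LUnit Omega2 (forest ms)"
| "join (n # ns) ms = (Ident Omega2 (corolla n) \<boxtimes>\<^bsub>Omega2\<^esub> join ns ms) \<cdot>\<^bsub>Omega2\<^esub>
    Assoc Omega2 (corolla n) (forest ns) (forest ms)"

lemma rigid_join:
  "\<lbrakk>\<forall>n \<in> set ns. n \<ge> 1; \<forall>m \<in> set ms. m \<ge> 1\<rbrakk> \<Longrightarrow>
    rigid (tree_sum (forest ns) (forest ms)) (forest (ns @ ms)) (join ns ms)"
proof (induction ns)
  case Nil
  then show ?case using rigid_unit(1)[of "forest ms"] by simp
next
  case (Cons n ns)
  then have n: "n \<ge> 1" "\<forall>n \<in> set ns. n \<ge> 1" by auto
  note P = corolla_pruned[OF n(1)] forest_pruned[OF n(2)] forest_pruned[OF Cons.prems(2)]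
  show ?case
    using rigid_comp[OF rigid_assoc[OF P] rigid_tensor[OF rigid_ident[OF P(1)] Cons.IH[OF n(2) Cons.prems(2)]]]
    by simp
qed

text \<open>Compatibility of \<open>kap\<close> with structure maps, corrected by
  \<open>join\<close>. The empty list is the left unit law of F; each further corolla uses
  naturality of \<open>Fmult\<close> and its associativity law once.\<close>

lemma kap_join:
  "\<lbrakk>\<forall>n \<in> set ns. n \<ge> 1; \<forall>m \<in> set ms. m \<ge> 1\<rbrakk> \<Longrightarrow>
    kap (ns @ ms) \<cdot> E.T_mult ns ms =
      amap F (join ns ms) \<cdot> (Fmult F (forest ns, forest ms) \<cdot> (kap ns \<boxtimes> kap ms))"
proof (induction ns)
  case Nil
  have P: "forest ms \<in> pruned_trees" using Nil by simp
  note k = kap_arr[OF Nil(2)] E.T_obj[OF Nil(2)]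
  have l: "LUnit Omega2 (forest ms) \<in> hom Omega2 (tree_sum empty_tree (forest ms)) (forest ms)"
    by (rule tree_lunit_hom[OF P])
  have Fl: "amap F (LUnit Omega2 (forest ms)) \<in> Arr C"
    "Dom C (amap F (LUnit Omega2 (forest ms))) = omap F (tree_sum empty_tree (forest ms))"
    using amap_hom[OF l] by auto
  have Fm: "Fmult F (empty_tree, forest ms) \<in> Arr C"
    "Dom C (Fmult F (empty_tree, forest ms)) = omap F empty_tree \<otimes> omap F (forest ms)"
    "Cod C (Fmult F (empty_tree, forest ms)) = omap F (tree_sum empty_tree (forest ms))"
    using Fmult_arr[of empty_tree "forest ms"] P by simp_all
  have Fu: "Funit F \<in> Arr C" "Dom C (Funit F) = Unit C" "Cod C (Funit F) = omap F empty_tree"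
    using Funit_arr by simp_all
  have "amap F (join [] ms) \<cdot> (Fmult F (forest [], forest ms) \<cdot> (kap [] \<boxtimes> kap ms)) =
      (amap F (LUnit Omega2 (forest ms)) \<cdot> Fmult F (empty_tree, forest ms) \<cdot> (Funit F \<boxtimes> Ident C (omap F (forest ms)))) \<cdot>
        (Ident C (Unit C) \<boxtimes> kap ms)"
    using k Fl Fm Fu P by simp
  also have "\<dots> = LUnit C (omap F (forest ms)) \<cdot> (Ident C (Unit C) \<boxtimes> kap ms)"
    using Fmult_lunit[of "forest ms"] P by simp
  also have "\<dots> = kap ms \<cdot> LUnit C (E.T ms)"
    using k by (simp add: D.lunit_natural_arr)
  finally show ?case by simp
next
  case (Cons n ns)
  then have n: "n \<ge> 1" "\<forall>n \<in> set ns. n \<ge> 1" and nm: "\<forall>m \<in> set (ns @ ms). m \<ge> 1" by auto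
  note P = corolla_pruned[OF n(1)] forest_pruned[OF n(2)] forest_pruned[OF Cons.prems(2)] forest_pruned[OF nm]
  note k = kap_arr[OF n(2)] kap_arr[OF Cons.prems(2)] kap_arr[OF nm] E.T_obj[OF n(2)] E.T_obj[OF Cons.prems(2)]
    E.T_obj[OF nm] E.T_mult_arr[OF n(2) Cons.prems(2)]
  let ?c = "corolla n" and ?s = "forest ns" and ?t = "forest ms" and ?u = "forest (ns @ ms)"
  let ?Fc = "omap F ?c" and ?one = "Ident C (omap F (corolla n))"
  have J: "join ns ms \<in> hom Omega2 (tree_sum ?s ?t) ?u" by (rule rigid_hom[OF rigid_join[OF n(2) Cons.prems(2)]])
  note J' = Omega2.hom_arr[OF J]
  have FJ: "amap F (join ns ms) \<in> Arr C" "Dom C (amap F (join ns ms)) = omap F (tree_sum ?s ?t)"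
    "Cod C (amap F (join ns ms)) = omap F ?u"
    using amap_hom[OF J] by auto
  have Fm: "Fmult F (x, y) \<in> Arr C" "Dom C (Fmult F (x, y)) = omap F x \<otimes> omap F y"
    "Cod C (Fmult F (x, y)) = omap F (tree_sum x y)" if "x \<in> pruned_trees" "y \<in> pruned_trees" for x y
    using Fmult_arr[of x y] that by simp_all
  note a = tree_assoc_hom[OF P(1-3)]
  note iJ = tensor_tree_hom[OF ident_tree_hom[OF P(1)] J]
  have FA: "amap F (Assoc Omega2 ?c ?s ?t) \<in> Arr C"
    "Dom C (amap F (Assoc Omega2 ?c ?s ?t)) = omap F (tree_sum (tree_sum ?c ?s) ?t)"
    "Cod C (amap F (Assoc Omega2 ?c ?s ?t)) = omap F (tree_sum ?c (tree_sum ?s ?t))"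
    using amap_hom[OF a] by auto
  have FiJ: "amap F (Ident Omega2 ?c \<boxtimes>\<^bsub>Omega2\<^esub> join ns ms) \<in> Arr C"
    "Dom C (amap F (Ident Omega2 ?c \<boxtimes>\<^bsub>Omega2\<^esub> join ns ms)) = omap F (tree_sum ?c (tree_sum ?s ?t))"
    using amap_hom[OF iJ] by auto
  have "kap ((n # ns) @ ms) \<cdot> E.T_mult (n # ns) ms =
      Fmult F (?c, ?u) \<cdot> ((?one \<boxtimes> (kap (ns @ ms) \<cdot> E.T_mult ns ms)) \<cdot> Assoc C ?Fc (E.T ns) (E.T ms))"
    using n k P Fm by simp
  also have "\<dots> = (Fmult F (?c, ?u) \<cdot> (amap F (Ident Omega2 ?c) \<boxtimes> amap F (join ns ms))) \<cdot>
      ((?one \<boxtimes> (Fmult F (?s, ?t) \<cdot> (kap ns \<boxtimes> kap ms))) \<cdot> Assoc C ?Fc (E.T ns) (E.T ms))"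
    unfolding Cons.IH[OF n(2) Cons.prems(2)] using n k P Fm FJ by simp
  \<comment> \<open>Naturality pulls the join of the remaining corollas out in front; what stays
    behind is one side of the associativity law of F.\<close>
  also have "\<dots> = (amap F (Ident Omega2 ?c \<boxtimes>\<^bsub>Omega2\<^esub> join ns ms) \<cdot> Fmult F (?c, tree_sum ?s ?t)) \<cdot>
      ((?one \<boxtimes> (Fmult F (?s, ?t) \<cdot> (kap ns \<boxtimes> kap ms))) \<cdot> Assoc C ?Fc (E.T ns) (E.T ms))"
    unfolding Fmult_natural[OF ident_tree_hom[OF P(1)] J] ..
  also have "\<dots> = amap F (Ident Omega2 ?c \<boxtimes>\<^bsub>Omega2\<^esub> join ns ms) \<cdot> (Fmult F (?c, tree_sum ?s ?t) \<cdot>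
      ((?one \<boxtimes> Fmult F (?s, ?t)) \<cdot> ((?one \<boxtimes> (kap ns \<boxtimes> kap ms)) \<cdot> Assoc C ?Fc (E.T ns) (E.T ms))))"
    using n k P Fm FiJ by simp
  also have "(?one \<boxtimes> (kap ns \<boxtimes> kap ms)) \<cdot> Assoc C ?Fc (E.T ns) (E.T ms) =
      Assoc C ?Fc (omap F ?s) (omap F ?t) \<cdot> ((?one \<boxtimes> kap ns) \<boxtimes> kap ms)"
    using n k P by (simp add: D.assoc_natural_arr)
  also have "Fmult F (?c, tree_sum ?s ?t) \<cdot> ((?one \<boxtimes> Fmult F (?s, ?t)) \<cdot>
      (Assoc C ?Fc (omap F ?s) (omap F ?t) \<cdot> ((?one \<boxtimes> kap ns) \<boxtimes> kap ms))) =
    (Fmult F (?c, ?s \<otimes>\<^bsub>Omega2\<^esub> ?t) \<cdot> (?one \<boxtimes> Fmult F (?s, ?t)) \<cdot> Assoc C ?Fc (omap F ?s) (omap F ?t)) \<cdot>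
      ((?one \<boxtimes> kap ns) \<boxtimes> kap ms)"
    using n k P Fm by simp
  also have "\<dots> = (amap F (Assoc Omega2 ?c ?s ?t) \<cdot> Fmult F (?c \<otimes>\<^bsub>Omega2\<^esub> ?s, ?t) \<cdot>
      (Fmult F (?c, ?s) \<boxtimes> Ident C (omap F ?t))) \<cdot> ((?one \<boxtimes> kap ns) \<boxtimes> kap ms)"
    using Fmult_assoc[of ?c ?s ?t] P by simp
  also have "amap F (Ident Omega2 ?c \<boxtimes>\<^bsub>Omega2\<^esub> join ns ms) \<cdot> \<dots> =
    (amap F (Ident Omega2 ?c \<boxtimes>\<^bsub>Omega2\<^esub> join ns ms) \<cdot> amap F (Assoc Omega2 ?c ?s ?t)) \<cdot>
      (Fmult F (tree_sum ?c ?s, ?t) \<cdot> ((Fmult F (?c, ?s) \<cdot> (?one \<boxtimes> kap ns)) \<boxtimes> kap ms))"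
    using n k P Fm FiJ FA by simp
  also have "\<dots> = amap F (join (n # ns) ms) \<cdot> (Fmult F (forest (n # ns), ?t) \<cdot> (kap (n # ns) \<boxtimes> kap ms))"
    by (simp add: amap_comp[OF a iJ])
  finally show ?case .
qed

section \<open>The comparison on arbitrary trees\<close>

definition kappa :: "tree \<Rightarrow> 'a" where
  "kappa = (\<lambda>t \<in> Obj Omega2. amap F (straighten t) \<cdot> kap (shape t))"

abbreviation "KE \<equiv> tensor_functor C (eval_obj C F)"

sublocale KE: monoidal_functor Omega2 C KE
  by (rule E.tensor_functor_monoidal)

lemma omap_KE [simp]: "t \<in> pruned_trees \<Longrightarrow> omap KE t = E.T (shape t)"
  by (rule tensor_functor_simps)

lemma kappa_iso: "t \<in> pruned_trees \<Longrightarrow> kappa t \<in> isos C (omap KE t) (omap F t)"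
  using D.comp_iso[OF kap_iso amap_iso[OF rigid_iso[OF rigid_straighten]]] shape_positive
  by (simp add: kappa_def)

lemma kappa_arr [simp]:
  assumes "t \<in> pruned_trees"
  shows "kappa t \<in> Arr C" "Dom C (kappa t) = E.T (shape t)" "Cod C (kappa t) = omap F t"
  using kappa_iso[OF assms] assms by auto

text \<open>By uniqueness of rigid arrows, \<open>straighten\<close> may be replaced by whichever
  rigid arrow is at hand, such as the right unitor of a corolla.\<close>

lemma kappa_eq:
  assumes "rigid (forest (shape t)) t G"
  shows "kappa t = amap F G \<cdot> kap (shape t)"
  using rigid_unique[OF assms rigid_straighten] hom_pruned(2)[OF rigid_hom[OF assms]]
  by (simp add: kappa_def)

text \<open>The forest of one corolla still has the empty tree attached, so the right unitor of
  trees straightens it; the right unit law of F then computes the value. Thus the comparison on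
  corollas has the form of the counit.\<close>

lemma kappa_corolla:
  assumes n: "n \<ge> 1"
  shows "kappa (corolla n) = RUnit C (omap F (corolla n))"
proof -
  have "rigid (forest (shape (corolla n))) (corolla n) (RUnit Omega2 (corolla n))"
    using rigid_unit(2)[OF corolla_pruned[OF n]] n by (simp del: upt_Suc)
  from kappa_eq[OF this]
  have "kappa (corolla n) = amap F (RUnit Omega2 (corolla n)) \<cdot> (Fmult F (corolla n, empty_tree) \<cdot>
      (Ident C (omap F (corolla n)) \<boxtimes> Funit F))"
    using n by (simp del: upt_Suc)
  also have "\<dots> = amap F (RUnit Omega2 (corolla n)) \<cdot> Fmult F (corolla n, Unit Omega2) \<cdot>
      (Ident C (omap F (corolla n)) \<boxtimes> Funit F)"
    using n Fmult_arr[of "corolla n" empty_tree] amap_hom[OF tree_runit_hom[OF corolla_pruned[OF n]]] Funit_arr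
    by simp
  also have "\<dots> = RUnit C (omap F (corolla n))" by (rule Fmult_runit) (use n in simp)
  finally show ?thesis .
qed

lemma kappa_empty: "kappa empty_tree = Funit F"
  using kappa_eq[of empty_tree "Ident Omega2 empty_tree"] rigid_ident[of empty_tree] Funit_arr
    amap_ident[of empty_tree] by simp

lemma kappa_mult:
  assumes s: "s \<in> pruned_trees" and t: "t \<in> pruned_trees"
  shows "kappa (tree_sum s t) \<cdot> Fmult KE (s, t) = Fmult F (s, t) \<cdot> (kappa s \<boxtimes> kappa t)"
proof -
  note ns = shape_positive[OF s] and ms = shape_positive[OF t]
  note rs = rigid_straighten[OF s] and rt = rigid_straighten[OF t] and rst = rigid_straighten[OF tree_sum_pruned[OF s t]]
  note hs = amap_hom[OF rigid_hom[OF rs]] and ht = amap_hom[OF rigid_hom[OF rt]]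
  note J = rigid_join[OF ns ms]
  let ?J = "join (shape s) (shape t)" and ?S = "straighten s" and ?T = "straighten t" and ?U = "straighten (tree_sum s t)"
  let ?fs = "forest (shape s)" and ?ft = "forest (shape t)"
  note P = forest_pruned[OF ns] forest_pruned[OF ms]
  have rst': "rigid (forest (shape s @ shape t)) (tree_sum s t) ?U"
    using rst by (simp only: shape_tree_sum[OF s t])
  have pos: "\<forall>n \<in> set (shape s @ shape t). n \<ge> 1" using ns ms by auto
  \<comment> \<open>Both sides are rigid with the same source and target, so the chosen arrows need
    not be known.\<close>
  have UJ: "?U \<cdot>\<^bsub>Omega2\<^esub> ?J = ?S \<boxtimes>\<^bsub>Omega2\<^esub> ?T"
    by (rule rigid_unique[OF rigid_comp[OF J rst'] rigid_tensor[OF rs rt]])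
  have FJ: "amap F ?J \<in> hom C (omap F (tree_sum ?fs ?ft)) (omap F (forest (shape s @ shape t)))"
    by (rule amap_hom[OF rigid_hom[OF J]])
  have FU: "amap F ?U \<in> hom C (omap F (forest (shape s @ shape t))) (omap F (tree_sum s t))"
    by (rule amap_hom[OF rigid_hom[OF rst']])
  have Fm: "Fmult F (?fs, ?ft) \<in> Arr C" "Dom C (Fmult F (?fs, ?ft)) = omap F ?fs \<otimes> omap F ?ft"
    "Cod C (Fmult F (?fs, ?ft)) = omap F (tree_sum ?fs ?ft)"
    using Fmult_arr[of ?fs ?ft] P by simp_all
  have Fm': "Fmult F (s, t) \<in> Arr C" "Dom C (Fmult F (s, t)) = omap F s \<otimes> omap F t"
    using Fmult_arr[of s t] s t by simp_all
  note k = kap_arr[OF ns] kap_arr[OF ms] kap_arr[OF pos] E.T_mult_arr[OF ns ms]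
  have "kappa (tree_sum s t) \<cdot> Fmult KE (s, t) = amap F ?U \<cdot> (kap (shape s @ shape t) \<cdot> E.T_mult (shape s) (shape t))"
    unfolding kappa_def using s t k FU by (simp add: shape_tree_sum tensor_functor_simps(3))
  also have "\<dots> = (amap F ?U \<cdot> amap F ?J) \<cdot> (Fmult F (?fs, ?ft) \<cdot> (kap (shape s) \<boxtimes> kap (shape t)))"
    unfolding kap_join[OF ns ms] using FU FJ Fm k by simp
  also have "amap F ?U \<cdot> amap F ?J = amap F (?S \<boxtimes>\<^bsub>Omega2\<^esub> ?T)"
    unfolding UJ[symmetric] by (rule amap_comp[OF rigid_hom[OF J] rigid_hom[OF rst'], symmetric])
  also have "amap F (?S \<boxtimes>\<^bsub>Omega2\<^esub> ?T) \<cdot> (Fmult F (?fs, ?ft) \<cdot> (kap (shape s) \<boxtimes> kap (shape t))) =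
      (amap F (?S \<boxtimes>\<^bsub>Omega2\<^esub> ?T) \<cdot> Fmult F (?fs, ?ft)) \<cdot> (kap (shape s) \<boxtimes> kap (shape t))"
    using amap_hom[OF tensor_tree_hom[OF rigid_hom[OF rs] rigid_hom[OF rt]]] Fm k by simp
  also have "\<dots> = (Fmult F (s, t) \<cdot> (amap F ?S \<boxtimes> amap F ?T)) \<cdot> (kap (shape s) \<boxtimes> kap (shape t))"
    unfolding Fmult_natural[OF rigid_hom[OF rs] rigid_hom[OF rt]] ..
  also have "\<dots> = Fmult F (s, t) \<cdot> (kappa s \<boxtimes> kappa t)"
    using s t hs ht k Fm' by (simp add: kappa_def)
  finally show ?thesis .
qed

text \<open>Naturality squares can be composed, and also tensored since the comparison respects
  structure maps by \<open>kappa_mult\<close>; so generators suffice. Rigid arrows are covered by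
  \<open>kappa_eq\<close>, the structure maps of the cosimplicial monoid of trees by the
  computations with right unitors made for the counit.\<close>

lemma kappa_natural:
  assumes "G \<in> hom Omega2 s t"
  shows "kappa t \<cdot> amap KE G = amap F G \<cdot> kappa s"
proof -
  \<comment> \<open>\<open>generated\<close> does not record the ends of an arrow, so the induction
    speaks of \<open>source\<close> and \<open>target\<close>.\<close>
  have "kappa (target G) \<cdot> amap KE G = amap F G \<cdot> kappa (source G)" if "generated G" for G
    using that
  proof (induction rule: generated.induct)
    case (generated_rigid s t G)
    note G = rigid_hom[OF generated_rigid]
    note P = hom_pruned[OF G]
    have shape: "shape s = shape t" by (rule rigid_shape[OF generated_rigid])
    note rs = rigid_straighten[OF P(1)]
    \<comment> \<open>Composing with G straightens t in a second way, through which
      \<open>kappa t\<close> is computed.\<close>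
    have "rigid (forest (shape t)) t (G \<cdot>\<^bsub>Omega2\<^esub> straighten s)"
      using rigid_comp[OF rs generated_rigid] by (simp only: shape)
    then have "kappa t = amap F (G \<cdot>\<^bsub>Omega2\<^esub> straighten s) \<cdot> kap (shape t)" by (rule kappa_eq)
    also have "\<dots> = amap F G \<cdot> kappa s"
      unfolding amap_comp[OF rigid_hom[OF rs] G]
      using P amap_hom[OF G] amap_hom[OF rigid_hom[OF rs]] kap_arr[OF shape_positive[OF P(1)]]
      by (simp add: kappa_def shape)
    finally have "kappa t = amap F G \<cdot> kappa s" .
    moreover have "amap KE G = Ident C (E.T (shape t))"
      unfolding tensor_functor_simps(2)[OF G] E.T_arr_rigid[OF generated_rigid] shape ..
    ultimately show ?case using P Omega2_homD[OF G] kappa_arr[OF P(2)] by simp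
  next
    case (generated_Smap d)
    then have d: "d \<in> hom Delta (source d) (target d)" using Delta.arr_hom by simp
    have n: "source d \<ge> 1" "target d \<ge> 1" using generated_Smap by (auto simp: Delta_arr)
    note S = Smap(1)[OF generated_Smap]
    have M: "E.M_arr d = amap F (Smap d)" using generated_Smap by (simp add: eval_obj_simps)
    have "kappa (corolla (target d)) \<cdot> amap KE (Smap d) = amap F (Smap d) \<cdot> kappa (corolla (source d))"
      unfolding E.amap_K_Smap[OF d] M kappa_corolla[OF n(1)] kappa_corolla[OF n(2)]
      using amap_hom[OF S] by (simp add: D.runit_natural_arr)
    then show ?case using Omega2_homD[OF S] by simp
  next
    case (generated_mult n)
    then have n: "n \<ge> 1" .
    note P = corolla_pruned[OF n]
    let ?c = "corolla n" and ?m = "mult (Smon n)"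
    note m = mult_Smon(1)[OF n]
    have Fm: "Fmult F (?c, ?c) \<in> Arr C" "Dom C (Fmult F (?c, ?c)) = omap F ?c \<otimes> omap F ?c"
      "Cod C (Fmult F (?c, ?c)) = omap F (tree_sum ?c ?c)"
      using Fmult_arr[of ?c ?c] P by simp_all
    have iso: "Fmult KE (?c, ?c) \<in> isos C (omap KE ?c \<otimes> omap KE ?c) (omap KE (tree_sum ?c ?c))"
      using KE.Fmult_iso[of ?c ?c] P by simp
    have KEm: "amap KE ?m \<in> hom C (omap KE (tree_sum ?c ?c)) (omap KE ?c)" by (rule KE.amap_hom[OF m])
    have kc: "kappa ?c \<in> hom C (omap KE ?c) (omap F ?c)" by (rule D.isos_hom[OF kappa_iso[OF P]])
    have kcc: "kappa (tree_sum ?c ?c) \<in> hom C (omap KE (tree_sum ?c ?c)) (omap F (tree_sum ?c ?c))"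
      by (rule D.isos_hom[OF kappa_iso[OF tree_sum_pruned[OF P P]]])
    have "(kappa ?c \<cdot> amap KE ?m) \<cdot> Fmult KE (?c, ?c) = RUnit C (omap F ?c) \<cdot> (amap KE ?m \<cdot> Fmult KE (?c, ?c))"
      using D.hom_arr[OF kc] D.hom_arr[OF KEm] D.iso_arr[OF iso] unfolding kappa_corolla[OF n]
      by (simp del: omap_KE kappa_arr)
    \<comment> \<open>On corollas the comparison is the right unitor, so this is the
      multiplicativity of the counit for the evaluation of F.\<close>
    also have "\<dots> = mult (omap (eval_obj C F) n) \<cdot> (RUnit C (omap F ?c) \<boxtimes> RUnit C (omap F ?c))"
      using E.runit_K_mult[OF n] n by simp
    also have "\<dots> = amap F ?m \<cdot> (Fmult F (?c, ?c) \<cdot> (kappa ?c \<boxtimes> kappa ?c))"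
      unfolding kappa_corolla[OF n] using n Fm amap_hom[OF m] P by (simp add: eval_obj_simps)
    also have "\<dots> = (amap F ?m \<cdot> kappa (tree_sum ?c ?c)) \<cdot> Fmult KE (?c, ?c)"
      unfolding kappa_mult[OF P P, symmetric]
      using amap_hom[OF m] D.hom_arr[OF kcc] D.iso_arr[OF iso] by (simp del: omap_KE kappa_arr)
    finally have eq: "(kappa ?c \<cdot> amap KE ?m) \<cdot> Fmult KE (?c, ?c) = (amap F ?m \<cdot> kappa (tree_sum ?c ?c)) \<cdot> Fmult KE (?c, ?c)" .
    \<comment> \<open>The square was obtained after precomposition with a structure map of the
      tensor functor; that map is invertible and is cancelled.\<close>
    have "kappa ?c \<cdot> amap KE ?m = amap F ?m \<cdot> kappa (tree_sum ?c ?c)"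
      by (rule D.iso_cancel_right[OF iso _ _ _ _ eq])
        (use D.hom_arr[OF kc] D.hom_arr[OF KEm] D.hom_arr[OF kcc] amap_hom[OF m] in \<open>simp_all del: omap_KE kappa_arr\<close>)
    then show ?case using Omega2_homD[OF m] by simp
  next
    case (generated_unit n)
    then have n: "n \<ge> 1" .
    note u = unit_Smon[OF n]
    have "kappa (corolla n) \<cdot> amap KE (unit (Smon n)) = unit (omap (eval_obj C F) n)"
      unfolding kappa_corolla[OF n] using E.runit_K_unit[OF n] n by simp
    also have "\<dots> = amap F (unit (Smon n)) \<cdot> kappa empty_tree"
      using n by (simp add: eval_obj_simps kappa_empty)
    finally show ?case using Omega2_homD[OF u] by simp
  next
    case (generated_comp G s t H u)
    note GH = generated_comp(1,2)
    note P = hom_pruned[OF GH(1)] hom_pruned[OF GH(2)]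
    note s = Omega2_homD[OF GH(1)] Omega2_homD[OF GH(2)] Omega2_homD[OF Omega2.comp_hom[OF GH]]
    note h = amap_hom[OF GH(1)] amap_hom[OF GH(2)] KE.amap_hom[OF GH(1)] KE.amap_hom[OF GH(2)]
    note h' = D.hom_arr[OF h(1)] D.hom_arr[OF h(2)] D.hom_arr[OF h(3)] D.hom_arr[OF h(4)]
    have IH: "kappa t \<cdot> amap KE G = amap F G \<cdot> kappa s" "kappa u \<cdot> amap KE H = amap F H \<cdot> kappa t"
      using generated_comp(5,6) s by simp_all
    note k = kappa_arr[OF P(1)] kappa_arr[OF P(2)] kappa_arr[OF P(4)]
    have "kappa u \<cdot> (amap KE H \<cdot> amap KE G) = (kappa u \<cdot> amap KE H) \<cdot> amap KE G"
      using h' k P by simp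
    also have "\<dots> = amap F H \<cdot> (kappa t \<cdot> amap KE G)" unfolding IH(2) using h' k P by simp
    also have "\<dots> = (amap F H \<cdot> amap F G) \<cdot> kappa s" unfolding IH(1) using h' k P by simp
    finally have "kappa u \<cdot> amap KE (H \<cdot>\<^bsub>Omega2\<^esub> G) = amap F (H \<cdot>\<^bsub>Omega2\<^esub> G) \<cdot> kappa s"
      unfolding amap_comp[OF GH] KE.amap_comp[OF GH] .
    then show ?case using s by simp
  next
    case (generated_tensor G s s' H t t')
    note GH = generated_tensor(1,2)
    note P = hom_pruned[OF GH(1)] hom_pruned[OF GH(2)]
    note T = tensor_tree_hom[OF GH]
    note s = Omega2_homD[OF GH(1)] Omega2_homD[OF GH(2)] Omega2_homD[OF T]
    note h = amap_hom[OF GH(1)] amap_hom[OF GH(2)] KE.amap_hom[OF GH(1)] KE.amap_hom[OF GH(2)]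
      amap_hom[OF T] KE.amap_hom[OF T]
    note h' = D.hom_arr[OF h(1)] D.hom_arr[OF h(2)] D.hom_arr[OF h(3)] D.hom_arr[OF h(4)]
      D.hom_arr[OF h(5)] D.hom_arr[OF h(6)]
    have IH: "kappa s' \<cdot> amap KE G = amap F G \<cdot> kappa s" "kappa t' \<cdot> amap KE H = amap F H \<cdot> kappa t"
      using generated_tensor(5,6) s by simp_all
    have k: "kappa x \<in> Arr C" "Dom C (kappa x) = omap KE x" "Cod C (kappa x) = omap F x"
      if "x \<in> pruned_trees" for x using D.iso_arr[OF kappa_iso[OF that]] by simp_all
    have Fm: "Fmult F (x, y) \<in> Arr C" "Dom C (Fmult F (x, y)) = omap F x \<otimes> omap F y"
      "Cod C (Fmult F (x, y)) = omap F (tree_sum x y)"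
      "Fmult KE (x, y) \<in> Arr C" "Dom C (Fmult KE (x, y)) = omap KE x \<otimes> omap KE y"
      "Cod C (Fmult KE (x, y)) = omap KE (tree_sum x y)" if "x \<in> pruned_trees" "y \<in> pruned_trees" for x y
      using Fmult_arr[of x y] KE.Fmult_arr[of x y] that by (simp_all del: omap_KE)
    have iso: "Fmult KE (s, t) \<in> isos C (omap KE s \<otimes> omap KE t) (omap KE (tree_sum s t))"
      using KE.Fmult_iso[of s t] P by (simp del: omap_KE)
    note [simp del] = omap_KE kappa_arr
    note [simp] = k Fm tree_sum_pruned P h'
    let ?T = "G \<boxtimes>\<^bsub>Omega2\<^esub> H"
    have "(kappa (tree_sum s' t') \<cdot> amap KE ?T) \<cdot> Fmult KE (s, t) =
        kappa (tree_sum s' t') \<cdot> (amap KE ?T \<cdot> Fmult KE (s, t))" by simp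
    also have "\<dots> = (kappa (tree_sum s' t') \<cdot> Fmult KE (s', t')) \<cdot> (amap KE G \<boxtimes> amap KE H)"
      unfolding KE.Fmult_natural[OF GH, symmetric] by simp
    also have "\<dots> = Fmult F (s', t') \<cdot> ((kappa s' \<cdot> amap KE G) \<boxtimes> (kappa t' \<cdot> amap KE H))"
      unfolding kappa_mult[OF P(2,4)] by simp
    also have "\<dots> = (Fmult F (s', t') \<cdot> (amap F G \<boxtimes> amap F H)) \<cdot> (kappa s \<boxtimes> kappa t)"
      unfolding IH by simp
    also have "\<dots> = amap F ?T \<cdot> (Fmult F (s, t) \<cdot> (kappa s \<boxtimes> kappa t))"
      unfolding Fmult_natural[OF GH] by simp
    also have "\<dots> = (amap F ?T \<cdot> kappa (tree_sum s t)) \<cdot> Fmult KE (s, t)"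
      unfolding kappa_mult[OF P(1,3), symmetric] by simp
    finally have eq: "(kappa (tree_sum s' t') \<cdot> amap KE ?T) \<cdot> Fmult KE (s, t) =
      (amap F ?T \<cdot> kappa (tree_sum s t)) \<cdot> Fmult KE (s, t)" .
    have "kappa (tree_sum s' t') \<cdot> amap KE ?T = amap F ?T \<cdot> kappa (tree_sum s t)"
      by (rule D.iso_cancel_right[OF iso _ _ _ _ eq]) simp_all
    then show ?case using s by simp
  qed
  from this[OF generated_arr[OF assms]] show ?thesis using Omega2_homD[OF assms] by simp
qed

lemma kappa_monoidal: "monoidal_transformation Omega2 C KE F kappa"
proof
  show "kappa \<in> extensional (Obj Omega2)" by (simp add: kappa_def)
  show "kappa (Unit Omega2) \<cdot> Funit KE = Funit F"
    using Funit_arr by (simp add: kappa_empty tensor_functor_simps)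
  fix s t G
  { assume "s \<in> Obj Omega2"
    then show "kappa s \<in> hom C (omap KE s) (omap F s)" using D.isos_hom[OF kappa_iso] by simp
    assume "t \<in> Obj Omega2"
    with \<open>s \<in> Obj Omega2\<close> show "kappa (s \<otimes>\<^bsub>Omega2\<^esub> t) \<cdot> Fmult KE (s, t) = Fmult F (s, t) \<cdot> (kappa s \<boxtimes> kappa t)"
      using kappa_mult by simp }
  show "G \<in> hom Omega2 s t \<Longrightarrow> kappa t \<cdot> amap KE G = amap F G \<cdot> kappa s" by (rule kappa_natural)
qed

end

section \<open>The equivalence\<close>

lemma functor_category_simps:
  "Obj (functor_category A B) = {F. category_functor A B F}"
  "Ident (functor_category A B) F = Arrow F F (\<lambda>x \<in> Obj A. Ident B (omap F x))"
  "Comp (functor_category A B) \<beta> \<alpha> = Arrow (source \<alpha>) (target \<beta>)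
    (\<lambda>x \<in> Obj A. underlying \<beta> x \<cdot>\<^bsub>B\<^esub> underlying \<alpha> x)"
  by (simp_all add: functor_category_def)

lemma functor_category_iso:
  assumes eta: "natural_transformation A B F G \<eta>"
    and iso: "\<And>x. x \<in> Obj A \<Longrightarrow> \<eta> x \<in> isos B (omap F x) (omap G x)"
  shows "Arrow F G \<eta> \<in> isos (functor_category A B) F G"
proof -
  interpret eta: natural_transformation A B F G \<eta> by fact
  let ?\<theta> = "\<lambda>x \<in> Obj A. inverse_arr B (\<eta> x)"
  have h: "Arrow F G \<eta> \<in> hom (functor_category A B) F G" "Arrow G F ?\<theta> \<in> hom (functor_category A B) G F"
    using eta natural_transformation_inverse[OF eta iso] by (auto simp: hom_functor_category)
  have inv: "inverse_arr B (\<eta> x) \<cdot>\<^bsub>B\<^esub> \<eta> x = Ident B (omap F x)"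
    "\<eta> x \<cdot>\<^bsub>B\<^esub> inverse_arr B (\<eta> x) = Ident B (omap G x)" if "x \<in> Obj A" for x
    using eta.F.B.iso_arr[OF iso[OF that]] by auto
  show ?thesis
    unfolding isos_def
    using h inv by (auto intro!: bexI[OF _ h(2)] simp: functor_category_simps fun_eq_iff)
qed

lemma monoidal_functor_category_iso:
  assumes eta: "monoidal_transformation C D F G \<eta>"
    and iso: "\<And>x. x \<in> Obj C \<Longrightarrow> \<eta> x \<in> isos D (omap F x) (omap G x)"
  shows "Arrow F G \<eta> \<in> isos (monoidal_functor_category C D) F G"
proof -
  interpret eta: monoidal_transformation C D F G \<eta> by fact
  let ?\<theta> = "\<lambda>x \<in> Obj C. inverse_arr D (\<eta> x)"
  have h: "Arrow F G \<eta> \<in> hom (monoidal_functor_category C D) F G"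
    "Arrow G F ?\<theta> \<in> hom (monoidal_functor_category C D) G F"
    using eta monoidal_transformation_inverse[OF eta iso] by (auto simp: hom_monoidal_functor_category)
  have inv: "inverse_arr D (\<eta> x) \<cdot>\<^bsub>D\<^esub> \<eta> x = Ident D (omap F x)"
    "\<eta> x \<cdot>\<^bsub>D\<^esub> inverse_arr D (\<eta> x) = Ident D (omap G x)" if "x \<in> Obj C" for x
    using eta.F.D.iso_arr[OF iso[OF that]] by auto
  show ?thesis
    unfolding isos_def
    using h inv by (auto intro!: bexI[OF _ h(2)] simp: fun_eq_iff)
qed

text \<open>The inverse arrow preserves multiplication and unit automatically, by composing the two
  equations for f with it.\<close>

lemma Mon_iso:
  assumes M: "monoid_in C M" and N: "monoid_in C N" and f: "f \<in> monoid_homs C M N"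
    and iso: "f \<in> isos C (carr M) (carr N)"
  shows "Arrow M N f \<in> isos (Mon C) M N"
proof -
  interpret M: monoid_in C M by fact
  interpret N: monoid_in C N by fact
  let ?g = "inverse_arr C f"
  have f': "f \<cdot>\<^bsub>C\<^esub> mult M = mult N \<cdot>\<^bsub>C\<^esub> (f \<boxtimes>\<^bsub>C\<^esub> f)" "f \<cdot>\<^bsub>C\<^esub> unit M = unit N"
    using f by (auto simp: monoid_homs_def)
  note i = M.iso_arr[OF iso]
  have "?g \<cdot>\<^bsub>C\<^esub> mult N = ?g \<cdot>\<^bsub>C\<^esub> ((mult N \<cdot>\<^bsub>C\<^esub> (f \<boxtimes>\<^bsub>C\<^esub> f)) \<cdot>\<^bsub>C\<^esub> (?g \<boxtimes>\<^bsub>C\<^esub> ?g))"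
    using i by simp
  also have "\<dots> = (?g \<cdot>\<^bsub>C\<^esub> f) \<cdot>\<^bsub>C\<^esub> (mult M \<cdot>\<^bsub>C\<^esub> (?g \<boxtimes>\<^bsub>C\<^esub> ?g))"
    unfolding f'(1)[symmetric] using i iso by simp
  also have "\<dots> = mult M \<cdot>\<^bsub>C\<^esub> (?g \<boxtimes>\<^bsub>C\<^esub> ?g)" unfolding i(7) using i by simp
  finally have "?g \<cdot>\<^bsub>C\<^esub> mult N = mult M \<cdot>\<^bsub>C\<^esub> (?g \<boxtimes>\<^bsub>C\<^esub> ?g)" .
  moreover have "?g \<cdot>\<^bsub>C\<^esub> unit N = unit M"
    unfolding f'(2)[symmetric] using M.iso_cancel(1)[OF iso] by simp
  ultimately have "?g \<in> monoid_homs C N M"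
    using M.inverse_arr_hom[OF iso] by (simp add: monoid_homs_def)
  then have h: "Arrow M N f \<in> hom (Mon C) M N" "Arrow N M ?g \<in> hom (Mon C) N M"
    using M N f by (auto simp: hom_Mon)
  show ?thesis
    unfolding isos_def using h i by (auto intro!: bexI[OF _ h(2)])
qed

text \<open>Naturality of the comparison in the functor. On forests it follows by induction, because
  \<theta> commutes with structure maps; naturality of \<theta> at \<open>straighten\<close> carries
  it over to all trees.\<close>

lemma kappa_natural_functor:
  assumes "monoidal_transformation Omega2 C F G \<theta>" and t: "t \<in> pruned_trees"
  shows "\<theta> t \<cdot>\<^bsub>C\<^esub> tree_functor.kappa C F t =
    tree_functor.kappa C G t \<cdot>\<^bsub>C\<^esub> tensor_nat C (eval_arr C F G \<theta>) (shape t)"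
proof -
  interpret theta: monoidal_transformation Omega2 C F G \<theta> by fact
  interpret F: tree_functor C F by unfold_locales
  interpret G: tree_functor C G by unfold_locales
  have C: "monoidal_category C" by unfold_locales
  interpret E: cosimplicial_monoid_map C "eval_obj C F" "eval_obj C G" "eval_arr C F G \<theta>"
    by (rule cosimplicial_monoid_mapI[OF C eval_arr_natural]) fact
  have a: "E.a n = \<theta> (corolla n)" if "n \<ge> 1" for n using that by (simp add: eval_arr_def)
  have th: "\<theta> s \<in> Arr C" "Dom C (\<theta> s) = omap F s" "Cod C (\<theta> s) = omap G s" if "s \<in> pruned_trees" for s
    using theta.component_arr[of s] that by simp_all
  have kap: "\<theta> (forest ns) \<cdot>\<^bsub>C\<^esub> F.kap ns = G.kap ns \<cdot>\<^bsub>C\<^esub> E.T_nat ns" if "\<forall>n \<in> set ns. n \<ge> 1" for ns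
    using that
  proof (induction ns)
    case Nil
    then show ?case using theta.component_unit theta.G.Funit_arr by simp
  next
    case (Cons n ns)
    then have n: "n \<ge> 1" "\<forall>n \<in> set ns. n \<ge> 1" by auto
    note P = corolla_pruned[OF n(1)] forest_pruned[OF n(2)]
    have Fm: "Fmult H (corolla n, forest ns) \<in> Arr C"
      "Dom C (Fmult H (corolla n, forest ns)) = omap H (corolla n) \<otimes>\<^bsub>C\<^esub> omap H (forest ns)"
      "Cod C (Fmult H (corolla n, forest ns)) = omap H (tree_sum (corolla n) (forest ns))"
      if "tree_functor C H" for H
      using monoidal_functor.Fmult_arr[OF tree_functor.axioms[OF that], of "corolla n" "forest ns"] P by simp_all
    note FmF = Fm[OF F.tree_functor_axioms] and FmG = Fm[OF G.tree_functor_axioms]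
    note k = F.kap_arr[OF n(2)] G.kap_arr[OF n(2)] E.T_nat_arr[OF n(2)]
    let ?c = "corolla n" and ?s = "forest ns"
    have "\<theta> (forest (n # ns)) \<cdot>\<^bsub>C\<^esub> F.kap (n # ns) =
        (\<theta> (tree_sum ?c ?s) \<cdot>\<^bsub>C\<^esub> Fmult F (?c, ?s)) \<cdot>\<^bsub>C\<^esub> (Ident C (omap F ?c) \<boxtimes>\<^bsub>C\<^esub> F.kap ns)"
      using th P FmF k by simp
    also have "\<dots> = Fmult G (?c, ?s) \<cdot>\<^bsub>C\<^esub> (\<theta> ?c \<boxtimes>\<^bsub>C\<^esub> (\<theta> ?s \<cdot>\<^bsub>C\<^esub> F.kap ns))"
      using theta.component_mult[of ?c ?s] th P FmG k by simp
    also have "\<dots> = G.kap (n # ns) \<cdot>\<^bsub>C\<^esub> E.T_nat (n # ns)"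
      unfolding Cons.IH[OF n(2)] using th P FmG k a[OF n(1)] by simp
    finally show ?case .
  qed
  note pos = shape_positive[OF t]
  have r: "straighten t \<in> hom Omega2 (forest (shape t)) t" by (rule rigid_hom[OF rigid_straighten[OF t]])
  note h = theta.F.D.hom_arr[OF theta.F.amap_hom[OF r]] theta.F.D.hom_arr[OF theta.G.amap_hom[OF r]]
  note k = F.kap_arr[OF pos] G.kap_arr[OF pos] E.T_nat_arr[OF pos]
  note P = forest_pruned[OF pos]
  have "\<theta> t \<cdot>\<^bsub>C\<^esub> F.kappa t = (\<theta> t \<cdot>\<^bsub>C\<^esub> amap F (straighten t)) \<cdot>\<^bsub>C\<^esub> F.kap (shape t)"
    using t th h k by (simp add: F.kappa_def)
  also have "\<dots> = amap G (straighten t) \<cdot>\<^bsub>C\<^esub> (\<theta> (forest (shape t)) \<cdot>\<^bsub>C\<^esub> F.kap (shape t))"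
    unfolding theta.natural[OF r] using th[OF P] h k by simp
  also have "\<dots> = G.kappa t \<cdot>\<^bsub>C\<^esub> E.T_nat (shape t)"
    unfolding kap[OF pos] using t h k by (simp add: G.kappa_def)
  finally show ?thesis .
qed

lemma naturally_isomorphic_inverse:
  assumes "natural_transformation A B F G \<eta>" "\<And>x. x \<in> Obj A \<Longrightarrow> \<eta> x \<in> isos B (omap F x) (omap G x)"
  shows "naturally_isomorphic A B G F"
proof -
  interpret eta: natural_transformation A B F G \<eta> by fact
  show ?thesis
    unfolding naturally_isomorphic_def
    using natural_transformation_inverse[OF assms] eta.F.B.inverse_arr_iso[OF assms(2)]
    by (intro exI[of _ "\<lambda>x \<in> Obj A. inverse_arr B (\<eta> x)"]) simp
qed

lemma comp_functor_simps:
  "x \<in> Obj A \<Longrightarrow> omap (comp_functor A G F) x = omap G (omap F x)"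
  "f \<in> Arr A \<Longrightarrow> amap (comp_functor A G F) f = amap G (amap F f)"
  by (simp_all add: comp_functor_def compose_def)

lemma id_functor_simps:
  "x \<in> Obj A \<Longrightarrow> omap (id_functor A) x = x"
  "f \<in> Arr A \<Longrightarrow> amap (id_functor A) f = f"
  by (simp_all add: id_functor_def)

lemma tensor_functor_functor_simps:
  "category_functor Delta (Mon C) M \<Longrightarrow> omap (tensor_functor_functor C) M = tensor_functor C M"
  "Arrow M N \<alpha> \<in> Arr (cosimplicial_monoids C) \<Longrightarrow> amap (tensor_functor_functor C) (Arrow M N \<alpha>) =
    Arrow (tensor_functor C M) (tensor_functor C N) (\<lambda>t \<in> Obj Omega2. tensor_nat C \<alpha> (shape t))"
  by (simp_all add: tensor_functor_functor_def)

theorem proposition5p0p12: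
  fixes C :: "('o, 'a) moncat"
  assumes "monoidal_category C"
  shows "equivalence_of_categories
    (monoidal_functor_category Omega2 C) (cosimplicial_monoids C) (evaluation C)"
proof -
  let ?A = "monoidal_functor_category Omega2 C" and ?B = "cosimplicial_monoids C"
  let ?E = "evaluation C" and ?G = "tensor_functor_functor C"
  interpret C: monoidal_category C by fact
  interpret E: category_functor ?A ?B ?E by (rule evaluation_functor[OF assms])
  interpret G: category_functor ?B ?A ?G by (rule tensor_functor_functor[OF assms])
  interpret GE: category_functor ?A ?A "comp_functor ?A ?G ?E"
    by (rule comp_functor_functor) unfold_locales
  interpret EG: category_functor ?B ?B "comp_functor ?B ?E ?G"
    by (rule comp_functor_functor) unfold_locales
  interpret idA: category_functor ?A ?A "id_functor ?A" by (rule id_functor_functor) unfold_locales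
  interpret idB: category_functor ?B ?B "id_functor ?B" by (rule id_functor_functor) unfold_locales
  have objA: "monoidal_functor Omega2 C F" if "F \<in> Obj ?A" for F using that by simp
  have GE_obj: "omap (comp_functor ?A ?G ?E) F = tensor_functor C (eval_obj C F)" if "F \<in> Obj ?A" for F
    using that E.omap_obj[OF that]
    by (simp add: comp_functor_simps(1) evaluation_simps tensor_functor_functor_simps)
  let ?kappa = "\<lambda>F \<in> Obj ?A. Arrow (tensor_functor C (eval_obj C F)) F (tree_functor.kappa C F)"
  have kappa_iso: "?kappa F \<in> isos ?A (omap (comp_functor ?A ?G ?E) F) (omap (id_functor ?A) F)"
    if F: "F \<in> Obj ?A" for F
  proof -
    interpret F: tree_functor C F using objA[OF F] by (simp add: tree_functor_def)
    show ?thesis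
      unfolding GE_obj[OF F] id_functor_simps(1)[OF F]
      using monoidal_functor_category_iso[OF F.kappa_monoidal F.kappa_iso] F by simp
  qed
  have "natural_transformation ?A ?A (comp_functor ?A ?G ?E) (id_functor ?A) ?kappa"
  proof
    show "?kappa \<in> extensional (Obj ?A)" by simp
    show "?kappa F \<in> hom ?A (omap (comp_functor ?A ?G ?E) F) (omap (id_functor ?A) F)" if "F \<in> Obj ?A" for F
      by (rule E.A.isos_hom[OF kappa_iso[OF that]])
    fix \<alpha> F G
    assume \<alpha>: "\<alpha> \<in> hom ?A F G"
    then obtain \<theta> where \<theta>: "\<alpha> = Arrow F G \<theta>" "monoidal_transformation Omega2 C F G \<theta>"
      by (auto simp: hom_monoidal_functor_category)
    note aa = E.A.hom_arr(1)[OF \<alpha>] and FG = E.A.hom_obj[OF \<alpha>]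
    have "amap ?E \<alpha> \<in> Arr ?B" using E.amap_hom[OF \<alpha>] by (rule E.B.hom_arr)
    then have GEa: "amap (comp_functor ?A ?G ?E) \<alpha> =
      Arrow (tensor_functor C (eval_obj C F)) (tensor_functor C (eval_obj C G))
        (\<lambda>t \<in> Obj Omega2. tensor_nat C (eval_arr C F G \<theta>) (shape t))"
      using aa unfolding comp_functor_simps(2)[OF aa] unfolding \<theta>(1)
      by (simp add: evaluation_simps(2) tensor_functor_functor_simps(2))
    show "?kappa G \<cdot>\<^bsub>?A\<^esub> amap (comp_functor ?A ?G ?E) \<alpha> = amap (id_functor ?A) \<alpha> \<cdot>\<^bsub>?A\<^esub> ?kappa F"
      unfolding GEa id_functor_simps(2)[OF aa]
      using FG \<theta>(1) kappa_natural_functor[OF \<theta>(2)] by (auto simp: fun_eq_iff)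
  qed
  \<comment> \<open>The comparison runs towards the identity functor, whereas the equivalence asks
    for an isomorphism out of it.\<close>
  then have unit: "naturally_isomorphic ?A ?A (id_functor ?A) (comp_functor ?A ?G ?E)"
    by (rule naturally_isomorphic_inverse[OF _ kappa_iso])
  have EG_obj: "omap (comp_functor ?B ?E ?G) M = eval_obj C (tensor_functor C M)" if "M \<in> Obj ?B" for M
    using that G.omap_obj[OF that]
    by (simp add: comp_functor_simps(1) evaluation_simps tensor_functor_functor_simps)
  let ?eps = "\<lambda>M \<in> Obj ?B. Arrow (eval_obj C (tensor_functor C M)) M (cosimplicial_monoid.counit C M)"
  have eps_iso: "?eps M \<in> isos ?B (omap (comp_functor ?B ?E ?G) M) (omap (id_functor ?B) M)"
    if M: "M \<in> Obj ?B" for M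
  proof -
    interpret M: cosimplicial_monoid C M using M by (simp add: cosimplicial_monoidI[OF assms])
    interpret counit: natural_transformation Delta "Mon C" "eval_obj C M.K" M M.counit
      by (rule M.counit_natural)
    have "M.counit n \<in> isos (Mon C) (omap (eval_obj C M.K) n) (omap M n)" if "n \<in> Obj Delta" for n
    proof -
      have n: "n \<ge> 1" using that by simp
      have "Arrow (omap (eval_obj C M.K) n) (omap M n) (RUnit C (carr (omap M n))) \<in> isos (Mon C) (omap (eval_obj C M.K) n) (omap M n)"
      proof (rule Mon_iso)
        show "monoid_in C (omap (eval_obj C M.K) n)" using counit.F.omap_obj[OF that] by simp
        show "monoid_in C (omap M n)" by (rule M.monoid_M[OF n])
        show "RUnit C (carr (omap M n)) \<in> monoid_homs C (omap (eval_obj C M.K) n) (omap M n)"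
          using counit.component_hom[OF that] n by (auto simp: hom_Mon M.counit_def)
        show "RUnit C (carr (omap M n)) \<in> isos C (carr (omap (eval_obj C M.K) n)) (carr (omap M n))"
          using n C.runit_iso by (simp add: eval_obj_simps M.omap_K_corolla)
      qed
      then show ?thesis using n by (simp add: M.counit_def)
    qed
    then show ?thesis
      unfolding EG_obj[OF M] id_functor_simps(1)[OF M]
      using functor_category_iso[OF M.counit_natural] M by (simp add: cosimplicial_monoids_def)
  qed
  have "natural_transformation ?B ?B (comp_functor ?B ?E ?G) (id_functor ?B) ?eps"
  proof
    show "?eps \<in> extensional (Obj ?B)" by simp
    show "?eps M \<in> hom ?B (omap (comp_functor ?B ?E ?G) M) (omap (id_functor ?B) M)" if "M \<in> Obj ?B" for M
      by (rule E.B.isos_hom[OF eps_iso[OF that]])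
    fix \<alpha> M N
    assume \<alpha>: "\<alpha> \<in> hom ?B M N"
    then obtain \<eta> where \<eta>: "\<alpha> = Arrow M N \<eta>" "natural_transformation Delta (Mon C) M N \<eta>"
      by (auto simp: hom_cosimplicial_monoids)
    interpret eta: cosimplicial_monoid_map C M N \<eta> by (rule cosimplicial_monoid_mapI[OF assms \<eta>(2)])
    note aa = E.B.hom_arr(1)[OF \<alpha>] and MN = E.B.hom_obj[OF \<alpha>]
    let ?T = "\<lambda>t \<in> Obj Omega2. tensor_nat C \<eta> (shape t)"
    have "amap ?G \<alpha> \<in> Arr ?A" using G.amap_hom[OF \<alpha>] by (rule E.A.hom_arr)
    then have EGa: "amap (comp_functor ?B ?E ?G) \<alpha> =
      Arrow (eval_obj C eta.M.K) (eval_obj C eta.N.K) (eval_arr C eta.M.K eta.N.K ?T)"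
      using aa unfolding comp_functor_simps(2)[OF aa] unfolding \<eta>(1)
      by (simp add: evaluation_simps(2) tensor_functor_functor_simps(2))
    have "eta.N.counit n \<cdot>\<^bsub>Mon C\<^esub> eval_arr C eta.M.K eta.N.K ?T n = \<eta> n \<cdot>\<^bsub>Mon C\<^esub> eta.M.counit n"
      if "n \<ge> 1" for n
    proof -
      \<comment> \<open>On the corolla with n leaves the induced transformation is the component at
        n tensored with I, so the square to be checked is naturality of the right unitor.\<close>
      have "RUnit C (carr (omap N n)) \<cdot>\<^bsub>C\<^esub> (eta.a n \<boxtimes>\<^bsub>C\<^esub> Ident C (Unit C)) = eta.a n \<cdot>\<^bsub>C\<^esub> RUnit C (carr (omap M n))"
        using eta.component_arr_a[OF that] C.runit_natural_arr[of "eta.a n" "carr (omap N n)"] by simp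
      then show ?thesis
        using that arg_cong[OF eta.component(1)[OF that], of target]
        by (simp add: eta.M.counit_def eta.N.counit_def eval_arr_def del: upt_Suc)
    qed
    then show "?eps N \<cdot>\<^bsub>?B\<^esub> amap (comp_functor ?B ?E ?G) \<alpha> = amap (id_functor ?B) \<alpha> \<cdot>\<^bsub>?B\<^esub> ?eps M"
      unfolding EGa id_functor_simps(2)[OF aa] using MN \<eta>(1) by (auto simp: fun_eq_iff simp del: Mon_simps)
  qed
  then have counit: "naturally_isomorphic ?B ?B (comp_functor ?B ?E ?G) (id_functor ?B)"
    unfolding naturally_isomorphic_def using eps_iso by (intro exI[of _ ?eps]) blast
  show ?thesis
    unfolding equivalence_of_categories_def
    using E.category_functor_axioms G.category_functor_axioms unit counit by blast
qed

end
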